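(* Let $(M,J,g,\tilde g)$ be a $2n$-dimensional almost skew-Hermitian manifold with Levi-Civita connection $\nabla$ of $g$, and let $TM$ be its tangent bundle with the almost hypercomplex structure $H=(J_1,J_2,J_3)$ defined in the context. Then: 1. $(TM,J_1)$ is complex if and only if $M$ is flat. 2. For each $\beta\in\{2,3\}$, $(TM,J_\beta)$ is complex if and only if $M$ is flat and $J$ is parallel. 3. $(TM,H)$ is hypercomplex if and only if $M$ is flat and $J$ is parallel.
   Context: An almost skew-Hermitian manifold $(M^{2n},J,g,\tilde g)$ is a smooth $2n$-manifold with an almost complex structure $J$ and a pseudo-Riemannian metric $g$ of signature $(n,n)$ with $g(JX,JY)=-g(X,Y)$; $\tilde g=g(\cdot,J\cdot)$. $\nabla$ is the Levi-Civita connection of $g$ and $R(X,Y)=[\nabla_X,\nabla_Y]-\nabla_{[X,Y]}$; "$M$ is flat" means $R=0$; "$J$ is parallel" means $\nabla J=0$. Lifts: local coordinates $(x^i)$ on $M$ induce coordinates $(x^i,y^i)$ on $TM$, where $(y^i)$ are the components of a tangent vector with respect to $\partial/\partial x^i$. For a vector field $X=X^k\,\partial/\partial x^k$ on $M$, $X^V=X^k\,\partial/\partial y^k$ and $X^H=X^k\,\partial/\partial x^k-y^i\Gamma_{ij}^kX^j\,\partial/\partial y^k$, where $\Gamma_{ij}^k$ are the components of $\nabla$. The structure $H=(J_1,J_2,J_3)$ on $TM$: $J_1X^H=X^V$, $J_1X^V=-X^H$; $J_2X^H=(JX)^V$, $J_2X^V=(JX)^H$; $J_3=J_1\circ J_2$.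 $(TM,J_\alpha)$ is complex if the Nijenhuis tensor $N_\alpha(A,B)=[A,B]+J_\alpha[J_\alpha A,B]+J_\alpha[A,J_\alpha B]-[J_\alpha A,J_\alpha B]$ vanishes; $(TM,H)$ is hypercomplex if $N_1=N_2=N_3=0$. *)

theory Defs
  imports "HOL-Analysis.Analysis" "HOL-Library.Function_Algebras"
begin

text \<open>Functions into a real vector space form a real vector space; the additive structure
  comes from \<^theory>\<open>HOL-Library.Function_Algebras\<close>.\<close>

instantiation "fun" :: (type, real_vector) real_vector
begin

definition scaleR_fun_def: "a *\<^sub>R f = (\<lambda>x. a *\<^sub>R f x)"

instance
  by standard (auto simp: scaleR_fun_def plus_fun_def scaleR_add_right scaleR_add_left)

end

lemma scaleR_fun_apply [simp]: "(a *\<^sub>R f) x = a *\<^sub>R f x"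
  by (simp add: scaleR_fun_def)


section \<open>Smooth maps between open subsets of Euclidean spaces\<close>

text \<open>\<open>C\<^sup>k\<close> and \<open>C\<^sup>\<infinity>\<close> maps on an open set \<open>S\<close>, by iterated directional derivatives.\<close>

primrec Ck_on :: "nat \<Rightarrow> 'a::euclidean_space set \<Rightarrow> ('a \<Rightarrow> 'b::real_normed_vector) \<Rightarrow> bool" where
  "Ck_on 0 S f \<longleftrightarrow> continuous_on S f"
| "Ck_on (Suc k) S f \<longleftrightarrow> (\<forall>x\<in>S. f differentiable (at x)) \<and>
     (\<forall>v. Ck_on k S (\<lambda>x. frechet_derivative f (at x) v))"

definition smooth_on :: "'a::euclidean_space set \<Rightarrow> ('a \<Rightarrow> 'b::real_normed_vector) \<Rightarrow> bool" where
  "smooth_on S f \<longleftrightarrow> (\<forall>k. Ck_on k S f)"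


section \<open>Smooth manifolds\<close>

text \<open>A manifold modelled on the Euclidean space \<^typ>\<open>'e\<close> is given by an atlas. A chart is a pair
  consisting of its domain and its coordinate map; the values of the coordinate map off the
  domain are never used.\<close>

type_synonym ('p, 'e) chart = "'p set \<times> ('p \<Rightarrow> 'e)"

definition chart_inv :: "('p, 'e) chart \<Rightarrow> 'e \<Rightarrow> 'p" where
  "chart_inv c = inv_into (fst c) (snd c)"

definition transition :: "('p, 'e) chart \<Rightarrow> ('p, 'e) chart \<Rightarrow> 'e \<Rightarrow> 'e" where
  "transition c c' = snd c' \<circ> chart_inv c"

definition points :: "('p, 'e) chart set \<Rightarrow> 'p set" where
  "points A = (\<Union>c\<in>A. fst c)"

definition charts_at :: "('p, 'e) chart set \<Rightarrow> 'p \<Rightarrow> ('p, 'e) chart set" where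
  "charts_at A p = {c \<in> A. p \<in> fst c}"

definition smooth_atlas :: "('p, 'e::euclidean_space) chart set \<Rightarrow> bool" where
  "smooth_atlas A \<longleftrightarrow>
     (\<forall>c\<in>A. inj_on (snd c) (fst c)) \<and>
     (\<forall>c\<in>A. \<forall>c'\<in>A. open (snd c ` (fst c \<inter> fst c')) \<and>
        smooth_on (snd c ` (fst c \<inter> fst c')) (transition c c'))"

definition manifold_topology :: "('p, 'e::euclidean_space) chart set \<Rightarrow> 'p topology" where
  "manifold_topology A =
     topology (\<lambda>U. U \<subseteq> points A \<and> (\<forall>c\<in>A. open (snd c ` (U \<inter> fst c))))"

lemma openin_manifold_topology:
  assumes "smooth_atlas A"
  shows "openin (manifold_topology A) U \<longleftrightarrow>
    U \<subseteq> points A \<and> (\<forall>c\<in>A. open (snd c ` (U \<inter> fst c)))"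
proof -
  have inj: "inj_on (snd c) (fst c)" if "c \<in> A" for c
    using assms that by (auto simp: smooth_atlas_def)
  have int: "snd c ` (S \<inter> T \<inter> fst c) = snd c ` (S \<inter> fst c) \<inter> snd c ` (T \<inter> fst c)"
    if "c \<in> A" for c S T
  proof -
    have "snd c ` ((S \<inter> fst c) \<inter> (T \<inter> fst c)) = snd c ` (S \<inter> fst c) \<inter> snd c ` (T \<inter> fst c)"
      by (rule inj_on_image_Int[OF inj[OF that]]) auto
    moreover have "(S \<inter> fst c) \<inter> (T \<inter> fst c) = S \<inter> T \<inter> fst c"
      by auto
    ultimately show ?thesis by simp
  qed
  have un: "snd c ` (\<Union>K \<inter> fst c) = (\<Union>S\<in>K. snd c ` (S \<inter> fst c))"
    for c :: "('a, 'b) chart" and K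
    by auto
  have "istopology (\<lambda>U. U \<subseteq> points A \<and> (\<forall>c\<in>A. open (snd c ` (U \<inter> fst c))))"
    unfolding istopology_def by (auto simp: int un simp del: Int_assoc)
  then show ?thesis
    by (simp add: manifold_topology_def topology_inverse')
qed

definition smooth_manifold :: "('p, 'e::euclidean_space) chart set \<Rightarrow> bool" where
  "smooth_manifold A \<longleftrightarrow> smooth_atlas A \<and>
     Hausdorff_space (manifold_topology A) \<and> second_countable (manifold_topology A)"

definition smooth_fun :: "('p, 'e::euclidean_space) chart set \<Rightarrow> 'p set \<Rightarrow> ('p \<Rightarrow> real) \<Rightarrow> bool" where
  "smooth_fun A U f \<longleftrightarrow> (\<forall>c\<in>A. smooth_on (snd c ` (U \<inter> fst c)) (f \<circ> chart_inv c))"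


section \<open>Tangent vectors and vector fields\<close>

text \<open>A tangent vector at \<open>p\<close> is the family of its component vectors in all charts around \<open>p\<close>,
  which are related by the derivatives of the coordinate changes; the entries at all other
  charts are set to zero, so that the tangent space is a linear subspace of a function space.\<close>

type_synonym ('p, 'e) tvec = "('p, 'e) chart \<Rightarrow> 'e"
type_synonym ('p, 'e) vfield = "'p \<Rightarrow> ('p, 'e) tvec"

definition tangent_space ::
    "('p, 'e::euclidean_space) chart set \<Rightarrow> 'p \<Rightarrow> ('p, 'e) tvec set" where
  "tangent_space A p =
     {v. (\<forall>c. c \<notin> charts_at A p \<longrightarrow> v c = 0) \<and>
         (\<forall>c\<in>charts_at A p. \<forall>c'\<in>charts_at A p.
            v c' = frechet_derivative (transition c c') (at (snd c p)) (v c))}"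

definition vector_field ::
    "('p, 'e::euclidean_space) chart set \<Rightarrow> 'p set \<Rightarrow> ('p, 'e) vfield \<Rightarrow> bool" where
  "vector_field A U X \<longleftrightarrow>
     (\<forall>p\<in>U. X p \<in> tangent_space A p) \<and>
     (\<forall>c\<in>A. smooth_on (snd c ` (U \<inter> fst c)) (\<lambda>x. X (chart_inv c x) c))"

text \<open>The field on \<open>fst c\<close> with constant components \<open>w\<close> in the chart \<open>c\<close>; for \<open>w = i \<in> Basis\<close> it is
  the coordinate field \<open>\<partial>/\<partial>x\<^sup>i\<close>.\<close>

definition coord_field ::
    "('p, 'e::euclidean_space) chart set \<Rightarrow> ('p, 'e) chart \<Rightarrow> 'e \<Rightarrow> ('p, 'e) vfield" where
  "coord_field A c w p = (\<lambda>c'. if c' \<in> charts_at A p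
     then frechet_derivative (transition c c') (at (snd c p)) w else 0)"

text \<open>The derivative of a function along a tangent vector at \<open>p\<close>, computed in some chart around
  \<open>p\<close> (the value does not depend on the chart).\<close>

definition dir_deriv ::
    "('p, 'e::euclidean_space) chart set \<Rightarrow> 'p \<Rightarrow> ('p, 'e) tvec \<Rightarrow> ('p \<Rightarrow> real) \<Rightarrow> real" where
  "dir_deriv A p v f = (let c = (SOME c. c \<in> charts_at A p)
     in frechet_derivative (f \<circ> chart_inv c) (at (snd c p)) (v c))"

definition lie_bracket ::
    "('p, 'e::euclidean_space) chart set \<Rightarrow> ('p, 'e) vfield \<Rightarrow> ('p, 'e) vfield \<Rightarrow> ('p, 'e) vfield" where
  "lie_bracket A X Y p = (\<lambda>c. if c \<in> charts_at A p
     then frechet_derivative (\<lambda>x. Y (chart_inv c x) c) (at (snd c p)) (X p c)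
        - frechet_derivative (\<lambda>x. X (chart_inv c x) c) (at (snd c p)) (Y p c)
     else 0)"


section \<open>Tensor fields\<close>

definition linear_on :: "'v::real_vector set \<Rightarrow> ('v \<Rightarrow> 'w::real_vector) \<Rightarrow> bool" where
  "linear_on V f \<longleftrightarrow> (\<forall>v\<in>V. \<forall>w\<in>V. \<forall>a b. f (a *\<^sub>R v + b *\<^sub>R w) = a *\<^sub>R f v + b *\<^sub>R f w)"

definition endo_field ::
    "('p, 'e::euclidean_space) chart set \<Rightarrow> ('p \<Rightarrow> ('p, 'e) tvec \<Rightarrow> ('p, 'e) tvec) \<Rightarrow> bool" where
  "endo_field A K \<longleftrightarrow>
     (\<forall>p\<in>points A. K p ` tangent_space A p \<subseteq> tangent_space A p \<and> linear_on (tangent_space A p) (K p)) \<and>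
     (\<forall>c\<in>A. \<forall>i\<in>Basis. smooth_on (snd c ` fst c)
        (\<lambda>x. K (chart_inv c x) (coord_field A c i (chart_inv c x)) c))"

definition almost_complex ::
    "('p, 'e::euclidean_space) chart set \<Rightarrow> ('p \<Rightarrow> ('p, 'e) tvec \<Rightarrow> ('p, 'e) tvec) \<Rightarrow> bool" where
  "almost_complex A J \<longleftrightarrow> endo_field A J \<and>
     (\<forall>p\<in>points A. \<forall>v\<in>tangent_space A p. J p (J p v) = - v)"

text \<open>A pseudo-Riemannian metric of signature \<open>(r, s)\<close>: every tangent space has a basis which is
  orthogonal with \<open>r\<close> vectors of square \<open>1\<close> and \<open>s\<close> vectors of square \<open>-1\<close>. This entails
  nondegeneracy.\<close>

definition pseudo_riemannian_metric ::
    "nat \<Rightarrow> nat \<Rightarrow> ('p, 'e::euclidean_space) chart set \<Rightarrow>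
     ('p \<Rightarrow> ('p, 'e) tvec \<Rightarrow> ('p, 'e) tvec \<Rightarrow> real) \<Rightarrow> bool" where
  "pseudo_riemannian_metric r s A g \<longleftrightarrow>
     (\<forall>p\<in>points A.
        (\<forall>v\<in>tangent_space A p. \<forall>w\<in>tangent_space A p. g p v w = g p w v) \<and>
        (\<forall>w\<in>tangent_space A p. linear_on (tangent_space A p) (\<lambda>v. g p v w)) \<and>
        (\<exists>e :: nat \<Rightarrow> ('p, 'e) tvec. span (e ` {..<r + s}) = tangent_space A p \<and>
           (\<forall>i<r + s. \<forall>j<r + s.
              g p (e i) (e j) = (if i \<noteq> j then 0 else if i < r then 1 else - 1)))) \<and>
     (\<forall>c\<in>A. \<forall>i\<in>Basis. \<forall>j\<in>Basis. smooth_on (snd c ` fst c)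
        (\<lambda>x. g (chart_inv c x) (coord_field A c i (chart_inv c x)) (coord_field A c j (chart_inv c x))))"

definition almost_skew_hermitian ::
    "nat \<Rightarrow> ('p, 'e::euclidean_space) chart set \<Rightarrow> ('p \<Rightarrow> ('p, 'e) tvec \<Rightarrow> ('p, 'e) tvec) \<Rightarrow>
     ('p \<Rightarrow> ('p, 'e) tvec \<Rightarrow> ('p, 'e) tvec \<Rightarrow> real) \<Rightarrow>
     ('p \<Rightarrow> ('p, 'e) tvec \<Rightarrow> ('p, 'e) tvec \<Rightarrow> real) \<Rightarrow> bool" where
  "almost_skew_hermitian n A J g gt \<longleftrightarrow>
     smooth_manifold A \<and> DIM('e) = 2 * n \<and> almost_complex A J \<and>
     pseudo_riemannian_metric n n A g \<and>
     (\<forall>p\<in>points A. \<forall>v\<in>tangent_space A p. \<forall>w\<in>tangent_space A p.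
        g p (J p v) (J p w) = - g p v w \<and> gt p v w = g p v (J p w))"


section \<open>The Levi-Civita connection\<close>

text \<open>A connection acts on vector fields over arbitrary open sets \<open>U\<close>, compatibly with restriction:
  on \<open>U\<close> the value depends only on the arguments on \<open>U\<close>. (Fields are total functions whose values
  off \<open>U\<close> are arbitrary.)\<close>

definition connection ::
    "('p, 'e::euclidean_space) chart set \<Rightarrow>
     (('p, 'e) vfield \<Rightarrow> ('p, 'e) vfield \<Rightarrow> ('p, 'e) vfield) \<Rightarrow> bool" where
  "connection A D \<longleftrightarrow>
     (\<forall>U X X' Y Y' f. openin (manifold_topology A) U \<and>
        vector_field A U X \<and> vector_field A U X' \<and> vector_field A U Y \<and> vector_field A U Y' \<and>
        smooth_fun A U f \<longrightarrow>
        vector_field A U (D X Y) \<and>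
        ((\<forall>p\<in>U. X p = X' p \<and> Y p = Y' p) \<longrightarrow> (\<forall>p\<in>U. D X Y p = D X' Y' p)) \<and>
        (\<forall>p\<in>U.
           D (X + X') Y p = D X Y p + D X' Y p \<and>
           D (\<lambda>q. f q *\<^sub>R X q) Y p = f p *\<^sub>R D X Y p \<and>
           D X (Y + Y') p = D X Y p + D X Y' p \<and>
           D X (\<lambda>q. f q *\<^sub>R Y q) p = dir_deriv A p (X p) f *\<^sub>R Y p + f p *\<^sub>R D X Y p))"

definition levi_civita ::
    "('p, 'e::euclidean_space) chart set \<Rightarrow> ('p \<Rightarrow> ('p, 'e) tvec \<Rightarrow> ('p, 'e) tvec \<Rightarrow> real) \<Rightarrow>
     (('p, 'e) vfield \<Rightarrow> ('p, 'e) vfield \<Rightarrow> ('p, 'e) vfield) \<Rightarrow> bool" where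
  "levi_civita A g D \<longleftrightarrow> connection A D \<and>
     (\<forall>U X Y Z. openin (manifold_topology A) U \<and>
        vector_field A U X \<and> vector_field A U Y \<and> vector_field A U Z \<longrightarrow>
        (\<forall>p\<in>U. D X Y p - D Y X p = lie_bracket A X Y p \<and>
           dir_deriv A p (X p) (\<lambda>q. g q (Y q) (Z q)) = g p (D X Y p) (Z p) + g p (Y p) (D X Z p)))"

definition curvature ::
    "('p, 'e::euclidean_space) chart set \<Rightarrow>
     (('p, 'e) vfield \<Rightarrow> ('p, 'e) vfield \<Rightarrow> ('p, 'e) vfield) \<Rightarrow>
     ('p, 'e) vfield \<Rightarrow> ('p, 'e) vfield \<Rightarrow> ('p, 'e) vfield \<Rightarrow> ('p, 'e) vfield" where
  "curvature A D X Y Z = D X (D Y Z) - D Y (D X Z) - D (lie_bracket A X Y) Z"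

definition flat ::
    "('p, 'e::euclidean_space) chart set \<Rightarrow>
     (('p, 'e) vfield \<Rightarrow> ('p, 'e) vfield \<Rightarrow> ('p, 'e) vfield) \<Rightarrow> bool" where
  "flat A D \<longleftrightarrow>
     (\<forall>U X Y Z. openin (manifold_topology A) U \<and>
        vector_field A U X \<and> vector_field A U Y \<and> vector_field A U Z \<longrightarrow>
        (\<forall>p\<in>U. curvature A D X Y Z p = 0))"

text \<open>\<open>(\<nabla>\<^sub>X J) Y = \<nabla>\<^sub>X (J Y) - J (\<nabla>\<^sub>X Y)\<close>\<close>

definition cov_deriv_endo ::
    "(('p, 'e) vfield \<Rightarrow> ('p, 'e) vfield \<Rightarrow> ('p, 'e) vfield) \<Rightarrow>
     ('p \<Rightarrow> ('p, 'e::euclidean_space) tvec \<Rightarrow> ('p, 'e) tvec) \<Rightarrow>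
     ('p, 'e) vfield \<Rightarrow> ('p, 'e) vfield \<Rightarrow> ('p, 'e) vfield" where
  "cov_deriv_endo D J X Y = (\<lambda>p. D X (\<lambda>q. J q (Y q)) p - J p (D X Y p))"

definition parallel ::
    "('p, 'e::euclidean_space) chart set \<Rightarrow>
     (('p, 'e) vfield \<Rightarrow> ('p, 'e) vfield \<Rightarrow> ('p, 'e) vfield) \<Rightarrow>
     ('p \<Rightarrow> ('p, 'e) tvec \<Rightarrow> ('p, 'e) tvec) \<Rightarrow> bool" where
  "parallel A D J \<longleftrightarrow>
     (\<forall>U X Y. openin (manifold_topology A) U \<and> vector_field A U X \<and> vector_field A U Y \<longrightarrow>
        (\<forall>p\<in>U. cov_deriv_endo D J X Y p = 0))"


section \<open>Integrability of almost complex structures\<close>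

definition nijenhuis ::
    "('p, 'e::euclidean_space) chart set \<Rightarrow> ('p \<Rightarrow> ('p, 'e) tvec \<Rightarrow> ('p, 'e) tvec) \<Rightarrow>
     ('p, 'e) vfield \<Rightarrow> ('p, 'e) vfield \<Rightarrow> ('p, 'e) vfield" where
  "nijenhuis A K X Y = (\<lambda>p.
     lie_bracket A X Y p
     + K p (lie_bracket A (\<lambda>q. K q (X q)) Y p)
     + K p (lie_bracket A X (\<lambda>q. K q (Y q)) p)
     - lie_bracket A (\<lambda>q. K q (X q)) (\<lambda>q. K q (Y q)) p)"

definition complex_structure ::
    "('p, 'e::euclidean_space) chart set \<Rightarrow> ('p \<Rightarrow> ('p, 'e) tvec \<Rightarrow> ('p, 'e) tvec) \<Rightarrow> bool" where
  "complex_structure A K \<longleftrightarrow>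
     (\<forall>U X Y. openin (manifold_topology A) U \<and> vector_field A U X \<and> vector_field A U Y \<longrightarrow>
        (\<forall>p\<in>U. nijenhuis A K X Y p = 0))"

definition hypercomplex_structure ::
    "('p, 'e::euclidean_space) chart set \<Rightarrow> ('p \<Rightarrow> ('p, 'e) tvec \<Rightarrow> ('p, 'e) tvec) \<Rightarrow>
     ('p \<Rightarrow> ('p, 'e) tvec \<Rightarrow> ('p, 'e) tvec) \<Rightarrow> ('p \<Rightarrow> ('p, 'e) tvec \<Rightarrow> ('p, 'e) tvec) \<Rightarrow> bool" where
  "hypercomplex_structure A K1 K2 K3 \<longleftrightarrow>
     complex_structure A K1 \<and> complex_structure A K2 \<and> complex_structure A K3"


section \<open>The tangent bundle and its almost hypercomplex structure\<close>

text \<open>The points of the tangent bundle are the pairs \<open>(p, u)\<close> with \<open>u\<close> tangent at \<open>p\<close>. A chart with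
  coordinates \<open>(x\<^sup>i)\<close> induces the chart with coordinates \<open>(x\<^sup>i, y\<^sup>i)\<close>.\<close>

type_synonym ('p, 'e) tpoint = "'p \<times> ('p, 'e) tvec"

definition bundle_chart ::
    "('p, 'e::euclidean_space) chart set \<Rightarrow> ('p, 'e) chart \<Rightarrow> (('p, 'e) tpoint, 'e \<times> 'e) chart" where
  "bundle_chart A c = ((SIGMA p:fst c. tangent_space A p), (\<lambda>(p, u). (snd c p, u c)))"

definition tangent_bundle ::
    "('p, 'e::euclidean_space) chart set \<Rightarrow> (('p, 'e) tpoint, 'e \<times> 'e) chart set" where
  "tangent_bundle A = bundle_chart A ` A"

text \<open>\<open>a\<^sup>i b\<^sup>j \<Gamma>\<^sub>i\<^sub>j\<^sup>k\<close> at \<open>p\<close> in the chart \<open>c\<close>, where \<open>\<Gamma>\<^sub>i\<^sub>j\<^sup>k\<close> are the components of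
  \<open>\<nabla>\<close> applied to the \<open>i\<close>-th and \<open>j\<close>-th coordinate field.\<close>

definition christoffel ::
    "('p, 'e::euclidean_space) chart set \<Rightarrow>
     (('p, 'e) vfield \<Rightarrow> ('p, 'e) vfield \<Rightarrow> ('p, 'e) vfield) \<Rightarrow>
     ('p, 'e) chart \<Rightarrow> 'p \<Rightarrow> 'e \<Rightarrow> 'e \<Rightarrow> 'e" where
  "christoffel A D c p a b =
     (\<Sum>i\<in>Basis. \<Sum>j\<in>Basis. ((a \<bullet> i) * (b \<bullet> j)) *\<^sub>R D (coord_field A c i) (coord_field A c j) p c)"

text \<open>Lifts of a vector \<open>v\<close> tangent at \<open>p\<close> to a vector tangent to the bundle at \<open>z = (p, u)\<close>. The
  coordinate expressions in the different induced charts define one and the same tangent vector.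
  The lifts of a field \<open>X\<close> have at \<open>z\<close> the values \<open>vlift A z (X p)\<close> and \<open>hlift A D z (X p)\<close>.\<close>

definition vlift ::
    "('p, 'e::euclidean_space) chart set \<Rightarrow> ('p, 'e) tpoint \<Rightarrow> ('p, 'e) tvec \<Rightarrow>
     (('p, 'e) tpoint, 'e \<times> 'e) tvec" where
  "vlift A z v = (THE w. w \<in> tangent_space (tangent_bundle A) z \<and>
     (\<forall>c\<in>charts_at A (fst z). w (bundle_chart A c) = (0, v c)))"

definition hlift ::
    "('p, 'e::euclidean_space) chart set \<Rightarrow>
     (('p, 'e) vfield \<Rightarrow> ('p, 'e) vfield \<Rightarrow> ('p, 'e) vfield) \<Rightarrow>
     ('p, 'e) tpoint \<Rightarrow> ('p, 'e) tvec \<Rightarrow> (('p, 'e) tpoint, 'e \<times> 'e) tvec" where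
  "hlift A D z v = (THE w. w \<in> tangent_space (tangent_bundle A) z \<and>
     (\<forall>c\<in>charts_at A (fst z).
        w (bundle_chart A c) = (v c, - christoffel A D c (fst z) (snd z c) (v c))))"

text \<open>Every vector tangent to the bundle at \<open>z = (p, u)\<close> is uniquely the sum of the horizontal lift of
  some \<open>a\<close> and the vertical lift of some \<open>b\<close>, with \<open>a\<close> and \<open>b\<close> tangent at \<open>p\<close>; hence the linear
  endomorphisms below are determined by their values on lifts.\<close>

definition J1 ::
    "('p, 'e::euclidean_space) chart set \<Rightarrow>
     (('p, 'e) vfield \<Rightarrow> ('p, 'e) vfield \<Rightarrow> ('p, 'e) vfield) \<Rightarrow>
     ('p, 'e) tpoint \<Rightarrow> (('p, 'e) tpoint, 'e \<times> 'e) tvec \<Rightarrow> (('p, 'e) tpoint, 'e \<times> 'e) tvec" where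
  "J1 A D z w = (THE w'. \<exists>a\<in>tangent_space A (fst z). \<exists>b\<in>tangent_space A (fst z).
     w = hlift A D z a + vlift A z b \<and> w' = vlift A z a - hlift A D z b)"

definition J2 ::
    "('p, 'e::euclidean_space) chart set \<Rightarrow>
     (('p, 'e) vfield \<Rightarrow> ('p, 'e) vfield \<Rightarrow> ('p, 'e) vfield) \<Rightarrow>
     ('p \<Rightarrow> ('p, 'e) tvec \<Rightarrow> ('p, 'e) tvec) \<Rightarrow>
     ('p, 'e) tpoint \<Rightarrow> (('p, 'e) tpoint, 'e \<times> 'e) tvec \<Rightarrow> (('p, 'e) tpoint, 'e \<times> 'e) tvec" where
  "J2 A D J z w = (THE w'. \<exists>a\<in>tangent_space A (fst z). \<exists>b\<in>tangent_space A (fst z).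
     w = hlift A D z a + vlift A z b \<and> w' = vlift A z (J (fst z) a) + hlift A D z (J (fst z) b))"

definition J3 ::
    "('p, 'e::euclidean_space) chart set \<Rightarrow>
     (('p, 'e) vfield \<Rightarrow> ('p, 'e) vfield \<Rightarrow> ('p, 'e) vfield) \<Rightarrow>
     ('p \<Rightarrow> ('p, 'e) tvec \<Rightarrow> ('p, 'e) tvec) \<Rightarrow>
     ('p, 'e) tpoint \<Rightarrow> (('p, 'e) tpoint, 'e \<times> 'e) tvec \<Rightarrow> (('p, 'e) tpoint, 'e \<times> 'e) tvec" where
  "J3 A D J z = J1 A D z \<circ> J2 A D J z"

end

theory Submission
  imports Defs
begin

text \<open>In the coordinates \<open>(x, y)\<close> of the tangent bundle induced by a chart, the horizontal and
  vertical lifts of a constant vector \<open>a\<close> are \<open>H\<^sub>a = (a, - \<Gamma>(y, a))\<close> and \<open>V\<^sub>a = (0, a)\<close>. The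
  bracket \<open>[H\<^sub>a, H\<^sub>b]\<close> is the vertical lift of \<open>- R(a, b) y\<close>, \<open>[H\<^sub>a, V\<^sub>b]\<close> that of \<open>\<Gamma>(a, b)\<close>, and
  \<open>[V\<^sub>a, V\<^sub>b] = 0\<close>. The Nijenhuis tensor \<open>N\<close> of an almost complex structure \<open>K\<close> depends only on
  the values of its arguments and satisfies \<open>N(K X, Y) = - K N(X, Y)\<close>, so it is enough to evaluate
  it on lifts. With \<open>S(a, b) = (\<nabla>\<^sub>a J) b\<close>, the brackets above and their analogues for the
  nonconstant vector \<open>J a\<close> give

  \<^item> \<open>N\<^sub>1(H\<^sub>a, H\<^sub>b)\<close> has vertical part \<open>- R(a, b) y\<close> and no horizontal part;
  \<^item> \<open>N\<^sub>2(H\<^sub>a, H\<^sub>b)\<close> has vertical part \<open>- R(a, b) y\<close> and horizontal part \<open>J (S(a, b) - S(b, a))\<close>;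
  \<^item> \<open>N\<^sub>3(H\<^sub>a, V\<^sub>b)\<close> is vertical, equal to \<open>J S(a, b) + S(J a, b)\<close>, while \<open>N\<^sub>3(H\<^sub>a, H\<^sub>b)\<close> has
    horizontal part \<open>J (S(a, b) - S(b, a)) - S(J a, b) + S(J b, a)\<close> and vertical part
    \<open>R(J a, J b) y - R(a, b) y + J R(J a, b) y + J R(a, J b) y\<close>.

  The first line settles \<open>J\<^sub>1\<close>. For \<open>J\<^sub>2\<close> it remains to see that \<open>S\<close> vanishes once it is
  symmetric. Here the metric enters: \<open>J\<close> is self-adjoint, hence so is each \<open>S(a, \<cdot>)\<close>, and
  \<open>F(a, b, c) = g(S(a, b), c)\<close> is totally symmetric; but \<open>J\<close> anticommutes with \<open>S(a, \<cdot>)\<close>, so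
  moving \<open>J\<close> from one argument of \<open>F\<close> to another changes the sign, and moving it once around the
  three arguments gives \<open>F(J a, b, c) = - F(J a, b, c)\<close>. For \<open>J\<^sub>3\<close>, the vanishing of the mixed
  value turns the horizontal part into \<open>2 J (S(a, b) - S(b, a))\<close>, so again \<open>S = 0\<close>. Then \<open>R(a, b)\<close>
  commutes with the self-adjoint \<open>J\<close>, and the symmetries of the curvature tensor turn this into
  \<open>R(J a, b) = J R(a, b)\<close>. The vertical part becomes \<open>- 4 R(a, b) y\<close>, which forces \<open>R = 0\<close>.

  A tangent vector is the family of its components in all charts, and an equation between tangent
  vectors need only be verified in one chart (\<open>tangent_space_eqI\<close>). So everything reduces to
  calculus on open sets of a Euclidean space: \<open>D_in_chart\<close> expresses the connection by Christoffel
  symbols, \<open>flat_iff\<close> and \<open>parallel_iff\<close> translate the geometric hypotheses,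
  \<open>complex_structure_iff\<close> replaces the Nijenhuis condition by the vanishing of a tensor \<open>nij\<close> in
  every chart, and \<open>J1_in_chart\<close>, \<open>J2_in_chart\<close>, \<open>J3_in_chart\<close> compute the three structures. The
  evaluation on lifts is done in \<open>nij_k1_zero_iff\<close>, \<open>nij_k2_zero_iff\<close>, \<open>nij_k3_zero_iff\<close>, and the
  algebra with the metric in \<open>S_zero_if_symmetric\<close> and \<open>curv_J_left\<close>.\<close>

abbreviation fd :: "('a::real_normed_vector \<Rightarrow> 'b::real_normed_vector) \<Rightarrow> 'a \<Rightarrow> 'a \<Rightarrow> 'b" where
  "fd f x \<equiv> frechet_derivative f (at x)"

section \<open>Calculus of smooth maps\<close>

lemma fd_eqI: "(f has_derivative f') (at x) \<Longrightarrow> fd f x = f'"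
  using frechet_derivative_at[of f f' x] by simp

lemma has_derivative_fd: "f differentiable (at x) \<Longrightarrow> (f has_derivative fd f x) (at x)"
  using frechet_derivative_works by blast

lemma fd_cong:
  assumes "open S" "x \<in> S" "\<And>y. y \<in> S \<Longrightarrow> f y = g y"
  shows "fd f x = fd g x"
proof -
  have "(f has_derivative f') (at x) = (g has_derivative f') (at x)" for f'
    using assms by (metis has_derivative_transform_within_open)
  then show ?thesis
    by (simp add: frechet_derivative_def)
qed

lemma differentiable_cong:
  assumes "f differentiable (at x)" "open S" "x \<in> S" "\<And>y. y \<in> S \<Longrightarrow> f y = g y"
  shows "g differentiable (at x)"
  using assms unfolding differentiable_def by (metis has_derivative_transform_within_open)

lemma linear_fd: "f differentiable (at x) \<Longrightarrow> linear (fd f x)"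
  by (rule linear_frechet_derivative)

lemma fd_chain:
  assumes "g differentiable (at x)" "f differentiable (at (g x))"
  shows "fd (\<lambda>y. f (g y)) x v = fd f (g x) (fd g x v)"
  using frechet_derivative_compose[OF assms] by (simp add: o_def fun_eq_iff)

lemma linear_Basis_expansion:
  fixes L :: "'a::euclidean_space \<Rightarrow> 'b::real_vector"
  assumes "linear L"
  shows "L v = (\<Sum>i\<in>Basis. (v \<bullet> i) *\<^sub>R L i)"
proof -
  have "L v = L (\<Sum>i\<in>Basis. (v \<bullet> i) *\<^sub>R i)"
    by (simp add: euclidean_representation)
  also have "\<dots> = (\<Sum>i\<in>Basis. (v \<bullet> i) *\<^sub>R L i)"
    by (simp add: linear_sum[OF assms] linear_scale[OF assms])
  finally show ?thesis .
qed

lemma Ck_on_SucD: "Ck_on (Suc k) S f \<Longrightarrow> Ck_on k S f"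
proof (induction k arbitrary: f)
  case 0
  then show ?case
    by (auto simp: continuous_on_eq_continuous_within intro!: differentiable_imp_continuous_within
        dest: differentiable_at_withinI)
qed auto

lemma Ck_on_cong:
  assumes "open S"
  shows "Ck_on k S f \<Longrightarrow> (\<And>x. x \<in> S \<Longrightarrow> f x = g x) \<Longrightarrow> Ck_on k S g"
proof (induction k arbitrary: f g)
  case 0
  then show ?case
    by (metis Ck_on.simps(1) continuous_on_cong)
next
  case (Suc k)
  have "fd f x = fd g x" if "x \<in> S" for x
    using fd_cong[OF assms that] Suc.prems(2) by blast
  moreover have "g differentiable (at x)" if "x \<in> S" for x
    using differentiable_cong[OF _ assms that] Suc.prems that by auto
  ultimately show ?case
    using Suc.prems Suc.IH[of "\<lambda>x. fd f x v" "\<lambda>x. fd g x v" for v] by simp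
qed

lemma Ck_on_subset: "Ck_on k S f \<Longrightarrow> T \<subseteq> S \<Longrightarrow> Ck_on k T f"
  by (induction k arbitrary: f) (auto intro: continuous_on_subset)

lemma Ck_on_const: "Ck_on k S (\<lambda>x. c)"
  by (induction k arbitrary: c) auto

lemma Ck_on_bounded_linear: "bounded_linear L \<Longrightarrow> Ck_on k S L"
proof (cases k)
  case 0
  assume "bounded_linear L"
  then show ?thesis using 0 by (simp add: linear_continuous_on)
next
  case (Suc m)
  assume L: "bounded_linear L"
  then have "fd L x = L" for x
    by (intro fd_eqI bounded_linear_imp_has_derivative)
  with L show ?thesis
    by (auto simp: Suc Ck_on_const bounded_linear_imp_differentiable)
qed

lemma Ck_on_add:
  assumes "open S"
  shows "Ck_on k S f \<Longrightarrow> Ck_on k S g \<Longrightarrow> Ck_on k S (\<lambda>x. f x + g x)"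
proof (induction k arbitrary: f g)
  case 0
  then show ?case by (auto intro: continuous_intros)
next
  case (Suc k)
  have "fd (\<lambda>x. f x + g x) x v = fd f x v + fd g x v" if "x \<in> S" for x v
    using Suc.prems that by (subst fd_eqI[OF
        has_derivative_add[OF has_derivative_fd has_derivative_fd]]) auto
  moreover have "Ck_on k S (\<lambda>x. fd f x v + fd g x v)" for v
    using Suc by simp
  ultimately have "Ck_on k S (\<lambda>x. fd (\<lambda>x. f x + g x) x v)" for v
    using Ck_on_cong[OF assms] by (metis (mono_tags, lifting))
  then show ?case using Suc.prems by auto
qed

lemma Ck_on_scaleR:
  fixes f :: "'a::euclidean_space \<Rightarrow> real" and g :: "'a \<Rightarrow> 'b::real_normed_vector"
  assumes "open S"
  shows "Ck_on k S f \<Longrightarrow> Ck_on k S g \<Longrightarrow> Ck_on k S (\<lambda>x. f x *\<^sub>R g x)"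
proof (induction k arbitrary: f g)
  case 0
  then show ?case by (auto intro: continuous_intros)
next
  case (Suc k)
  have "fd (\<lambda>x. f x *\<^sub>R g x) x v = f x *\<^sub>R fd g x v + fd f x v *\<^sub>R g x" if "x \<in> S" for x v
    using Suc.prems that
    by (subst fd_eqI[OF has_derivative_scaleR[OF has_derivative_fd has_derivative_fd]]) auto
  moreover have "Ck_on k S (\<lambda>x. f x *\<^sub>R fd g x v + fd f x v *\<^sub>R g x)" for v
  proof (intro Ck_on_add[OF assms] Suc.IH)
    show "Ck_on k S f" "Ck_on k S g"
      using Suc.prems by (auto intro: Ck_on_SucD simp del: Ck_on.simps)
  qed (use Suc.prems in auto)
  ultimately have "Ck_on k S (\<lambda>x. fd (\<lambda>x. f x *\<^sub>R g x) x v)" for v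
    using Ck_on_cong[OF assms] by (metis (mono_tags, lifting))
  then show ?case using Suc.prems by auto
qed

lemma Ck_on_sum:
  assumes "open S"
  shows "(\<And>i. i \<in> I \<Longrightarrow> Ck_on k S (f i)) \<Longrightarrow> Ck_on k S (\<lambda>x. \<Sum>i\<in>I. f i x)"
  by (induction I rule: infinite_finite_induct) (auto simp: Ck_on_const Ck_on_add[OF assms])

lemma Ck_on_linear_image:
  assumes "open S" "bounded_linear L"
  shows "Ck_on k S f \<Longrightarrow> Ck_on k S (\<lambda>x. L (f x))"
proof (induction k arbitrary: f)
  case 0
  then show ?case
    by (simp add: bounded_linear.continuous_on[OF assms(2)])
next
  case (Suc k)
  have "fd (\<lambda>x. L (f x)) x v = L (fd f x v)" if "x \<in> S" for x v
    using Suc.prems that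
    by (subst fd_eqI[OF bounded_linear.has_derivative[OF assms(2) has_derivative_fd]]) auto
  moreover have "Ck_on k S (\<lambda>x. L (fd f x v))" for v
    using Suc by simp
  ultimately have "Ck_on k S (\<lambda>x. fd (\<lambda>x. L (f x)) x v)" for v
    using Ck_on_cong[OF assms(1)] by (metis (mono_tags, lifting))
  then show ?case
    using Suc.prems bounded_linear.has_derivative[OF assms(2)] by (auto simp: differentiable_def) blast
qed

text \<open>The chain rule writes a derivative of \<open>f \<circ> g\<close> as a sum of products of derivatives of \<open>g\<close>
  with derivatives of \<open>f\<close> composed with \<open>g\<close>, which are one order smoother by induction.\<close>

lemma Ck_on_compose:
  fixes f :: "'b::euclidean_space \<Rightarrow> 'c::real_normed_vector" and g :: "'a::euclidean_space \<Rightarrow> 'b"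
  assumes "open S" "g ` S \<subseteq> T"
  shows "Ck_on k T f \<Longrightarrow> Ck_on k S g \<Longrightarrow> Ck_on k S (\<lambda>x. f (g x))"
proof (induction k arbitrary: f)
  case 0
  then show ?case
    using assms by (auto intro: continuous_on_compose2)
next
  case (Suc k)
  have diff: "f differentiable (at (g x))" "g differentiable (at x)" if "x \<in> S" for x
    using Suc.prems assms(2) that by auto
  have "fd (\<lambda>x. f (g x)) x v = (\<Sum>i\<in>Basis. (fd g x v \<bullet> i) *\<^sub>R fd f (g x) i)" if "x \<in> S" for x v
    using diff[OF that]
    by (simp add: fd_chain linear_Basis_expansion[OF linear_fd[OF diff(1)[OF that]], symmetric])
  moreover have "Ck_on k S (\<lambda>x. \<Sum>i\<in>Basis. (fd g x v \<bullet> i) *\<^sub>R fd f (g x) i)" for v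
  proof (intro Ck_on_sum Ck_on_scaleR assms(1) Ck_on_linear_image[OF assms(1) bounded_linear_inner_left])
    show "Ck_on k S (\<lambda>x. fd f (g x) i)" for i
      using Suc.prems Ck_on_SucD[of k S g] by (intro Suc.IH) auto
  qed (use Suc.prems in auto)
  ultimately have "Ck_on k S (\<lambda>x. fd (\<lambda>x. f (g x)) x v)" for v
    using Ck_on_cong[OF assms(1)] by (metis (mono_tags, lifting))
  then show ?case
    using diff by (auto intro!: differentiable_compose[of f g])
qed

lemma smooth_on_differentiable: "smooth_on S f \<Longrightarrow> x \<in> S \<Longrightarrow> f differentiable (at x)"
  unfolding smooth_on_def by (metis Ck_on.simps(2))

lemma smooth_on_fd: "smooth_on S f \<Longrightarrow> smooth_on S (\<lambda>x. fd f x v)"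
  unfolding smooth_on_def by (metis Ck_on.simps(2))

lemma smooth_on_continuous: "smooth_on S f \<Longrightarrow> continuous_on S f"
  unfolding smooth_on_def by (metis Ck_on.simps(1))

lemma smooth_on_cong:
  "open S \<Longrightarrow> smooth_on S f \<Longrightarrow> (\<And>x. x \<in> S \<Longrightarrow> f x = g x) \<Longrightarrow> smooth_on S g"
  unfolding smooth_on_def using Ck_on_cong[of S _ f g] by simp

lemma smooth_on_subset: "smooth_on S f \<Longrightarrow> T \<subseteq> S \<Longrightarrow> smooth_on T f"
  unfolding smooth_on_def by (blast intro: Ck_on_subset)

lemma smooth_on_const: "smooth_on S (\<lambda>x. c)"
  unfolding smooth_on_def by (blast intro: Ck_on_const)

lemma smooth_on_bounded_linear: "bounded_linear L \<Longrightarrow> smooth_on S L"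
  unfolding smooth_on_def by (blast intro: Ck_on_bounded_linear)

lemma smooth_on_add:
  "open S \<Longrightarrow> smooth_on S f \<Longrightarrow> smooth_on S g \<Longrightarrow> smooth_on S (\<lambda>x. f x + g x)"
  by (simp add: smooth_on_def Ck_on_add)

lemma smooth_on_scaleR:
  "open S \<Longrightarrow> smooth_on S f \<Longrightarrow> smooth_on S g \<Longrightarrow> smooth_on S (\<lambda>x. f x *\<^sub>R g x)"
  by (simp add: smooth_on_def Ck_on_scaleR)

lemma smooth_on_sum:
  "open S \<Longrightarrow> (\<And>i. i \<in> I \<Longrightarrow> smooth_on S (f i)) \<Longrightarrow> smooth_on S (\<lambda>x. \<Sum>i\<in>I. f i x)"
  by (simp add: smooth_on_def Ck_on_sum)

lemma smooth_on_linear_image: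
  "open S \<Longrightarrow> bounded_linear L \<Longrightarrow> smooth_on S f \<Longrightarrow> smooth_on S (\<lambda>x. L (f x))"
  by (simp add: smooth_on_def Ck_on_linear_image)

lemma smooth_on_compose:
  "open S \<Longrightarrow> g ` S \<subseteq> T \<Longrightarrow> smooth_on T f \<Longrightarrow> smooth_on S g \<Longrightarrow> smooth_on S (\<lambda>x. f (g x))"
  using Ck_on_compose[of S g T _ f] by (simp add: smooth_on_def)

lemma smooth_on_inner:
  "open S \<Longrightarrow> smooth_on S f \<Longrightarrow> smooth_on S (\<lambda>x. f x \<bullet> i)"
  using smooth_on_linear_image[OF _ bounded_linear_inner_left] by blast

lemma smooth_on_diff:
  assumes "open S" "smooth_on S f" "smooth_on S g" shows "smooth_on S (\<lambda>x. f x - g x)"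
proof -
  have "smooth_on S (\<lambda>x. - g x)"
    using assms by (intro smooth_on_linear_image[of S uminus])
        (auto intro: bounded_linear_minus bounded_linear_ident)
  from smooth_on_add[OF assms(1,2) this] show ?thesis by simp
qed

lemma smooth_on_Pair:
  fixes f :: "'a::euclidean_space \<Rightarrow> 'b::real_normed_vector" and g :: "'a \<Rightarrow> 'c::real_normed_vector"
  assumes "open S" "smooth_on S f" "smooth_on S g" shows "smooth_on S (\<lambda>x. (f x, g x))"
proof -
  have "bounded_linear (\<lambda>b::'b. (b, 0::'c))" "bounded_linear (\<lambda>c::'c. (0::'b, c))"
    by (auto intro: bounded_linear_Pair bounded_linear_ident bounded_linear_zero)
  then have "smooth_on S (\<lambda>x. (f x, 0::'c))" "smooth_on S (\<lambda>x. (0::'b, g x))"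
    using smooth_on_linear_image assms by blast+
  from smooth_on_add[OF assms(1) this] show ?thesis by simp
qed

text \<open>The basic device for fields of linear maps \<open>F y\<close> applied to varying arguments: expanding the
  argument in the standard basis reduces the product rule to the one for real factors, so only the
  values on constant arguments have to be smooth or differentiable. Derivatives of maps,
  endomorphism fields, Christoffel symbols and metrics are all handled this way.\<close>

lemma smooth_on_linear_family:
  fixes F :: "'z::euclidean_space \<Rightarrow> 'e::euclidean_space \<Rightarrow> 'b::real_normed_vector"
  assumes "open S" "\<And>y. y \<in> S \<Longrightarrow> linear (F y)" "\<And>i. i \<in> Basis \<Longrightarrow> smooth_on S (\<lambda>y. F y i)"
    and "smooth_on S a"
  shows "smooth_on S (\<lambda>y. F y (a y))"
proof -
  have "smooth_on S (\<lambda>y. \<Sum>i\<in>Basis. (a y \<bullet> i) *\<^sub>R F y i)"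
    using assms by (intro smooth_on_sum smooth_on_scaleR smooth_on_inner) auto
  from smooth_on_cong[OF assms(1) this] show ?thesis
    by (simp add: linear_Basis_expansion[OF assms(2), symmetric])
qed

lemma has_derivative_linear_family:
  fixes F :: "'z::real_normed_vector \<Rightarrow> 'e::euclidean_space \<Rightarrow> 'b::real_normed_vector"
  assumes S: "open S" "x \<in> S" and lin: "\<And>y. y \<in> S \<Longrightarrow> linear (F y)"
    and diff: "\<And>i. i \<in> Basis \<Longrightarrow> (\<lambda>y. F y i) differentiable (at x)"
    and a: "(a has_derivative a') (at x)"
  shows "((\<lambda>y. F y (a y)) has_derivative (\<lambda>h. fd (\<lambda>y. F y (a x)) x h + F x (a' h))) (at x)"
proof -
  have *: "((\<lambda>y. F y (a y)) has_derivative
      (\<lambda>h. \<Sum>i\<in>Basis. (a x \<bullet> i) *\<^sub>R fd (\<lambda>y. F y i) x h + (a' h \<bullet> i) *\<^sub>R F x i)) (at x)"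
    if "(a has_derivative a') (at x)" for a a'
  proof (rule has_derivative_transform_within_open[OF _ S])
    show "((\<lambda>y. \<Sum>i\<in>Basis. (a y \<bullet> i) *\<^sub>R F y i) has_derivative
      (\<lambda>h. \<Sum>i\<in>Basis. (a x \<bullet> i) *\<^sub>R fd (\<lambda>y. F y i) x h + (a' h \<bullet> i) *\<^sub>R F x i)) (at x)"
      by (intro has_derivative_sum has_derivative_scaleR has_derivative_inner_left that
          has_derivative_fd diff)
  qed (simp add: linear_Basis_expansion[OF lin, symmetric])
  have "fd (\<lambda>y. F y (a x)) x = (\<lambda>h. \<Sum>i\<in>Basis. (a x \<bullet> i) *\<^sub>R fd (\<lambda>y. F y i) x h)"
    using fd_eqI[OF *[OF has_derivative_const[of "a x"]]] by simp
  with *[OF a] show ?thesis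
    by (simp add: sum.distrib linear_Basis_expansion[OF lin[OF S(2)], symmetric])
qed

lemma has_derivative_linear_family_compose:
  fixes F :: "'y::real_normed_vector \<Rightarrow> 'e::euclidean_space \<Rightarrow> 'b::real_normed_vector"
    and \<phi> :: "'z::real_normed_vector \<Rightarrow> 'y"
  assumes S: "open S" "\<phi> z \<in> S" and lin: "\<And>y. y \<in> S \<Longrightarrow> linear (F y)"
    and diff: "\<And>v. (\<lambda>y. F y v) differentiable (at (\<phi> z))"
    and \<phi>: "(\<phi> has_derivative \<phi>') (at z)" and a: "(a has_derivative a') (at z)"
  shows "((\<lambda>y. F (\<phi> y) (a y)) has_derivative
     (\<lambda>h. fd (\<lambda>y. F y (a z)) (\<phi> z) (\<phi>' h) + F (\<phi> z) (a' h))) (at z)"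
proof -
  have "continuous (at z) \<phi>"
    using \<phi> by (rule has_derivative_continuous)
  then obtain T where T: "open T" "z \<in> T" "\<And>y. y \<in> T \<Longrightarrow> \<phi> y \<in> S"
    using S by (metis continuous_at_open)
  have *: "((\<lambda>y. F (\<phi> y) v) has_derivative (\<lambda>h. fd (\<lambda>y. F y v) (\<phi> z) (\<phi>' h))) (at z)" for v
    using has_derivative_compose[OF \<phi> has_derivative_fd[OF diff]] .
  have "((\<lambda>y. F (\<phi> y) (a y)) has_derivative
     (\<lambda>h. fd (\<lambda>y. F (\<phi> y) (a z)) z h + F (\<phi> z) (a' h))) (at z)"
    using * by (intro has_derivative_linear_family[OF T(1,2)] lin T(3) a) (auto simp: differentiable_def)
  then show ?thesis
    by (simp add: fd_eqI[OF *])
qed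

lemma fd_linear:
  assumes "open S" "x \<in> S" "\<And>y. y \<in> S \<Longrightarrow> linear (F y)" "\<And>v. (\<lambda>y. F y v) differentiable (at x)"
  shows "linear (\<lambda>v. fd (\<lambda>y. F y v) x h)"
proof (rule linearI)
  fix v w and c :: real
  have "fd (\<lambda>y. F y (v + w)) x = fd (\<lambda>y. F y v + F y w) x"
    using assms by (intro fd_cong[OF assms(1,2)]) (simp add: linear_add)
  also have "\<dots> = (\<lambda>h. fd (\<lambda>y. F y v) x h + fd (\<lambda>y. F y w) x h)"
    using assms by (intro fd_eqI has_derivative_add has_derivative_fd)
  finally show "fd (\<lambda>y. F y (v + w)) x h = fd (\<lambda>y. F y v) x h + fd (\<lambda>y. F y w) x h" by simp
  have "fd (\<lambda>y. F y (c *\<^sub>R v)) x = fd (\<lambda>y. c *\<^sub>R F y v) x"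
    using assms by (intro fd_cong[OF assms(1,2)]) (simp add: linear_scale)
  also have "\<dots> = (\<lambda>h. c *\<^sub>R fd (\<lambda>y. F y v) x h)"
    using assms by (intro fd_eqI has_derivative_scaleR_right has_derivative_fd)
  finally show "fd (\<lambda>y. F y (c *\<^sub>R v)) x h = c *\<^sub>R fd (\<lambda>y. F y v) x h" by simp
qed

lemma has_derivative_bilinear_family:
  fixes G :: "'y::real_normed_vector \<Rightarrow> 'e::euclidean_space \<Rightarrow> 'f::euclidean_space \<Rightarrow> 'b::real_normed_vector"
    and \<phi> :: "'z::real_normed_vector \<Rightarrow> 'y"
  assumes S: "open S" "\<phi> z \<in> S"
    and lin: "\<And>y b. y \<in> S \<Longrightarrow> linear (\<lambda>a. G y a b)" "\<And>y a. y \<in> S \<Longrightarrow> linear (G y a)"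
    and diff: "\<And>v w. (\<lambda>y. G y v w) differentiable (at (\<phi> z))"
    and \<phi>: "(\<phi> has_derivative \<phi>') (at z)"
    and a: "(a has_derivative a') (at z)" and b: "(b has_derivative b') (at z)"
  shows "((\<lambda>y. G (\<phi> y) (a y) (b y)) has_derivative
     (\<lambda>h. fd (\<lambda>y. G y (a z) (b z)) (\<phi> z) (\<phi>' h) + G (\<phi> z) (a' h) (b z) + G (\<phi> z) (a z) (b' h))) (at z)"
proof -
  have "continuous (at z) \<phi>"
    using \<phi> by (rule has_derivative_continuous)
  then obtain T where T: "open T" "z \<in> T" "\<And>y. y \<in> T \<Longrightarrow> \<phi> y \<in> S"
    using S by (metis continuous_at_open)
  have *: "((\<lambda>y. G (\<phi> y) (a y) w) has_derivative
      (\<lambda>h. fd (\<lambda>y. G y (a z) w) (\<phi> z) (\<phi>' h) + G (\<phi> z) (a' h) w)) (at z)" for w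
    using has_derivative_linear_family_compose[where F="\<lambda>y v. G y v w", OF S lin(1) diff \<phi> a] .
  have "((\<lambda>y. G (\<phi> y) (a y) (b y)) has_derivative
     (\<lambda>h. fd (\<lambda>y. G (\<phi> y) (a y) (b z)) z h + G (\<phi> z) (a z) (b' h))) (at z)"
    using * by (intro has_derivative_linear_family[OF T(1,2)] lin T(3) b) (auto simp: differentiable_def)
  then show ?thesis
    by (simp add: fd_eqI[OF *])
qed

text \<open>Two applications of the mean value theorem, first in direction \<open>v\<close> and then in direction
  \<open>w\<close>. The left-hand side is symmetric in \<open>v\<close> and \<open>w\<close>; for \<open>t\<close> tending to \<open>0\<close> this gives the
  symmetry of the second derivative.\<close>

lemma second_difference_mean_value:
  fixes f :: "'a::euclidean_space \<Rightarrow> real"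
  assumes t: "0 < t" and S: "\<And>s r. s \<in> {0..t} \<Longrightarrow> r \<in> {0..t} \<Longrightarrow> x + s *\<^sub>R v + r *\<^sub>R w \<in> S"
    and f: "smooth_on S f"
  shows "\<exists>s\<in>{0..t}. \<exists>r\<in>{0..t}. f (x + t *\<^sub>R v + t *\<^sub>R w) - f (x + t *\<^sub>R v) - f (x + t *\<^sub>R w) + f x
     = t\<^sup>2 * fd (\<lambda>y. fd f y v) (x + s *\<^sub>R v + r *\<^sub>R w) w"
proof -
  define \<phi> where "\<phi> s = f (x + s *\<^sub>R v + t *\<^sub>R w) - f (x + s *\<^sub>R v + 0 *\<^sub>R w)" for s
  have d: "((\<lambda>s. f (x + s *\<^sub>R v + r *\<^sub>R w)) has_derivative (\<lambda>h. h * fd f (x + s *\<^sub>R v + r *\<^sub>R w) v)) (at s)"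
    if "s \<in> {0..t}" "r \<in> {0..t}" for s r
  proof -
    have 1: "((\<lambda>s. x + s *\<^sub>R v + r *\<^sub>R w) has_derivative (\<lambda>h. h *\<^sub>R v)) (at s)"
      by (auto intro!: derivative_eq_intros)
    have 2: "f differentiable at (x + s *\<^sub>R v + r *\<^sub>R w)"
      using smooth_on_differentiable[OF f] S that by blast
    show ?thesis
      using has_derivative_compose[OF 1 has_derivative_fd[OF 2]] linear_fd[OF 2]
      by (simp add: linear_scale)
  qed
  have "\<exists>s\<in>{0<..<t}. \<phi> t - \<phi> 0 = (\<lambda>h. h * fd f (x + s *\<^sub>R v + t *\<^sub>R w) v
      - h * fd f (x + s *\<^sub>R v + 0 *\<^sub>R w) v) (t - 0)"
  proof (rule mvt_simple[OF t])
    fix s assume "0 \<le> s" "s \<le> t"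
    then have s: "s \<in> {0..t}" by simp
    have "t \<in> {0..t}" "0 \<in> {0..t}" using t by auto
    then show "(\<phi> has_derivative
        (\<lambda>h. h * fd f (x + s *\<^sub>R v + t *\<^sub>R w) v - h * fd f (x + s *\<^sub>R v + 0 *\<^sub>R w) v)) (at s within {0..t})"
      unfolding \<phi>_def[abs_def]
      using d[OF s, of t] d[OF s, of 0] has_derivative_at_withinI has_derivative_diff by blast
  qed
  then obtain s where s: "s \<in> {0<..<t}"
    "\<phi> t - \<phi> 0 = t * (fd f (x + s *\<^sub>R v + t *\<^sub>R w) v - fd f (x + s *\<^sub>R v) v)"
    by (auto simp: algebra_simps)
  have "\<exists>r\<in>{0<..<t}. fd f (x + s *\<^sub>R v + t *\<^sub>R w) v - fd f (x + s *\<^sub>R v + 0 *\<^sub>R w) v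
      = (\<lambda>h. h * fd (\<lambda>y. fd f y v) (x + s *\<^sub>R v + r *\<^sub>R w) w) (t - 0)"
  proof (rule mvt_simple[OF t], rule has_derivative_at_withinI)
    fix r assume "0 \<le> r" "r \<le> t"
    then have 2: "(\<lambda>y. fd f y v) differentiable at (x + s *\<^sub>R v + r *\<^sub>R w)"
      using smooth_on_differentiable[OF smooth_on_fd[OF f]] S s by auto
    have 1: "((\<lambda>r. x + s *\<^sub>R v + r *\<^sub>R w) has_derivative (\<lambda>h. h *\<^sub>R w)) (at r)"
      by (auto intro!: derivative_eq_intros)
    show "((\<lambda>r. fd f (x + s *\<^sub>R v + r *\<^sub>R w) v) has_derivative
        (\<lambda>h. h * fd (\<lambda>y. fd f y v) (x + s *\<^sub>R v + r *\<^sub>R w) w)) (at r)"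
      using has_derivative_compose[OF 1 has_derivative_fd[OF 2]] linear_fd[OF 2]
      by (simp add: linear_scale)
  qed
  then obtain r where r: "r \<in> {0<..<t}" "fd f (x + s *\<^sub>R v + t *\<^sub>R w) v - fd f (x + s *\<^sub>R v) v
      = t * fd (\<lambda>y. fd f y v) (x + s *\<^sub>R v + r *\<^sub>R w) w"
    by auto
  have "f (x + t *\<^sub>R v + t *\<^sub>R w) - f (x + t *\<^sub>R v) - f (x + t *\<^sub>R w) + f x = \<phi> t - \<phi> 0"
    by (simp add: \<phi>_def)
  also have "\<dots> = t\<^sup>2 * fd (\<lambda>y. fd f y v) (x + s *\<^sub>R v + r *\<^sub>R w) w"
    using s r by (simp add: power2_eq_square)
  finally have eq: "f (x + t *\<^sub>R v + t *\<^sub>R w) - f (x + t *\<^sub>R v) - f (x + t *\<^sub>R w) + f x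
      = t\<^sup>2 * fd (\<lambda>y. fd f y v) (x + s *\<^sub>R v + r *\<^sub>R w) w" .
  have "s \<in> {0..t}" "r \<in> {0..t}"
    using s(1) r(1) by auto
  with eq show ?thesis by blast
qed

lemma fd_inner:
  assumes "f differentiable (at x)"
  shows "fd (\<lambda>x. f x \<bullet> i) x v = fd f x v \<bullet> i"
  by (subst fd_eqI[OF has_derivative_inner_left[OF has_derivative_fd[OF assms]]]) simp

theorem second_derivative_symmetric:
  fixes f :: "'a::euclidean_space \<Rightarrow> 'b::euclidean_space"
  assumes S: "open S" "x \<in> S" and f: "smooth_on S f"
  shows "fd (\<lambda>y. fd f y v) x w = fd (\<lambda>y. fd f y w) x v"
proof -
  have real: "fd (\<lambda>y. fd f y v) x w = fd (\<lambda>y. fd f y w) x v"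
    if f: "smooth_on S f" for f :: "'a \<Rightarrow> real"
  proof (rule ccontr)
    let ?P = "\<lambda>y. fd (\<lambda>y. fd f y v) y w" and ?Q = "\<lambda>y. fd (\<lambda>y. fd f y w) y v"
    assume "?P x \<noteq> ?Q x"
    define e where "e = \<bar>?P x - ?Q x\<bar> / 2"
    have e: "e > 0" using \<open>?P x \<noteq> ?Q x\<close> by (simp add: e_def)
    have "continuous_on S ?P" "continuous_on S ?Q"
      using f by (auto intro: smooth_on_continuous smooth_on_fd)
    then have "isCont ?P x" "isCont ?Q x"
      using S by (auto simp: continuous_on_eq_continuous_at)
    then obtain d1 d2 where d: "d1 > 0" "\<And>y. dist y x < d1 \<Longrightarrow> dist (?P y) (?P x) < e"
      "d2 > 0" "\<And>y. dist y x < d2 \<Longrightarrow> dist (?Q y) (?Q x) < e"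
      using e unfolding continuous_at_eps_delta by metis
    obtain d3 where d3: "d3 > 0" "ball x d3 \<subseteq> S"
      using S openE by blast
    define d where "d = min d3 (min d1 d2)"
    have "d > 0" using d d3 by (simp add: d_def)
    \<comment> \<open>small enough that the whole parallelogram spanned by \<open>t v\<close> and \<open>t w\<close> lies within distance \<open>d\<close>\<close>
    define t where "t = d / (norm v + norm w + 1)"
    have t: "t > 0" using \<open>d > 0\<close> by (simp add: t_def add_nonneg_pos)
    have near: "dist (x + s *\<^sub>R v + r *\<^sub>R w) x < d" if "s \<in> {0..t}" "r \<in> {0..t}" for s r
    proof -
      have "dist (x + s *\<^sub>R v + r *\<^sub>R w) x = norm (s *\<^sub>R v + r *\<^sub>R w)"
        by (simp add: dist_norm add.assoc)
      also have "\<dots> \<le> s * norm v + r * norm w"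
        using that norm_triangle_ineq[of "s *\<^sub>R v" "r *\<^sub>R w"] by simp
      also have "\<dots> \<le> t * norm v + t * norm w"
        using that by (intro add_mono mult_right_mono) auto
      also have "\<dots> < t * (norm v + norm w + 1)"
        using t by (simp add: algebra_simps)
      also have "\<dots> = d"
        unfolding t_def
        by (metis add_nonneg_pos add_nonneg_nonneg less_irrefl nonzero_eq_divide_eq norm_ge_zero
            zero_less_one)
      finally show ?thesis .
    qed
    have inS: "x + s *\<^sub>R v + r *\<^sub>R w \<in> S" "x + s *\<^sub>R w + r *\<^sub>R v \<in> S" if "s \<in> {0..t}" "r \<in> {0..t}" for s r
      using near[OF that] near[OF that(2,1)] d3(2) by (auto simp: d_def dist_commute add_ac)
    obtain s r where sr: "s \<in> {0..t}" "r \<in> {0..t}"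
      "f (x + t *\<^sub>R v + t *\<^sub>R w) - f (x + t *\<^sub>R v) - f (x + t *\<^sub>R w) + f x
          = t\<^sup>2 * ?P (x + s *\<^sub>R v + r *\<^sub>R w)"
      using second_difference_mean_value[where v=v and w=w, OF t inS(1) f] by blast
    obtain s' r' where sr': "s' \<in> {0..t}" "r' \<in> {0..t}"
      "f (x + t *\<^sub>R w + t *\<^sub>R v) - f (x + t *\<^sub>R w) - f (x + t *\<^sub>R v) + f x
          = t\<^sup>2 * ?Q (x + s' *\<^sub>R w + r' *\<^sub>R v)"
      using second_difference_mean_value[where v=w and w=v, OF t inS(2) f] by blast
    have "x + t *\<^sub>R w + t *\<^sub>R v = x + t *\<^sub>R v + t *\<^sub>R w"
      by simp
    then have "t\<^sup>2 * ?P (x + s *\<^sub>R v + r *\<^sub>R w) = t\<^sup>2 * ?Q (x + s' *\<^sub>R w + r' *\<^sub>R v)"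
      using sr(3) sr'(3) by (simp only:)
    then have eq: "?P (x + s *\<^sub>R v + r *\<^sub>R w) = ?Q (x + r' *\<^sub>R v + s' *\<^sub>R w)"
      using t by (simp add: add_ac)
    have "dist (?P (x + s *\<^sub>R v + r *\<^sub>R w)) (?P x) < e" "dist (?Q (x + r' *\<^sub>R v + s' *\<^sub>R w)) (?Q x) < e"
      using near[OF sr(1,2)] near[OF sr'(2,1)] d by (auto simp: d_def)
    then have "\<bar>?P x - ?Q x\<bar> < 2 * e"
      unfolding eq dist_real_def by linarith
    then show False by (simp add: e_def)
  qed
  show ?thesis
  proof (rule euclidean_eqI)
    fix i :: 'b
    have comp: "fd (\<lambda>y. fd f y v) x w \<bullet> i = fd (\<lambda>y. fd (\<lambda>y. f y \<bullet> i) y v) x w" for v w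
    proof -
      have "fd (\<lambda>y. fd f y v) x w \<bullet> i = fd (\<lambda>y. fd f y v \<bullet> i) x w"
        using fd_inner[OF smooth_on_differentiable[OF smooth_on_fd[OF f] S(2)]] by simp
      also have "\<dots> = fd (\<lambda>y. fd (\<lambda>y. f y \<bullet> i) y v) x w"
        using fd_inner[OF smooth_on_differentiable[OF f]]
        by (intro fun_cong[OF fd_cong[OF S]]) simp
      finally show ?thesis .
    qed
    show "fd (\<lambda>y. fd f y v) x w \<bullet> i = fd (\<lambda>y. fd f y w) x v \<bullet> i"
      unfolding comp by (rule real) (rule smooth_on_inner[OF S(1) f])
  qed
qed

section \<open>Tangent vectors and vector fields in charts\<close>

definition in_chart :: "('p, 'e::euclidean_space) chart \<Rightarrow> ('p, 'e) vfield \<Rightarrow> 'e \<Rightarrow> 'e" where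
  "in_chart c X x = X (chart_inv c x) c"

locale atlas =
  fixes A :: "('p, 'e::euclidean_space) chart set"
  assumes smooth_atlas: "smooth_atlas A"
begin

abbreviation jac :: "('p, 'e) chart \<Rightarrow> ('p, 'e) chart \<Rightarrow> 'p \<Rightarrow> 'e \<Rightarrow> 'e" where
  "jac c c' p \<equiv> fd (transition c c') (snd c p)"

lemma charts_atD: "c \<in> charts_at A p \<Longrightarrow> c \<in> A" "c \<in> charts_at A p \<Longrightarrow> p \<in> fst c"
  by (auto simp: charts_at_def)

lemma charts_atI: "c \<in> A \<Longrightarrow> p \<in> fst c \<Longrightarrow> c \<in> charts_at A p"
  by (auto simp: charts_at_def)

lemma chart_inv_chart [simp]: "c \<in> A \<Longrightarrow> p \<in> fst c \<Longrightarrow> chart_inv c (snd c p) = p"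
  using smooth_atlas by (auto simp: chart_inv_def smooth_atlas_def inv_into_f_f)

lemma in_chart_at [simp]: "c \<in> A \<Longrightarrow> p \<in> fst c \<Longrightarrow> in_chart c X (snd c p) = X p c"
  by (simp add: in_chart_def)

lemma transition_chart [simp]: "c \<in> A \<Longrightarrow> p \<in> fst c \<Longrightarrow> transition c c' (snd c p) = snd c' p"
  by (simp add: transition_def)

lemma open_overlap: "c \<in> A \<Longrightarrow> c' \<in> A \<Longrightarrow> open (snd c ` (fst c \<inter> fst c'))"
  using smooth_atlas by (auto simp: smooth_atlas_def)

lemma open_chart_range: "c \<in> A \<Longrightarrow> open (snd c ` fst c)"
  using open_overlap[of c c] by simp

lemma smooth_transition:
  "c \<in> A \<Longrightarrow> c' \<in> A \<Longrightarrow> smooth_on (snd c ` (fst c \<inter> fst c')) (transition c c')"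
  using smooth_atlas by (auto simp: smooth_atlas_def)

lemma transition_differentiable:
  "c \<in> charts_at A p \<Longrightarrow> c' \<in> charts_at A p \<Longrightarrow> transition c c' differentiable (at (snd c p))"
  by (rule smooth_on_differentiable[OF smooth_transition]) (auto dest: charts_atD)

lemma linear_jac: "c \<in> charts_at A p \<Longrightarrow> c' \<in> charts_at A p \<Longrightarrow> linear (jac c c' p)"
  by (intro linear_fd transition_differentiable)

lemma jac_self [simp]: "c \<in> charts_at A p \<Longrightarrow> jac c c p v = v"
proof -
  assume c: "c \<in> charts_at A p"
  have "fd (transition c c) (snd c p) = fd (\<lambda>x. x) (snd c p)"
    using c by (intro fd_cong[OF open_chart_range[of c]]) (auto dest: charts_atD)
  then show ?thesis by simp
qed

text \<open>The chain rule for the transition maps on the triple overlap.\<close>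

lemma jac_cocycle:
  assumes c: "c \<in> charts_at A p" "c' \<in> charts_at A p" "c'' \<in> charts_at A p"
  shows "jac c' c'' p (jac c c' p v) = jac c c'' p v"
proof -
  note [simp] = c[THEN charts_atD(1)] c[THEN charts_atD(2)]
  let ?W = "snd c ` (fst c \<inter> fst c' \<inter> (fst c \<inter> fst c''))"
  have "?W = snd c ` (fst c \<inter> fst c') \<inter> snd c ` (fst c \<inter> fst c'')"
    using smooth_atlas by (intro inj_on_image_Int[of _ "fst c"]) (auto simp: smooth_atlas_def)
  then have W: "open ?W"
    by (simp add: open_Int open_overlap)
  have "jac c c'' p = fd (\<lambda>x. transition c' c'' (transition c c' x)) (snd c p)"
    by (rule fd_cong[OF W]) auto
  then show ?thesis
    using fd_chain[of "transition c c'" "snd c p" "transition c' c''"] c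
    by (simp add: transition_differentiable)
qed

lemma tangent_space_component:
  "v \<in> tangent_space A p \<Longrightarrow> c \<in> charts_at A p \<Longrightarrow> c' \<in> charts_at A p \<Longrightarrow> v c' = jac c c' p (v c)"
  unfolding tangent_space_def by blast

lemma tangent_space_off: "v \<in> tangent_space A p \<Longrightarrow> c \<notin> charts_at A p \<Longrightarrow> v c = 0"
  unfolding tangent_space_def by blast

lemma tangent_spaceI:
  assumes "\<And>c. c \<notin> charts_at A p \<Longrightarrow> v c = 0"
    and "\<And>c c'. c \<in> charts_at A p \<Longrightarrow> c' \<in> charts_at A p \<Longrightarrow> v c' = jac c c' p (v c)"
  shows "v \<in> tangent_space A p"
  using assms unfolding tangent_space_def by blast

text \<open>A tangent vector is determined by its components in a single chart, which is why all later
  identities between tangent vectors are checked in one chart.\<close>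

lemma tangent_space_eqI:
  assumes "v \<in> tangent_space A p" "w \<in> tangent_space A p" "c \<in> charts_at A p" "v c = w c"
  shows "v = w"
proof
  fix c'
  show "v c' = w c'"
  proof (cases "c' \<in> charts_at A p")
    case True
    then show ?thesis
      using tangent_space_component[OF assms(1,3) True] tangent_space_component[OF assms(2,3) True] assms(4)
      by metis
  next
    case False
    then show ?thesis
      using assms(1,2) tangent_space_off by metis
  qed
qed

lemma tangent_space_zero: "0 \<in> tangent_space A p"
  by (rule tangent_spaceI) (simp_all add: linear_0[OF linear_jac])

lemma tangent_space_add:
  assumes "v \<in> tangent_space A p" "w \<in> tangent_space A p"
  shows "v + w \<in> tangent_space A p"
proof (rule tangent_spaceI)
  fix c c' assume c: "c \<in> charts_at A p" "c' \<in> charts_at A p"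
  show "(v + w) c' = jac c c' p ((v + w) c)"
    by (simp add: linear_add[OF linear_jac[OF c]] tangent_space_component[OF assms(1) c]
        tangent_space_component[OF assms(2) c])
qed (simp add: tangent_space_off[OF assms(1)] tangent_space_off[OF assms(2)])

lemma tangent_space_scale:
  assumes "v \<in> tangent_space A p"
  shows "a *\<^sub>R v \<in> tangent_space A p"
proof (rule tangent_spaceI)
  fix c c' assume c: "c \<in> charts_at A p" "c' \<in> charts_at A p"
  show "(a *\<^sub>R v) c' = jac c c' p ((a *\<^sub>R v) c)"
    by (simp add: linear_scale[OF linear_jac[OF c]] tangent_space_component[OF assms c])
qed (simp add: tangent_space_off[OF assms])

lemma tangent_space_minus: "v \<in> tangent_space A p \<Longrightarrow> - v \<in> tangent_space A p"
  using tangent_space_scale[of v p "-1"] by (simp add: scaleR_minus_left)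

lemma tangent_space_diff: "v \<in> tangent_space A p \<Longrightarrow> w \<in> tangent_space A p \<Longrightarrow> v - w \<in> tangent_space A p"
  using tangent_space_add[OF _ tangent_space_minus, of v p w] by simp

lemma tangent_space_sum:
  "(\<And>i. i \<in> I \<Longrightarrow> v i \<in> tangent_space A p) \<Longrightarrow> (\<Sum>i\<in>I. v i) \<in> tangent_space A p"
  by (induction I rule: infinite_finite_induct) (auto simp: tangent_space_zero tangent_space_add)

lemma coord_field_component:
  "c \<in> charts_at A p \<Longrightarrow> c' \<in> charts_at A p \<Longrightarrow> coord_field A c w p c' = jac c c' p w"
  by (simp add: coord_field_def)

lemma coord_field_self [simp]: "c \<in> charts_at A p \<Longrightarrow> coord_field A c w p c = w"
  by (simp add: coord_field_def)

lemma coord_field_tangent: "c \<in> charts_at A p \<Longrightarrow> coord_field A c w p \<in> tangent_space A p"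
  by (rule tangent_spaceI) (simp_all add: coord_field_def jac_cocycle)

lemma coord_field_eq:
  "v \<in> tangent_space A p \<Longrightarrow> c \<in> charts_at A p \<Longrightarrow> coord_field A c (v c) p = v"
  using tangent_space_eqI[OF coord_field_tangent] by simp

lemma coord_field_add:
  "c \<in> charts_at A p \<Longrightarrow> coord_field A c (v + w) p = coord_field A c v p + coord_field A c w p"
  by (rule tangent_space_eqI[where c=c]) (auto intro: coord_field_tangent tangent_space_add)

lemma coord_field_scale:
  "c \<in> charts_at A p \<Longrightarrow> coord_field A c (a *\<^sub>R v) p = a *\<^sub>R coord_field A c v p"
  by (rule tangent_space_eqI[where c=c]) (auto intro: coord_field_tangent tangent_space_scale)

lemma in_chart_coord_field [simp]:
  "c \<in> A \<Longrightarrow> x \<in> snd c ` fst c \<Longrightarrow> in_chart c (coord_field A c w) x = w"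
  by (auto simp: charts_atI)

lemma openin_iff:
  "openin (manifold_topology A) U \<longleftrightarrow> U \<subseteq> points A \<and> (\<forall>c\<in>A. open (snd c ` (U \<inter> fst c)))"
  by (rule openin_manifold_topology[OF smooth_atlas])

lemma open_in_chart: "openin (manifold_topology A) U \<Longrightarrow> c \<in> A \<Longrightarrow> open (snd c ` (U \<inter> fst c))"
  by (simp add: openin_iff)

lemma openin_chart: "c \<in> A \<Longrightarrow> openin (manifold_topology A) (fst c)"
  by (auto simp: openin_iff points_def Int_commute intro: open_overlap)

lemma openin_chart_Int:
  "openin (manifold_topology A) U \<Longrightarrow> c \<in> A \<Longrightarrow> openin (manifold_topology A) (U \<inter> fst c)"
  by (intro openin_Int openin_chart)

lemma ex_chart: "openin (manifold_topology A) U \<Longrightarrow> p \<in> U \<Longrightarrow> \<exists>c. c \<in> charts_at A p"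
  by (force simp: openin_iff points_def charts_at_def)

lemma vector_field_iff:
  "vector_field A U X \<longleftrightarrow> (\<forall>p\<in>U. X p \<in> tangent_space A p) \<and>
     (\<forall>c\<in>A. smooth_on (snd c ` (U \<inter> fst c)) (in_chart c X))"
  by (simp add: vector_field_def in_chart_def[abs_def])

lemma vector_field_tangent: "vector_field A U X \<Longrightarrow> p \<in> U \<Longrightarrow> X p \<in> tangent_space A p"
  by (simp add: vector_field_iff)

lemma vector_field_smooth: "vector_field A U X \<Longrightarrow> c \<in> A \<Longrightarrow> smooth_on (snd c ` (U \<inter> fst c)) (in_chart c X)"
  by (simp add: vector_field_iff)

lemma vector_field_differentiable:
  "vector_field A U X \<Longrightarrow> p \<in> U \<Longrightarrow> c \<in> charts_at A p \<Longrightarrow> in_chart c X differentiable (at (snd c p))"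
  by (rule smooth_on_differentiable[OF vector_field_smooth]) (auto dest: charts_atD)

lemma vector_field_subset: "vector_field A U X \<Longrightarrow> V \<subseteq> U \<Longrightarrow> vector_field A V X"
  unfolding vector_field_iff
  by (meson Int_mono image_mono order_refl smooth_on_subset subsetD)

text \<open>On an open set inside one chart, smoothness need only be checked in that chart: the
  components in the others arise by composing with the smooth transition map and its derivative.\<close>

lemma smooth_funI_in_chart:
  assumes U: "openin (manifold_topology A) U" "U \<subseteq> fst c" and c: "c \<in> A"
    and f: "smooth_on (snd c ` U) (f \<circ> chart_inv c)"
  shows "smooth_fun A U f"
  unfolding smooth_fun_def
proof
  fix c' assume c': "c' \<in> A"
  let ?S = "snd c' ` (U \<inter> fst c')"
  have S: "open ?S" using U c' by (simp add: open_in_chart)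
  have "smooth_on ?S (\<lambda>x. (f \<circ> chart_inv c) (transition c' c x))"
  proof (rule smooth_on_compose[OF S _ f])
    show "transition c' c ` ?S \<subseteq> snd c ` U"
      using c c' by auto
    show "smooth_on ?S (transition c' c)"
      using U by (intro smooth_on_subset[OF smooth_transition[OF c' c]]) auto
  qed
  then show "smooth_on ?S (f \<circ> chart_inv c')"
    by (rule smooth_on_cong[OF S]) (use U c c' in \<open>auto simp: subset_iff\<close>)
qed

lemma vector_fieldI_in_chart:
  assumes U: "openin (manifold_topology A) U" "U \<subseteq> fst c" and c: "c \<in> A"
    and X: "\<And>p. p \<in> U \<Longrightarrow> X p \<in> tangent_space A p" "smooth_on (snd c ` U) (in_chart c X)"
  shows "vector_field A U X"
  unfolding vector_field_iff
proof (intro conjI ballI)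
  fix c' assume c': "c' \<in> A"
  let ?S = "snd c' ` (U \<inter> fst c')" and ?\<tau> = "transition c' c"
  have S: "open ?S" using U c' by (simp add: open_in_chart)
  have sub: "?\<tau> ` ?S \<subseteq> snd c ` U" "?\<tau> ` ?S \<subseteq> snd c ` (fst c \<inter> fst c')"
    using c c' U(2) by auto
  have sm: "smooth_on ?S ?\<tau>"
    using U by (intro smooth_on_subset[OF smooth_transition[OF c' c]]) auto
  have at: "c \<in> charts_at A p" "c' \<in> charts_at A p" if "p \<in> U" "p \<in> fst c'" for p
    using that U(2) c c' by (auto intro: charts_atI)
  have "smooth_on ?S (\<lambda>x. fd (transition c c') (?\<tau> x) (in_chart c X (?\<tau> x)))"
  proof (rule smooth_on_linear_family[where F="\<lambda>x. fd (transition c c') (?\<tau> x)", OF S])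
    show "linear (fd (transition c c') (?\<tau> y))" if "y \<in> ?S" for y
    proof -
      from that obtain p where "p \<in> U" "p \<in> fst c'" "y = snd c' p" by auto
      then show ?thesis
        using linear_jac[OF at, of p] c' by simp
    qed
    show "smooth_on ?S (\<lambda>y. fd (transition c c') (?\<tau> y) i)" for i
      by (rule smooth_on_compose[OF S sub(2) smooth_on_fd[OF smooth_transition[OF c c']] sm])
    show "smooth_on ?S (\<lambda>x. in_chart c X (?\<tau> x))"
      by (rule smooth_on_compose[OF S sub(1) X(2) sm])
  qed
  then show "smooth_on ?S (in_chart c' X)"
  proof (rule smooth_on_cong[OF S])
    fix x assume "x \<in> ?S"
    then obtain p where "p \<in> U" "p \<in> fst c'" "x = snd c' p" by auto
    then show "fd (transition c c') (?\<tau> x) (in_chart c X (?\<tau> x)) = in_chart c' X x"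
      using c c' U(2) tangent_space_component[OF X(1) at, of p] by auto
  qed
qed (use X in auto)

lemma vector_field_coord: "c \<in> A \<Longrightarrow> vector_field A (fst c) (coord_field A c w)"
proof (rule vector_fieldI_in_chart[OF openin_chart order_refl])
  assume c: "c \<in> A"
  show "smooth_on (snd c ` fst c) (in_chart c (coord_field A c w))"
    using c by (intro smooth_on_cong[OF open_chart_range smooth_on_const[of _ w]]) simp_all
qed (auto intro: coord_field_tangent charts_atI)

lemma vector_field_zero: "vector_field A U (\<lambda>p. 0)"
  by (simp add: vector_field_def tangent_space_zero smooth_on_const)

lemma vector_field_add:
  assumes "openin (manifold_topology A) U" "vector_field A U X" "vector_field A U Y"
  shows "vector_field A U (X + Y)"
  using assms unfolding vector_field_def
  by (simp add: tangent_space_add smooth_on_add open_in_chart)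

lemma vector_field_scale:
  assumes "openin (manifold_topology A) U" "smooth_fun A U f" "vector_field A U X"
  shows "vector_field A U (\<lambda>q. f q *\<^sub>R X q)"
  using assms unfolding vector_field_def smooth_fun_def comp_def
  by (simp add: tangent_space_scale smooth_on_scaleR open_in_chart)

lemma vector_field_sum_scale:
  assumes "openin (manifold_topology A) U"
    and "\<And>i. i \<in> I \<Longrightarrow> smooth_fun A U (f i)" "\<And>i. i \<in> I \<Longrightarrow> vector_field A U (E i)"
  shows "vector_field A U (\<lambda>q. \<Sum>i\<in>I. f i q *\<^sub>R E i q)"
  using assms(2,3)
proof (induction I rule: infinite_finite_induct)
  case (insert i I)
  have "vector_field A U (\<lambda>q. \<Sum>i\<in>I. f i q *\<^sub>R E i q)"
    by (rule insert.IH[OF insert.prems]) simp_all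
  then have "vector_field A U ((\<lambda>q. f i q *\<^sub>R E i q) + (\<lambda>q. \<Sum>i\<in>I. f i q *\<^sub>R E i q))"
    using vector_field_add[OF assms(1) vector_field_scale[OF assms(1) insert.prems]] by simp
  moreover have "(\<lambda>q. f i q *\<^sub>R E i q) + (\<lambda>q. \<Sum>i\<in>I. f i q *\<^sub>R E i q)
      = (\<lambda>q. \<Sum>i\<in>insert i I. f i q *\<^sub>R E i q)"
    by (rule ext) (simp only: plus_fun_apply[of "\<lambda>q. f i q *\<^sub>R E i q"] sum.insert[OF insert(1,2)])
  ultimately show ?case by (simp only:)
qed (simp_all add: vector_field_zero)

lemma in_chart_transition:
  assumes "c \<in> charts_at A p" "c' \<in> charts_at A p" "X p \<in> tangent_space A p"
  shows "in_chart c' X (transition c c' (snd c p)) = jac c c' p (in_chart c X (snd c p))"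
  using tangent_space_component[OF assms(3,1,2)]
  by (simp add: charts_atD[OF assms(1)] charts_atD[OF assms(2)])

text \<open>How the derivative of the components of a field transforms: to the tensorial term the second
  derivative of the transition map is added. It is symmetric, so it cancels in Lie brackets; it is
  also the inhomogeneous term in the transformation of Christoffel symbols.\<close>

lemma fd_in_chart_transition:
  assumes U: "openin (manifold_topology A) U" "p \<in> U"
    and c: "c \<in> charts_at A p" and c': "c' \<in> charts_at A p"
    and Y: "\<And>q. q \<in> U \<Longrightarrow> Y q \<in> tangent_space A q"
      "\<And>c. c \<in> charts_at A p \<Longrightarrow> in_chart c Y differentiable (at (snd c p))"
    and v: "v \<in> tangent_space A p"
  shows "fd (in_chart c' Y) (snd c' p) (v c')
    = fd (\<lambda>x. fd (transition c c') x (Y p c)) (snd c p) (v c)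
      + jac c c' p (fd (in_chart c Y) (snd c p) (v c))"
proof -
  note A = c[THEN charts_atD(1)] c'[THEN charts_atD(1)] and P = c[THEN charts_atD(2)] c'[THEN charts_atD(2)]
  let ?\<tau> = "transition c c'" and ?x = "snd c p" and ?W = "snd c ` (U \<inter> fst c' \<inter> fst c)"
  have W: "open ?W" "?x \<in> ?W"
    using U A P by (auto intro: open_in_chart openin_chart_Int)
  have at: "c \<in> charts_at A q" "c' \<in> charts_at A q" if "q \<in> U \<inter> fst c' \<inter> fst c" for q
    using that A by (auto intro: charts_atI)
  have "((\<lambda>x. fd ?\<tau> x (in_chart c Y x)) has_derivative
      (\<lambda>h. fd (\<lambda>x. fd ?\<tau> x (in_chart c Y ?x)) ?x h + fd ?\<tau> ?x (fd (in_chart c Y) ?x h))) (at ?x)"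
  proof (rule has_derivative_linear_family[where F="fd ?\<tau>", OF W])
    show "linear (fd ?\<tau> y)" if "y \<in> ?W" for y
    proof -
      from that obtain q where "q \<in> U \<inter> fst c' \<inter> fst c" "y = snd c q" by auto
      then show ?thesis
        using linear_jac[OF at, of q] by simp
    qed
    show "(\<lambda>y. fd ?\<tau> y i) differentiable at ?x" for i
      using W(2) A by (intro smooth_on_differentiable[OF smooth_on_fd[OF smooth_transition[of c c']]]) auto
    show "(in_chart c Y has_derivative fd (in_chart c Y) ?x) (at ?x)"
      by (rule has_derivative_fd[OF Y(2)[OF c]])
  qed
  then have 1: "fd (\<lambda>x. fd ?\<tau> x (in_chart c Y x)) ?x (v c) =
      fd (\<lambda>x. fd ?\<tau> x (Y p c)) ?x (v c) + jac c c' p (fd (in_chart c Y) ?x (v c))"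
    using A P by (simp add: fd_eqI)
  have "fd (\<lambda>x. fd ?\<tau> x (in_chart c Y x)) ?x = fd (\<lambda>x. in_chart c' Y (?\<tau> x)) ?x"
  proof (rule fd_cong[OF W])
    fix y assume "y \<in> ?W"
    then obtain q where "q \<in> U \<inter> fst c' \<inter> fst c" "y = snd c q" by auto
    then show "fd ?\<tau> y (in_chart c Y y) = in_chart c' Y (?\<tau> y)"
      using in_chart_transition[of c q c' Y] at[of q] Y(1)[of q] by auto
  qed
  then have "fd (\<lambda>x. fd ?\<tau> x (in_chart c Y x)) ?x (v c) = fd (in_chart c' Y) (snd c' p) (jac c c' p (v c))"
    using A P Y(2) c c' by (simp add: fd_chain transition_differentiable)
  also have "jac c c' p (v c) = v c'"
    using tangent_space_component[OF v c c'] by (rule sym)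
  finally show ?thesis using 1 by simp
qed

lemma lie_bracket_component:
  "c \<in> charts_at A p \<Longrightarrow> lie_bracket A X Y p c =
     fd (in_chart c Y) (snd c p) (X p c) - fd (in_chart c X) (snd c p) (Y p c)"
  by (simp add: lie_bracket_def in_chart_def[abs_def])

text \<open>Stated for fields with differentiable components, so as to apply also to the images of
  vector fields under an endomorphism field.\<close>

lemma lie_bracket_tangent:
  assumes U: "openin (manifold_topology A) U" "p \<in> U"
    and X: "\<And>q. q \<in> U \<Longrightarrow> X q \<in> tangent_space A q"
      "\<And>c. c \<in> charts_at A p \<Longrightarrow> in_chart c X differentiable (at (snd c p))"
    and Y: "\<And>q. q \<in> U \<Longrightarrow> Y q \<in> tangent_space A q"
      "\<And>c. c \<in> charts_at A p \<Longrightarrow> in_chart c Y differentiable (at (snd c p))"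
  shows "lie_bracket A X Y p \<in> tangent_space A p"
proof -
  have "lie_bracket A X Y p c' = jac c c' p (lie_bracket A X Y p c)"
    if c: "c \<in> charts_at A p" and c': "c' \<in> charts_at A p" for c c'
  proof -
    have "fd (\<lambda>x. fd (transition c c') x (Y p c)) (snd c p) (X p c)
        = fd (\<lambda>x. fd (transition c c') x (X p c)) (snd c p) (Y p c)"
      using c c' by (intro second_derivative_symmetric[OF open_overlap _ smooth_transition])
        (auto dest: charts_atD)
    then show ?thesis
      using fd_in_chart_transition[OF U c c' Y X(1)] fd_in_chart_transition[OF U c c' X Y(1)] U c c'
      by (simp add: lie_bracket_component linear_diff[OF linear_jac])
  qed
  moreover have "lie_bracket A X Y p c = 0" if "c \<notin> charts_at A p" for c
    using that by (simp add: lie_bracket_def)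
  ultimately show ?thesis
    by (rule tangent_spaceI[rotated])
qed

lemma smooth_on_fd_along:
  fixes f :: "'e \<Rightarrow> 'b::real_normed_vector"
  assumes "open S" "smooth_on S f" "smooth_on S a"
  shows "smooth_on S (\<lambda>x. fd f x (a x))"
  by (rule smooth_on_linear_family[where F="fd f",
        OF assms(1) linear_fd[OF smooth_on_differentiable[OF assms(2)]] smooth_on_fd[OF assms(2)] assms(3)])

lemma vector_field_lie_bracket:
  assumes U: "openin (manifold_topology A) U" and X: "vector_field A U X" and Y: "vector_field A U Y"
  shows "vector_field A U (lie_bracket A X Y)"
  unfolding vector_field_iff
proof (intro conjI ballI)
  fix c assume c: "c \<in> A"
  let ?S = "snd c ` (U \<inter> fst c)"
  have S: "open ?S" using U c by (rule open_in_chart)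
  have "smooth_on ?S (\<lambda>x. fd (in_chart c Y) x (in_chart c X x) - fd (in_chart c X) x (in_chart c Y x))"
    using S X Y c by (intro smooth_on_diff smooth_on_fd_along vector_field_smooth)
  then show "smooth_on ?S (in_chart c (lie_bracket A X Y))"
    by (rule smooth_on_cong[OF S]) (use c in \<open>auto simp: lie_bracket_component charts_atI\<close>)
qed (use U X Y in \<open>blast intro: lie_bracket_tangent vector_field_tangent vector_field_differentiable\<close>)

text \<open>The chart used in the definition of the directional derivative is arbitrary; by the chain
  rule any chart around the point gives the same value.\<close>

lemma dir_deriv_in_chart:
  assumes c: "c \<in> charts_at A p" and v: "v \<in> tangent_space A p"
    and f: "f \<circ> chart_inv c differentiable (at (snd c p))"
  shows "dir_deriv A p v f = fd (f \<circ> chart_inv c) (snd c p) (v c)"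
proof -
  define c0 where "c0 = (SOME c. c \<in> charts_at A p)"
  have c0: "c0 \<in> charts_at A p"
    unfolding c0_def using c by (rule someI)
  note A = c[THEN charts_atD(1)] c0[THEN charts_atD(1)] and P = c[THEN charts_atD(2)] c0[THEN charts_atD(2)]
  let ?\<tau> = "transition c0 c"
  have "fd (f \<circ> chart_inv c0) (snd c0 p) = fd (\<lambda>x. (f \<circ> chart_inv c) (?\<tau> x)) (snd c0 p)"
    using A P by (intro fd_cong[OF open_overlap[of c0 c]]) auto
  moreover have "fd (\<lambda>x. (f \<circ> chart_inv c) (?\<tau> x)) (snd c0 p) (v c0)
      = fd (f \<circ> chart_inv c) (snd c p) (jac c0 c p (v c0))"
    using A P f c c0 by (subst fd_chain) (auto simp: transition_differentiable)
  ultimately show ?thesis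
    using tangent_space_component[OF v c0 c] by (simp add: dir_deriv_def Let_def c0_def)
qed

end

section \<open>Connections in charts\<close>

lemma sum_fun_apply: "(\<Sum>i\<in>I. f i) x = (\<Sum>i\<in>I. f i x)"
  for f :: "'i \<Rightarrow> 'a \<Rightarrow> 'b::comm_monoid_add"
  by (induction I rule: infinite_finite_induct) auto

text \<open>With \<open>G x a b = a\<^sup>i b\<^sup>j \<Gamma>\<^sub>i\<^sub>j\<^sup>k\<close>, these are the coordinate expressions of the curvature
  \<open>R(a, b) v\<close>, of \<open>(\<nabla>\<^sub>a K) b\<close> for an endomorphism field \<open>K\<close>, and of \<open>\<nabla>\<^sub>X Y\<close>.\<close>

definition curv :: "('e::real_normed_vector \<Rightarrow> 'e \<Rightarrow> 'e \<Rightarrow> 'e) \<Rightarrow> 'e \<Rightarrow> 'e \<Rightarrow> 'e \<Rightarrow> 'e \<Rightarrow> 'e" where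
  "curv G x a b v = fd (\<lambda>y. G y b v) x a - fd (\<lambda>y. G y a v) x b + G x a (G x b v) - G x b (G x a v)"

definition cov_endo :: "('e::real_normed_vector \<Rightarrow> 'e \<Rightarrow> 'e \<Rightarrow> 'e) \<Rightarrow> ('e \<Rightarrow> 'e \<Rightarrow> 'e) \<Rightarrow> 'e \<Rightarrow> 'e \<Rightarrow> 'e \<Rightarrow> 'e" where
  "cov_endo G K x a b = fd (\<lambda>y. K y b) x a + G x a (K x b) - K x (G x a b)"

definition nabla :: "('e::real_normed_vector \<Rightarrow> 'e \<Rightarrow> 'e \<Rightarrow> 'e) \<Rightarrow> ('e \<Rightarrow> 'e) \<Rightarrow> ('e \<Rightarrow> 'e) \<Rightarrow> 'e \<Rightarrow> 'e" where
  "nabla G X Y x = fd Y x (X x) + G x (X x) (Y x)"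

text \<open>The Christoffel symbols of a torsion-free connection over the range \<open>V\<close> of a chart.\<close>

locale chart_connection =
  fixes V :: "'e::euclidean_space set" and G :: "'e \<Rightarrow> 'e \<Rightarrow> 'e \<Rightarrow> 'e"
  assumes open_V: "open V"
    and G_linear_left: "linear (\<lambda>a. G x a b)" and G_linear_right: "linear (G x a)"
    and G_smooth: "smooth_on V (\<lambda>x. G x a b)"
    and G_sym: "x \<in> V \<Longrightarrow> G x a b = G x b a"
begin

lemma G_differentiable: "x \<in> V \<Longrightarrow> (\<lambda>y. G y a b) differentiable (at x)"
  by (rule smooth_on_differentiable[OF G_smooth])

lemmas G_add_right = linear_add[OF G_linear_right]
  and G_diff_left = linear_diff[OF G_linear_left] and G_diff_right = linear_diff[OF G_linear_right]
  and G_minus_left = linear_neg[OF G_linear_left] and G_minus_right = linear_neg[OF G_linear_right]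
  and G_scale_right = linear_scale[OF G_linear_right]

text \<open>The second derivatives of \<open>Z\<close> cancel by symmetry and the derivatives of \<open>X\<close> and \<open>Y\<close> cancel
  against the bracket; what is left is tensorial.\<close>

lemma curvature_tensorial:
  assumes W: "open W" "x \<in> W" "W \<subseteq> V"
    and X: "X differentiable (at x)" and Y: "Y differentiable (at x)" and Z: "smooth_on W Z"
  shows "nabla G X (nabla G Y Z) x - nabla G Y (nabla G X Z) x
      - nabla G (\<lambda>y. fd Y y (X y) - fd X y (Y y)) Z x = curv G x (X x) (Y x) (Z x)"
proof -
  have Zd: "Z differentiable (at y)" if "y \<in> W" for y
    using smooth_on_differentiable[OF Z that] .
  have *: "fd (nabla G Y Z) x v = fd (\<lambda>y. fd Z y (Y x)) x v + fd Z x (fd Y x v)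
      + (fd (\<lambda>y. G y (Y x) (Z x)) x v + G x (fd Y x v) (Z x) + G x (Y x) (fd Z x v))"
    if Y: "Y differentiable (at x)" for Y v
  proof -
    have 1: "((\<lambda>y. fd Z y (Y y)) has_derivative (\<lambda>h. fd (\<lambda>y. fd Z y (Y x)) x h + fd Z x (fd Y x h))) (at x)"
      using W(2) by (intro has_derivative_linear_family[where F="fd Z", OF W(1,2) linear_fd[OF Zd]]
          has_derivative_fd Y)
        (auto intro: smooth_on_differentiable[OF smooth_on_fd[OF Z]])
    have 2: "((\<lambda>y. G y (Y y) (Z y)) has_derivative
       (\<lambda>h. fd (\<lambda>y. G y (Y x) (Z x)) x h + G x (fd Y x h) (Z x) + G x (Y x) (fd Z x h))) (at x)"
      using W by (intro has_derivative_bilinear_family[where \<phi>="\<lambda>y. y" and G=G, OF open_V] has_derivative_fd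
          has_derivative_ident G_linear_left G_linear_right G_differentiable Y Zd) auto
    show ?thesis
      unfolding nabla_def[abs_def] using fd_eqI[OF has_derivative_add[OF 1 2]] by simp
  qed
  have "fd (\<lambda>y. fd Z y (Y x)) x (X x) = fd (\<lambda>y. fd Z y (X x)) x (Y x)"
    by (rule second_derivative_symmetric[OF W(1,2) Z])
  then show ?thesis
    using *[OF X] *[OF Y] W(2,3)
    by (simp add: nabla_def curv_def linear_diff[OF linear_fd[OF Zd]] G_diff_left G_add_right algebra_simps)
qed

end

locale manifold_connection = atlas A for A :: "('p, 'e::euclidean_space) chart set" +
  fixes D :: "('p, 'e) vfield \<Rightarrow> ('p, 'e) vfield \<Rightarrow> ('p, 'e) vfield"
  assumes connection: "connection A D"
begin

definition gam :: "('p, 'e) chart \<Rightarrow> 'e \<Rightarrow> 'e \<Rightarrow> 'e \<Rightarrow> 'e" where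
  "gam c x = christoffel A D c (chart_inv c x)"

lemma gam_at [simp]: "c \<in> A \<Longrightarrow> p \<in> fst c \<Longrightarrow> gam c (snd c p) = christoffel A D c p"
  by (simp add: gam_def)

lemma gam_linear_left: "linear (\<lambda>a. gam c x a b)"
  unfolding gam_def christoffel_def
  by (intro linear_compose_sum ballI linearI)
    (simp_all add: inner_add_left scaleR_add_left distrib_right)

lemma gam_linear_right: "linear (gam c x a)"
  unfolding gam_def christoffel_def
  by (intro linear_compose_sum ballI linearI)
    (simp_all add: inner_add_left scaleR_add_left distrib_left mult.left_commute)

lemma smooth_fun_const: "smooth_fun A U (\<lambda>_. r)"
  by (simp add: smooth_fun_def comp_def smooth_on_const)

context
  fixes U X Y
  assumes U: "openin (manifold_topology A) U" and X: "vector_field A U X" and Y: "vector_field A U Y"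
begin

lemma D_vector_field: "vector_field A U (D X Y)"
  using connection U X Y smooth_fun_const[of U 0] unfolding connection_def by blast

lemma D_local:
  assumes "vector_field A U X'" "vector_field A U Y'" "\<And>q. q \<in> U \<Longrightarrow> X q = X' q" "\<And>q. q \<in> U \<Longrightarrow> Y q = Y' q"
    and "p \<in> U"
  shows "D X Y p = D X' Y' p"
  using connection U X Y assms smooth_fun_const[of U 0] unfolding connection_def by blast

lemma D_add_left: "vector_field A U X' \<Longrightarrow> p \<in> U \<Longrightarrow> D (X + X') Y p = D X Y p + D X' Y p"
  using connection U X Y smooth_fun_const[of U 0] unfolding connection_def by blast

lemma D_add_right: "vector_field A U Y' \<Longrightarrow> p \<in> U \<Longrightarrow> D X (Y + Y') p = D X Y p + D X Y' p"
  using connection U X Y smooth_fun_const[of U 0] unfolding connection_def by blast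

lemma D_scale_left: "smooth_fun A U f \<Longrightarrow> p \<in> U \<Longrightarrow> D (\<lambda>q. f q *\<^sub>R X q) Y p = f p *\<^sub>R D X Y p"
  using connection U X Y unfolding connection_def by blast

lemma D_scale_right:
  "smooth_fun A U f \<Longrightarrow> p \<in> U \<Longrightarrow>
    D X (\<lambda>q. f q *\<^sub>R Y q) p = dir_deriv A p (X p) f *\<^sub>R Y p + f p *\<^sub>R D X Y p"
  using connection U X Y unfolding connection_def by blast

end

lemma D_zero_left:
  assumes "openin (manifold_topology A) U" "vector_field A U Y" "p \<in> U"
  shows "D (\<lambda>q. 0) Y p = 0"
  using D_scale_left[OF assms(1) vector_field_zero assms(2) smooth_fun_const[of U 0] assms(3)]
  by (simp only: scaleR_zero_left)

lemma D_zero_right: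
  assumes "openin (manifold_topology A) U" "vector_field A U X" "p \<in> U"
  shows "D X (\<lambda>q. 0) p = 0"
  using D_scale_right[OF assms(1,2) vector_field_zero smooth_fun_const[of U 0] assms(3)]
  by (simp only: scaleR_zero_left scaleR_zero_right add_0)

lemma D_sum_left:
  assumes U: "openin (manifold_topology A) U" and Y: "vector_field A U Y" and p: "p \<in> U"
    and "\<And>i. i \<in> I \<Longrightarrow> smooth_fun A U (f i)" "\<And>i. i \<in> I \<Longrightarrow> vector_field A U (E i)"
    and I: "finite I"
  shows "D (\<lambda>q. \<Sum>i\<in>I. f i q *\<^sub>R E i q) Y p = (\<Sum>i\<in>I. f i p *\<^sub>R D (E i) Y p)"
  using I assms(4,5)
proof (induction I)
  case empty
  show ?case using D_zero_left[OF U Y p] by (simp only: sum.empty)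
next
  case (insert i I)
  have vf: "vector_field A U (\<lambda>q. f i q *\<^sub>R E i q)" "vector_field A U (\<lambda>q. \<Sum>i\<in>I. f i q *\<^sub>R E i q)"
    by (rule vector_field_scale[OF U insert.prems]; simp)
        (rule vector_field_sum_scale[OF U insert.prems]; simp)
  have "(\<lambda>q. \<Sum>i\<in>insert i I. f i q *\<^sub>R E i q) = (\<lambda>q. f i q *\<^sub>R E i q) + (\<lambda>q. \<Sum>i\<in>I. f i q *\<^sub>R E i q)"
    by (rule ext) (simp only: plus_fun_apply[of "\<lambda>q. f i q *\<^sub>R E i q"] sum.insert[OF insert(1,2)])
  then have "D (\<lambda>q. \<Sum>i\<in>insert i I. f i q *\<^sub>R E i q) Y p
      = D (\<lambda>q. f i q *\<^sub>R E i q) Y p + D (\<lambda>q. \<Sum>i\<in>I. f i q *\<^sub>R E i q) Y p"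
    using D_add_left[OF U vf(1) Y vf(2) p] by (simp only:)
  also have "D (\<lambda>q. f i q *\<^sub>R E i q) Y p = f i p *\<^sub>R D (E i) Y p"
    by (rule D_scale_left[OF U insert.prems(2) Y insert.prems(1) p]) simp_all
  also have "D (\<lambda>q. \<Sum>i\<in>I. f i q *\<^sub>R E i q) Y p = (\<Sum>i\<in>I. f i p *\<^sub>R D (E i) Y p)"
    by (rule insert.IH[OF insert.prems]) simp_all
  finally show ?case
    by (simp only: sum.insert[OF insert(1,2)])
qed

lemma D_sum_right:
  assumes U: "openin (manifold_topology A) U" and X: "vector_field A U X" and p: "p \<in> U"
    and "\<And>i. i \<in> I \<Longrightarrow> smooth_fun A U (f i)" "\<And>i. i \<in> I \<Longrightarrow> vector_field A U (E i)"
    and I: "finite I"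
  shows "D X (\<lambda>q. \<Sum>i\<in>I. f i q *\<^sub>R E i q) p
    = (\<Sum>i\<in>I. dir_deriv A p (X p) (f i) *\<^sub>R E i p + f i p *\<^sub>R D X (E i) p)"
  using I assms(4,5)
proof (induction I)
  case empty
  show ?case using D_zero_right[OF U X p] by (simp only: sum.empty)
next
  case (insert i I)
  have vf: "vector_field A U (\<lambda>q. f i q *\<^sub>R E i q)" "vector_field A U (\<lambda>q. \<Sum>i\<in>I. f i q *\<^sub>R E i q)"
    by (rule vector_field_scale[OF U insert.prems]; simp)
        (rule vector_field_sum_scale[OF U insert.prems]; simp)
  have "(\<lambda>q. \<Sum>i\<in>insert i I. f i q *\<^sub>R E i q) = (\<lambda>q. f i q *\<^sub>R E i q) + (\<lambda>q. \<Sum>i\<in>I. f i q *\<^sub>R E i q)"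
    by (rule ext) (simp only: plus_fun_apply[of "\<lambda>q. f i q *\<^sub>R E i q"] sum.insert[OF insert(1,2)])
  then have "D X (\<lambda>q. \<Sum>i\<in>insert i I. f i q *\<^sub>R E i q) p
      = D X (\<lambda>q. f i q *\<^sub>R E i q) p + D X (\<lambda>q. \<Sum>i\<in>I. f i q *\<^sub>R E i q) p"
    using D_add_right[OF U X vf(1) vf(2) p] by (simp only:)
  also have "D X (\<lambda>q. f i q *\<^sub>R E i q) p = dir_deriv A p (X p) (f i) *\<^sub>R E i p + f i p *\<^sub>R D X (E i) p"
    by (rule D_scale_right[OF U X insert.prems(2) insert.prems(1) p]) simp_all
  also have "D X (\<lambda>q. \<Sum>i\<in>I. f i q *\<^sub>R E i q) p
      = (\<Sum>i\<in>I. dir_deriv A p (X p) (f i) *\<^sub>R E i p + f i p *\<^sub>R D X (E i) p)"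
    by (rule insert.IH[OF insert.prems]) simp_all
  finally show ?case
    by (simp only: sum.insert[OF insert(1,2)])
qed

lemma vector_field_expansion:
  assumes c: "c \<in> charts_at A p" and v: "v \<in> tangent_space A p"
  shows "v = (\<Sum>i\<in>Basis. (v c \<bullet> i) *\<^sub>R coord_field A c i p)"
  using c v
  by (intro tangent_space_eqI[OF v tangent_space_sum c] tangent_space_scale coord_field_tangent)
    (simp_all add: sum_fun_apply euclidean_representation)

lemma smooth_fun_component:
  assumes U: "openin (manifold_topology A) U" "U \<subseteq> fst c" and c: "c \<in> A" and X: "vector_field A U X"
  shows "smooth_fun A U (\<lambda>p. X p c \<bullet> i)"
proof (rule smooth_funI_in_chart[OF U c])
  have "U \<inter> fst c = U" using U(2) by blast
  then have "open (snd c ` U)" "smooth_on (snd c ` U) (in_chart c X)"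
    using vector_field_smooth[OF X c] open_in_chart[OF U(1) c] by simp_all
  then show "smooth_on (snd c ` U) ((\<lambda>p. X p c \<bullet> i) \<circ> chart_inv c)"
    using smooth_on_inner[of "snd c ` U" "in_chart c X" i] by (simp add: in_chart_def[abs_def] comp_def)
qed

text \<open>Inside the chart domain both fields are combinations of coordinate fields with smooth
  coefficients. Linearity over functions in the first argument and the Leibniz rule in the second
  reduce \<open>D X Y\<close> to the coordinate fields, where it is given by the Christoffel symbols. Locality
  of the connection permits the restriction to the chart domain.\<close>

theorem D_in_chart:
  assumes U: "openin (manifold_topology A) U" "p \<in> U" and c: "c \<in> charts_at A p"
    and X: "vector_field A U X" and Y: "vector_field A U Y"
  shows "D X Y p c = fd (in_chart c Y) (snd c p) (X p c) + christoffel A D c p (X p c) (Y p c)"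
proof -
  note cA = charts_atD(1)[OF c] and cp = charts_atD(2)[OF c]
  define U' where "U' = U \<inter> fst c"
  have U': "openin (manifold_topology A) U'" "U' \<subseteq> fst c" "p \<in> U'" "U' \<subseteq> U"
    using U cA cp by (auto simp: U'_def openin_chart_Int)
  have X': "vector_field A U' X" and Y': "vector_field A U' Y"
    using X Y U'(4) by (auto intro: vector_field_subset)
  have at: "c \<in> charts_at A q" if "q \<in> U'" for q
    using that cA U'(2) by (auto intro: charts_atI)
  let ?E = "coord_field A c"
  have E: "vector_field A U' (?E i)" for i
    by (rule vector_field_subset[OF vector_field_coord[OF cA] U'(2)])
  define fX where "fX i q = X q c \<bullet> i" for i q
  define fY where "fY i q = Y q c \<bullet> i" for i q
  have f: "smooth_fun A U' (fX i)" "smooth_fun A U' (fY i)" for i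
    unfolding fX_def[abs_def] fY_def[abs_def] by (rule smooth_fun_component[OF U'(1,2) cA]; fact)+
  define X1 where "X1 q = (\<Sum>i\<in>Basis. fX i q *\<^sub>R ?E i q)" for q
  define Y1 where "Y1 q = (\<Sum>i\<in>Basis. fY i q *\<^sub>R ?E i q)" for q
  have eq: "X q = X1 q" "Y q = Y1 q" if "q \<in> U'" for q
    unfolding X1_def Y1_def fX_def fY_def
    by (rule vector_field_expansion[OF at[OF that]], rule vector_field_tangent[OF _ that], fact)+
  have X1: "vector_field A U' X1" and Y1: "vector_field A U' Y1"
    unfolding X1_def[abs_def] Y1_def[abs_def]
        by (rule vector_field_sum_scale[OF U'(1) f(1) E] vector_field_sum_scale[OF U'(1) f(2) E])+
  have dir: "dir_deriv A p (?E i p) (fY j) = fd (in_chart c Y) (snd c p) i \<bullet> j" for i j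
  proof -
    have d: "in_chart c Y differentiable (at (snd c p))"
      by (rule vector_field_differentiable[OF Y U(2) c])
    have eq: "fY j \<circ> chart_inv c = (\<lambda>x. in_chart c Y x \<bullet> j)"
      by (simp add: fY_def in_chart_def comp_def)
    have "fY j \<circ> chart_inv c differentiable (at (snd c p))"
      unfolding eq using has_derivative_inner_left[OF has_derivative_fd[OF d]]
          by (auto simp: differentiable_def)
    then have "dir_deriv A p (?E i p) (fY j) = fd (fY j \<circ> chart_inv c) (snd c p) (?E i p c)"
      by (rule dir_deriv_in_chart[OF c coord_field_tangent[OF c]])
    then show ?thesis
      using c by (simp add: eq fd_inner[OF d])
  qed
  have "D X Y p = D X1 Y1 p"
    by (rule D_local[OF U'(1) X' Y' X1 Y1 eq U'(3)])
  also have "\<dots> = (\<Sum>i\<in>Basis. fX i p *\<^sub>R D (?E i) Y1 p)"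
    unfolding X1_def[abs_def] by (rule D_sum_left[OF U'(1) Y1 U'(3) f(1) E finite_Basis])
  also have "\<dots> = (\<Sum>i\<in>Basis. fX i p *\<^sub>R
      (\<Sum>j\<in>Basis. dir_deriv A p (?E i p) (fY j) *\<^sub>R ?E j p + fY j p *\<^sub>R D (?E i) (?E j) p))"
    unfolding Y1_def[abs_def] by (intro sum.cong refl arg_cong2[where f=scaleR]
        D_sum_right[OF U'(1) E U'(3) f(2) E finite_Basis])
  finally have "D X Y p c = (\<Sum>i\<in>Basis. fX i p *\<^sub>R
      (\<Sum>j\<in>Basis. (fd (in_chart c Y) (snd c p) i \<bullet> j) *\<^sub>R j + fY j p *\<^sub>R D (?E i) (?E j) p c))"
    using c by (simp add: sum_fun_apply dir)
  also have "\<dots> = (\<Sum>i\<in>Basis. fX i p *\<^sub>R fd (in_chart c Y) (snd c p) i) + christoffel A D c p (X p c) (Y p c)"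
    by (simp add: sum.distrib euclidean_representation scaleR_add_right christoffel_def fX_def
        fY_def scaleR_sum_right)
  also have "(\<Sum>i\<in>Basis. fX i p *\<^sub>R fd (in_chart c Y) (snd c p) i) = fd (in_chart c Y) (snd c p) (X p c)"
    unfolding fX_def
    by (rule linear_Basis_expansion[OF linear_fd[OF vector_field_differentiable[OF Y U(2) c]], symmetric])
  finally show ?thesis .
qed

lemma fd_in_chart_coord_field [simp]: "c \<in> charts_at A p
    \<Longrightarrow> fd (in_chart c (coord_field A c w)) (snd c p) v = 0"
proof -
  assume c: "c \<in> charts_at A p"
  have "fd (in_chart c (coord_field A c w)) (snd c p) = fd (\<lambda>_. w) (snd c p)"
    using charts_atD[OF c] by (intro fd_cong[OF open_chart_range]) (auto simp: charts_atI)
  then show ?thesis by simp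
qed

lemma D_coord_field:
  assumes c: "c \<in> charts_at A p"
  shows "D (coord_field A c a) (coord_field A c b) p c = christoffel A D c p a b"
  using D_in_chart[OF openin_chart _ c vector_field_coord[where w=a] vector_field_coord[where w=b]]
      c charts_atD[OF c]
  by simp

lemma gam_smooth: "c \<in> A \<Longrightarrow> smooth_on (snd c ` fst c) (\<lambda>x. gam c x a b)"
proof -
  assume c: "c \<in> A"
  have "smooth_on (snd c ` fst c) (in_chart c (D (coord_field A c a) (coord_field A c b)))"
    using vector_field_smooth[OF D_vector_field[OF openin_chart[OF c] vector_field_coord[OF c]
        vector_field_coord[OF c]] c]
    by simp
  then show ?thesis
    by (rule smooth_on_cong[OF open_chart_range[OF c]]) (use c in \<open>auto simp: D_coord_field charts_atI\<close>)
qed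

lemma nabla_in_chart:
  assumes U: "openin (manifold_topology A) U" and c: "c \<in> A"
    and X: "vector_field A U X" and Y: "vector_field A U Y" and x: "x \<in> snd c ` (U \<inter> fst c)"
  shows "in_chart c (D X Y) x = nabla (gam c) (in_chart c X) (in_chart c Y) x"
  using x D_in_chart[OF U _ charts_atI[OF c] X Y] c by (auto simp: nabla_def)

text \<open>Since \<open>D X Y\<close> is a vector, the failure of Christoffel symbols to be tensorial compensates
  that of the directional derivative of the components of \<open>Y\<close>. This is exactly what makes the
  coordinate expression of the horizontal lift independent of the chart.\<close>

lemma christoffel_transition:
  assumes c: "c \<in> charts_at A p" and c': "c' \<in> charts_at A p"
    and u: "u \<in> tangent_space A p" and v: "v \<in> tangent_space A p"
  shows "christoffel A D c' p (u c') (v c') =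
    jac c c' p (christoffel A D c p (u c) (v c)) - fd (\<lambda>x. fd (transition c c') x (v c)) (snd c p) (u c)"
proof -
  note cA = charts_atD(1)[OF c] and cp = charts_atD(2)[OF c]
  let ?X = "coord_field A c (u c)" and ?Y = "coord_field A c (v c)"
  note vf = vector_field_coord[OF cA]
  have p: "?X p = u" "?Y p = v"
    using coord_field_eq[OF u c] coord_field_eq[OF v c] by simp_all
  have "D ?X ?Y p \<in> tangent_space A p"
    by (rule vector_field_tangent[OF D_vector_field[OF openin_chart[OF cA] vf vf] cp])
  then have "D ?X ?Y p c' = jac c c' p (christoffel A D c p (u c) (v c))"
    using tangent_space_component[OF _ c c'] D_coord_field[OF c] by metis
  moreover have "D ?X ?Y p c' = fd (in_chart c' ?Y) (snd c' p) (u c') + christoffel A D c' p (u c') (v c')"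
    using D_in_chart[OF openin_chart[OF cA] cp c' vf vf, of "u c" "v c"] by (simp only: p)
  moreover have "fd (in_chart c' ?Y) (snd c' p) (u c')
      = fd (\<lambda>x. fd (transition c c') x (v c)) (snd c p) (u c)"
    using fd_in_chart_transition[OF openin_chart[OF cA] cp c c' vector_field_tangent[OF vf]
        vector_field_differentiable[OF vf cp] u, of "v c"]
      p c linear_0[OF linear_jac[OF c c']] by simp
  ultimately show ?thesis by (simp add: algebra_simps)
qed

end

locale torsion_free_connection = manifold_connection A D
  for A :: "('p, 'e::euclidean_space) chart set" and D +
  assumes torsion_free: "\<And>U X Y p. \<lbrakk>openin (manifold_topology A) U; vector_field A U X;
      vector_field A U Y; p \<in> U\<rbrakk>
    \<Longrightarrow> D X Y p - D Y X p = lie_bracket A X Y p"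
begin

lemma christoffel_sym:
  assumes c: "c \<in> charts_at A p"
  shows "christoffel A D c p a b = christoffel A D c p b a"
proof -
  note cA = charts_atD(1)[OF c] and cp = charts_atD(2)[OF c]
  let ?X = "coord_field A c a" and ?Y = "coord_field A c b"
  note vf = vector_field_coord[OF cA]
  have "(D ?X ?Y p - D ?Y ?X p) c = lie_bracket A ?X ?Y p c"
    using torsion_free[OF openin_chart[OF cA] vf vf cp] by metis
  then show ?thesis
    using c by (simp add: lie_bracket_component D_coord_field)
qed

lemma chart_connection: "c \<in> A \<Longrightarrow> chart_connection (snd c ` fst c) (gam c)"
proof (rule chart_connection.intro)
  fix x a b assume c: "c \<in> A" and "x \<in> snd c ` fst c"
  then obtain p where "p \<in> fst c" "x = snd c p" by auto
  then show "gam c x a b = gam c x b a"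
    using christoffel_sym[OF charts_atI[OF c]] c by simp
qed (auto intro: open_chart_range gam_linear_left gam_linear_right gam_smooth)

lemma curvature_in_chart:
  assumes U: "openin (manifold_topology A) U" "p \<in> U" and c: "c \<in> charts_at A p"
    and X: "vector_field A U X" and Y: "vector_field A U Y" and Z: "vector_field A U Z"
  shows "curvature A D X Y Z p c = curv (gam c) (snd c p) (X p c) (Y p c) (Z p c)"
proof -
  note cA = charts_atD(1)[OF c] and cp = charts_atD(2)[OF c]
  interpret C: chart_connection "snd c ` fst c" "gam c"
    by (rule chart_connection[OF cA])
  let ?W = "snd c ` (U \<inter> fst c)" and ?x = "snd c p" and ?r = "in_chart c"
  have W: "open ?W" "?x \<in> ?W" "?W \<subseteq> snd c ` fst c"
    using U cA cp by (auto intro: open_in_chart)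
  note LB = vector_field_lie_bracket[OF U(1) X Y]
  have nn: "nabla (gam c) (?r X) (?r (D Y Z)) ?x = nabla (gam c) (?r X) (nabla (gam c) (?r Y) (?r Z)) ?x"
    if X: "vector_field A U X" and Y: "vector_field A U Y" for X Y
  proof -
    have "fd (?r (D Y Z)) ?x = fd (nabla (gam c) (?r Y) (?r Z)) ?x"
      by (rule fd_cong[OF W(1,2)]) (rule nabla_in_chart[OF U(1) cA Y Z])
    then show ?thesis
      using nabla_in_chart[OF U(1) cA Y Z W(2)] by (simp add: nabla_def[of _ "?r X"])
  qed
  have "curvature A D X Y Z p c = ?r (D X (D Y Z)) ?x - ?r (D Y (D X Z)) ?x
      - ?r (D (lie_bracket A X Y) Z) ?x"
    using cA cp by (simp add: curvature_def)
  also have "\<dots> = nabla (gam c) (?r X) (nabla (gam c) (?r Y) (?r Z)) ?x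
      - nabla (gam c) (?r Y) (nabla (gam c) (?r X) (?r Z)) ?x
      - nabla (gam c) (?r (lie_bracket A X Y)) (?r Z) ?x"
    using nabla_in_chart[OF U(1) cA X D_vector_field[OF U(1) Y Z] W(2)]
      nabla_in_chart[OF U(1) cA Y D_vector_field[OF U(1) X Z] W(2)]
      nabla_in_chart[OF U(1) cA LB Z W(2)] nn[OF X Y] nn[OF Y X] by simp
  also have "nabla (gam c) (?r (lie_bracket A X Y)) (?r Z) ?x
     = nabla (gam c) (\<lambda>y. fd (?r Y) y (?r X y) - fd (?r X) y (?r Y y)) (?r Z) ?x"
    using c cA cp by (simp add: nabla_def lie_bracket_component)
  finally show ?thesis
    using C.curvature_tensorial[OF W vector_field_differentiable[OF X U(2) c]
        vector_field_differentiable[OF Y U(2) c] vector_field_smooth[OF Z cA]]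
      cA cp by simp
qed

lemma D_tangent:
  "openin (manifold_topology A) U \<Longrightarrow> vector_field A U X \<Longrightarrow> vector_field A U Y \<Longrightarrow> p \<in> U
      \<Longrightarrow> D X Y p \<in> tangent_space A p"
  by (blast intro: vector_field_tangent D_vector_field)

lemma flat_iff: "flat A D \<longleftrightarrow> (\<forall>c\<in>A. \<forall>x\<in>snd c ` fst c. \<forall>a b v. curv (gam c) x a b v = 0)"
proof
  assume flat: "flat A D"
  show "\<forall>c\<in>A. \<forall>x\<in>snd c ` fst c. \<forall>a b v. curv (gam c) x a b v = 0"
  proof (intro ballI allI)
    fix c x a b v assume c: "c \<in> A" and "x \<in> snd c ` fst c"
    then obtain p where p: "p \<in> fst c" "x = snd c p" by auto
    note at = charts_atI[OF c p(1)] and vf = vector_field_coord[OF c] and U = openin_chart[OF c]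
    have "curvature A D (coord_field A c a) (coord_field A c b) (coord_field A c v) p c = 0"
      using flat U vf p(1) unfolding flat_def by (metis zero_fun_apply)
    then show "curv (gam c) x a b v = 0"
      using curvature_in_chart[OF U p(1) at vf vf vf] at p(2) by simp
  qed
next
  assume *: "\<forall>c\<in>A. \<forall>x\<in>snd c ` fst c. \<forall>a b v. curv (gam c) x a b v = 0"
  show "flat A D"
    unfolding flat_def
  proof (intro allI impI ballI)
    fix U X Y Z p
    assume "openin (manifold_topology A) U \<and> vector_field A U X \<and> vector_field A U Y \<and> vector_field A U Z"
      and p: "p \<in> U"
    then have U: "openin (manifold_topology A) U"
        and vf: "vector_field A U X" "vector_field A U Y" "vector_field A U Z"
      by auto
    obtain c where c: "c \<in> charts_at A p" using ex_chart[OF U p] by blast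
    have t: "curvature A D X Y Z p \<in> tangent_space A p"
      using U vf p unfolding curvature_def
      by (simp add: tangent_space_diff D_tangent D_vector_field vector_field_lie_bracket)
    show "curvature A D X Y Z p = 0"
      using curvature_in_chart[OF U p c vf] * charts_atD[OF c]
      by (intro tangent_space_eqI[OF t tangent_space_zero c]) simp
  qed
qed

end

locale manifold_endo = torsion_free_connection A D
  for A :: "('p, 'e::euclidean_space) chart set" and D +
  fixes J :: "'p \<Rightarrow> ('p, 'e) tvec \<Rightarrow> ('p, 'e) tvec"
  assumes endo: "endo_field A J"
begin

text \<open>The value \<open>0\<close> outside the range of the chart makes \<open>jmat c x\<close> linear for every \<open>x\<close>, so that
  identities between lifts hold on the whole space and not only over the range of the chart.\<close>

definition jmat :: "('p, 'e) chart \<Rightarrow> 'e \<Rightarrow> 'e \<Rightarrow> 'e" where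
  "jmat c x w = (if x \<in> snd c ` fst c then J (chart_inv c x) (coord_field A c w (chart_inv c x)) c else 0)"

lemma J_tangent: "p \<in> points A \<Longrightarrow> v \<in> tangent_space A p \<Longrightarrow> J p v \<in> tangent_space A p"
  using endo by (auto simp: endo_field_def)

lemma points_chart: "c \<in> charts_at A p \<Longrightarrow> p \<in> points A"
  by (auto simp: charts_at_def points_def)

lemma jmat_at: "c \<in> charts_at A p \<Longrightarrow> v \<in> tangent_space A p \<Longrightarrow> jmat c (snd c p) (v c) = J p v c"
  by (simp add: jmat_def coord_field_eq charts_atD)

lemma jmat_linear: "c \<in> A \<Longrightarrow> linear (jmat c x)"
proof (cases "x \<in> snd c ` fst c")
  case False
  then show ?thesis
    by (intro linearI) (simp_all add: jmat_def)
next
  case True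
  assume c: "c \<in> A"
  from True obtain p where p: "p \<in> fst c" "x = snd c p" by auto
  note at = charts_atI[OF c p(1)]
  have lin: "J p (r *\<^sub>R v + s *\<^sub>R w) = r *\<^sub>R J p v + s *\<^sub>R J p w"
    if "v \<in> tangent_space A p" "w \<in> tangent_space A p" for r s v w
    using endo points_chart[OF at] that unfolding endo_field_def linear_on_def by blast
  show ?thesis
  proof (rule linearI)
    fix a b and r :: real
    show "jmat c x (a + b) = jmat c x a + jmat c x b"
      using lin[OF coord_field_tangent[OF at, of a] coord_field_tangent[OF at, of b], of 1 1] c p at
      by (simp add: jmat_def coord_field_add)
    show "jmat c x (r *\<^sub>R a) = r *\<^sub>R jmat c x a"
      using lin[OF coord_field_tangent[OF at, of a] coord_field_tangent[OF at, of a], of r 0] c p at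
      by (simp add: jmat_def coord_field_scale)
  qed
qed

lemma jmat_smooth: "c \<in> A \<Longrightarrow> smooth_on (snd c ` fst c) (\<lambda>x. jmat c x w)"
proof -
  assume c: "c \<in> A"
  show ?thesis
  proof (rule smooth_on_linear_family[where F="jmat c"
      and a="\<lambda>_. w", OF open_chart_range[OF c] jmat_linear[OF c]])
    show "smooth_on (snd c ` fst c) (\<lambda>x. jmat c x i)" if "i \<in> Basis" for i
    proof (rule smooth_on_cong[OF open_chart_range[OF c]])
      show "smooth_on (snd c ` fst c) (\<lambda>x. J (chart_inv c x) (coord_field A c i (chart_inv c x)) c)"
        using endo c that by (simp add: endo_field_def)
    qed (simp add: jmat_def)
  qed (simp_all add: smooth_on_const)
qed

lemma vector_field_endo:
  assumes U: "openin (manifold_topology A) U" and Y: "vector_field A U Y"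
  shows "vector_field A U (\<lambda>q. J q (Y q))"
  unfolding vector_field_iff
proof (intro conjI ballI)
  fix p assume "p \<in> U"
  then show "J p (Y p) \<in> tangent_space A p"
    using ex_chart[OF U] J_tangent points_chart vector_field_tangent[OF Y] by blast
next
  fix c assume c: "c \<in> A"
  let ?S = "snd c ` (U \<inter> fst c)"
  have S: "open ?S" using U c by (rule open_in_chart)
  have "smooth_on ?S (\<lambda>x. jmat c x (in_chart c Y x))"
  proof (rule smooth_on_linear_family[where F="jmat c", OF S])
    show "smooth_on ?S (\<lambda>x. jmat c x i)" for i
      by (rule smooth_on_subset[OF jmat_smooth[OF c]]) auto
  qed (use jmat_linear[OF c] vector_field_smooth[OF Y c] in auto)
  then show "smooth_on ?S (in_chart c (\<lambda>q. J q (Y q)))"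
  proof (rule smooth_on_cong[OF S])
    fix x assume "x \<in> ?S"
    then obtain p where "p \<in> U" "p \<in> fst c" "x = snd c p" by auto
    then show "jmat c x (in_chart c Y x) = in_chart c (\<lambda>q. J q (Y q)) x"
      using jmat_at[OF charts_atI[OF c] vector_field_tangent[OF Y]] c by simp
  qed
qed

lemma cov_deriv_endo_in_chart:
  assumes U: "openin (manifold_topology A) U" "p \<in> U" and c: "c \<in> charts_at A p"
    and X: "vector_field A U X" and Y: "vector_field A U Y"
  shows "cov_deriv_endo D J X Y p c = cov_endo (gam c) (jmat c) (snd c p) (X p c) (Y p c)"
proof -
  note cA = charts_atD(1)[OF c] and cp = charts_atD(2)[OF c]
  let ?W = "snd c ` (U \<inter> fst c)" and ?x = "snd c p" and ?r = "in_chart c"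
  have W: "open ?W" "?x \<in> ?W" "?W \<subseteq> snd c ` fst c"
    using U cA cp by (auto intro: open_in_chart)
  have "fd (?r (\<lambda>q. J q (Y q))) ?x = fd (\<lambda>x. jmat c x (?r Y x)) ?x"
  proof (rule fd_cong[OF W(1,2)])
    fix x assume "x \<in> ?W"
    then obtain p where "p \<in> U" "p \<in> fst c" "x = snd c p" by auto
    then show "in_chart c (\<lambda>q. J q (Y q)) x = jmat c x (in_chart c Y x)"
      using jmat_at[OF charts_atI[OF cA] vector_field_tangent[OF Y]] cA by simp
  qed
  also have "\<dots> = (\<lambda>h. fd (\<lambda>y. jmat c y (?r Y ?x)) ?x h + jmat c ?x (fd (?r Y) ?x h))"
  proof (rule fd_eqI, rule has_derivative_linear_family[where F="jmat c", OF W(1,2)])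
    show "linear (jmat c y)" if "y \<in> ?W" for y
      using jmat_linear[OF cA] W(3) that by blast
    show "(\<lambda>y. jmat c y i) differentiable at ?x" for i
      using smooth_on_differentiable[OF jmat_smooth[OF cA]] W(2,3) by blast
    show "(?r Y has_derivative fd (?r Y) ?x) (at ?x)"
      by (rule has_derivative_fd[OF vector_field_differentiable[OF Y U(2) c]])
  qed
  finally have 1: "D X (\<lambda>q. J q (Y q)) p c = fd (\<lambda>y. jmat c y (Y p c)) ?x (X p c)
      + jmat c ?x (fd (?r Y) ?x (X p c))
      + gam c ?x (X p c) (jmat c ?x (Y p c))"
    using D_in_chart[OF U c X vector_field_endo[OF U(1) Y]]
        jmat_at[OF c vector_field_tangent[OF Y U(2)]] cA cp
    by simp
  have "J p (D X Y p) c = jmat c ?x (fd (?r Y) ?x (X p c) + gam c ?x (X p c) (Y p c))"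
    using jmat_at[OF c D_tangent[OF U(1) X Y U(2)]] D_in_chart[OF U c X Y] cA cp by simp
  also have "\<dots> = jmat c ?x (fd (?r Y) ?x (X p c)) + jmat c ?x (gam c ?x (X p c) (Y p c))"
    using jmat_linear[OF cA] cp by (simp add: linear_add)
  finally show ?thesis
    using 1 by (simp add: cov_deriv_endo_def cov_endo_def algebra_simps)
qed

lemma parallel_iff: "parallel A D J \<longleftrightarrow> (\<forall>c\<in>A. \<forall>x\<in>snd c ` fst c. \<forall>a b. cov_endo (gam c) (jmat c) x a b = 0)"
proof
  assume par: "parallel A D J"
  show "\<forall>c\<in>A. \<forall>x\<in>snd c ` fst c. \<forall>a b. cov_endo (gam c) (jmat c) x a b = 0"
  proof (intro ballI allI)
    fix c x a b assume c: "c \<in> A" and "x \<in> snd c ` fst c"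
    then obtain p where p: "p \<in> fst c" "x = snd c p" by auto
    note at = charts_atI[OF c p(1)] and vf = vector_field_coord[OF c] and U = openin_chart[OF c]
    have "cov_deriv_endo D J (coord_field A c a) (coord_field A c b) p c = 0"
      using par U vf p(1) unfolding parallel_def by (metis zero_fun_apply)
    then show "cov_endo (gam c) (jmat c) x a b = 0"
      using cov_deriv_endo_in_chart[OF U p(1) at vf vf] at p(2) by simp
  qed
next
  assume *: "\<forall>c\<in>A. \<forall>x\<in>snd c ` fst c. \<forall>a b. cov_endo (gam c) (jmat c) x a b = 0"
  show "parallel A D J"
    unfolding parallel_def
  proof (intro allI impI ballI)
    fix U X Y p
    assume "openin (manifold_topology A) U \<and> vector_field A U X \<and> vector_field A U Y" and p: "p \<in> U"
    then have U: "openin (manifold_topology A) U" and vf: "vector_field A U X" "vector_field A U Y"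
      by auto
    obtain c where c: "c \<in> charts_at A p" using ex_chart[OF U p] by blast
    have t: "cov_deriv_endo D J X Y p \<in> tangent_space A p"
      using U vf p unfolding cov_deriv_endo_def
      by (intro tangent_space_diff J_tangent D_tangent[of U] vector_field_endo points_chart[OF c])
    show "cov_deriv_endo D J X Y p = 0"
      using cov_deriv_endo_in_chart[OF U p c vf] * charts_atD[OF c]
      by (intro tangent_space_eqI[OF t tangent_space_zero c]) simp
  qed
qed

end

section \<open>The Nijenhuis tensor of a field of complex structures on an open set\<close>

definition bracket :: "('a::real_normed_vector \<Rightarrow> 'a) \<Rightarrow> ('a \<Rightarrow> 'a) \<Rightarrow> 'a \<Rightarrow> 'a" where
  "bracket X Y x = fd Y x (X x) - fd X x (Y x)"

text \<open>What is left of \<open>N(X, Y)\<close> after all derivatives of \<open>X\<close> and \<open>Y\<close> have cancelled, for vectors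
  \<open>u\<close> and \<open>v\<close> in place of \<open>X x\<close> and \<open>Y x\<close>.\<close>

definition nij :: "('a::real_normed_vector \<Rightarrow> 'a \<Rightarrow> 'a) \<Rightarrow> 'a \<Rightarrow> 'a \<Rightarrow> 'a \<Rightarrow> 'a" where
  "nij K x u v = K x (fd (\<lambda>y. K y v) x u) - K x (fd (\<lambda>y. K y u) x v)
     + fd (\<lambda>y. K y u) x (K x v) - fd (\<lambda>y. K y v) x (K x u)"

lemma bracket_skew: "bracket Y X x = - bracket X Y x"
  by (simp add: bracket_def)

locale complex_field =
  fixes W :: "'a::euclidean_space set" and K :: "'a \<Rightarrow> 'a \<Rightarrow> 'a"
  assumes open_W: "open W" and K_linear: "x \<in> W \<Longrightarrow> linear (K x)"
    and K_square: "x \<in> W \<Longrightarrow> K x (K x v) = - v"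
    and K_differentiable: "x \<in> W \<Longrightarrow> (\<lambda>y. K y v) differentiable (at x)"
begin

lemma has_derivative_K:
  assumes "x \<in> W" "X differentiable (at x)"
  shows "((\<lambda>y. K y (X y)) has_derivative (\<lambda>h. fd (\<lambda>y. K y (X x)) x h + K x (fd X x h))) (at x)"
  using has_derivative_linear_family[where F=K, OF open_W assms(1) K_linear K_differentiable[OF assms(1)]
      has_derivative_fd[OF assms(2)]] .

text \<open>Differentiate \<open>K\<^sup>2 = - 1\<close>.\<close>

lemma K_anticommutes:
  assumes x: "x \<in> W"
  shows "fd (\<lambda>y. K y (K x u)) x h = - K x (fd (\<lambda>y. K y u) x h)"
proof -
  have "fd (\<lambda>y. K y (K y u)) x = fd (\<lambda>y. - u) x"
    by (rule fd_cong[OF open_W x]) (rule K_square)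
  then have "fd (\<lambda>y. K y (K x u)) x h + K x (fd (\<lambda>y. K y u) x h) = 0"
    using fd_eqI[OF has_derivative_K[OF x K_differentiable[OF x]]] by (metis frechet_derivative_const)
  then show ?thesis by (simp add: eq_neg_iff_add_eq_0)
qed

text \<open>This is used in both directions: it shows that the Nijenhuis tensor of vector fields is
  tensorial, and it evaluates \<open>nij\<close> on given vectors by brackets of any fields that extend them.\<close>

lemma nij_eq:
  assumes x: "x \<in> W" and X: "X differentiable (at x)" and Y: "Y differentiable (at x)"
  shows "bracket X Y x + K x (bracket (\<lambda>y. K y (X y)) Y x) + K x (bracket X (\<lambda>y. K y (Y y)) x)
     - bracket (\<lambda>y. K y (X y)) (\<lambda>y. K y (Y y)) x = nij K x (X x) (Y x)"
  using K_linear[OF x]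
  by (simp add: bracket_def nij_def fd_eqI[OF has_derivative_K[OF x X]] fd_eqI[OF has_derivative_K[OF x Y]]
      linear_diff linear_add K_square[OF x])

lemma dK_linear: "x \<in> W \<Longrightarrow> linear (\<lambda>u. fd (\<lambda>y. K y u) x h)"
  by (rule fd_linear[where F=K, OF open_W _ K_linear K_differentiable])

lemma nij_skew: "x \<in> W \<Longrightarrow> nij K x v u = - nij K x u v"
  by (simp add: nij_def)

lemma nij_add_left: "x \<in> W \<Longrightarrow> nij K x (u + u') v = nij K x u v + nij K x u' v"
  by (simp add: nij_def linear_add[OF K_linear] linear_add[OF dK_linear]
      linear_add[OF linear_fd[OF K_differentiable]])

lemma nij_add_right: "x \<in> W \<Longrightarrow> nij K x u (v + v') = nij K x u v + nij K x u v'"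
  using nij_skew nij_add_left by (metis minus_add_distrib)

lemma nij_K_left: "x \<in> W \<Longrightarrow> nij K x (K x u) v = - K x (nij K x u v)"
  by (simp add: nij_def K_anticommutes K_square linear_add[OF K_linear] linear_diff[OF K_linear]
      linear_neg[OF K_linear] linear_neg[OF linear_fd[OF K_differentiable]])

lemma nij_K_right: "x \<in> W \<Longrightarrow> nij K x u (K x v) = - K x (nij K x u v)"
  using nij_skew nij_K_left linear_neg[OF K_linear] by metis

text \<open>If \<open>H\<close> and \<open>K H\<close> together span, the antilinearity of \<open>nij\<close> under \<open>K\<close> reduces everything to
  arguments in \<open>H\<close>. It is applied to the horizontal vectors.\<close>

lemma nij_zero_if_generated:
  assumes x: "x \<in> W" and gen: "\<And>w. \<exists>a b. w = H a + K x (H b)"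
    and zero: "\<And>a b. nij K x (H a) (H b) = 0"
  shows "nij K x u v = 0"
proof -
  obtain a b where u: "u = H a + K x (H b)" using gen by blast
  obtain c d where v: "v = H c + K x (H d)" using gen by blast
  show ?thesis
    unfolding u v
    by (simp add: nij_add_left[OF x] nij_add_right[OF x] nij_K_left[OF x] nij_K_right[OF x] zero
        linear_0[OF K_linear[OF x]])
qed

end

lemma differentiable_fst: "fst differentiable (at z)" and differentiable_snd: "snd differentiable (at z)"
  unfolding differentiable_def
  using has_derivative_fst[OF has_derivative_ident] has_derivative_snd[OF has_derivative_ident] by blast+

lemma differentiable_prod:
  "f differentiable (at x) \<Longrightarrow> g differentiable (at x) \<Longrightarrow> (\<lambda>x. (f x, g x)) differentiable (at x)"
  unfolding differentiable_def by (blast intro: has_derivative_Pair)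

section \<open>Horizontal and vertical lifts over a chart\<close>

context chart_connection
begin

text \<open>Lifts of a vector field \<open>\<alpha>\<close> on the base; \<open>\<alpha>\<close> is allowed to vary because \<open>J\<^sub>2\<close> and \<open>J\<^sub>3\<close> turn
  lifts of constant fields \<open>a\<close> into lifts of the nonconstant fields \<open>J a\<close>.\<close>

definition hl :: "('e \<Rightarrow> 'e) \<Rightarrow> 'e \<times> 'e \<Rightarrow> 'e \<times> 'e" where
  "hl \<alpha> z = (\<alpha> (fst z), - G (fst z) (snd z) (\<alpha> (fst z)))"

definition vl :: "('e \<Rightarrow> 'e) \<Rightarrow> 'e \<times> 'e \<Rightarrow> 'e \<times> 'e" where
  "vl \<alpha> z = (0, \<alpha> (fst z))"

lemma open_VT: "open (V \<times> (UNIV :: 'e set))"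
  by (simp add: open_Times open_V)

lemma differentiable_G:
  fixes z :: "'z::real_normed_vector"
  assumes "\<phi> z \<in> V" "\<phi> differentiable (at z)" "a differentiable (at z)" "b differentiable (at z)"
  shows "(\<lambda>y. G (\<phi> y) (a y) (b y)) differentiable (at z)"
  using has_derivative_bilinear_family[where G=G, OF open_V assms(1) G_linear_left G_linear_right
      G_differentiable[OF assms(1)] has_derivative_fd[OF assms(2)] has_derivative_fd[OF assms(3)]
          has_derivative_fd[OF assms(4)]]
  unfolding differentiable_def by blast

lemma has_derivative_hl:
  assumes x: "x \<in> V" and \<alpha>: "\<alpha> differentiable (at x)"
  shows "(hl \<alpha> has_derivative (\<lambda>h. (fd \<alpha> x (fst h),
     - (fd (\<lambda>x'. G x' y (\<alpha> x)) x (fst h) + G x (snd h) (\<alpha> x) + G x y (fd \<alpha> x (fst h)))))) (at (x, y))"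
proof -
  have *: "((\<lambda>z. \<alpha> (fst z)) has_derivative (\<lambda>h. fd \<alpha> x (fst h))) (at (x, y))"
    using has_derivative_compose[OF has_derivative_fst[OF has_derivative_ident], of \<alpha> _ "(x, y)"]
        has_derivative_fd[OF \<alpha>]
    by simp
  have "((\<lambda>z. G (fst z) (snd z) (\<alpha> (fst z))) has_derivative
     (\<lambda>h. fd (\<lambda>x'. G x' (snd (x, y)) (\<alpha> (fst (x, y)))) (fst (x, y)) (fst h) + G (fst (x, y)) (snd h)
         (\<alpha> (fst (x, y)))
      + G (fst (x, y)) (snd (x, y)) (fd \<alpha> x (fst h)))) (at (x, y))"
    using x by (intro has_derivative_bilinear_family[where G=G and \<phi>=fst, OF open_V] G_linear_left
        G_linear_right
        G_differentiable has_derivative_fst has_derivative_snd has_derivative_ident *) auto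
  then show ?thesis
    unfolding hl_def[abs_def] by (intro has_derivative_Pair * has_derivative_minus) simp
qed

lemma has_derivative_vl:
  assumes \<alpha>: "\<alpha> differentiable (at x)"
  shows "(vl \<alpha> has_derivative (\<lambda>h. (0, fd \<alpha> x (fst h)))) (at (x, y))"
proof -
  have *: "((\<lambda>z. \<alpha> (fst z)) has_derivative (\<lambda>h. fd \<alpha> x (fst h))) (at (x, y))"
    using has_derivative_compose[OF has_derivative_fst[OF has_derivative_ident], of \<alpha> _ "(x, y)"]
        has_derivative_fd[OF \<alpha>]
    by simp
  then show ?thesis
    unfolding vl_def[abs_def] by (intro has_derivative_Pair has_derivative_const)
qed

lemma differentiable_hl: "x \<in> V \<Longrightarrow> \<alpha> differentiable (at x) \<Longrightarrow> hl \<alpha> differentiable (at (x, y))"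
  using has_derivative_hl unfolding differentiable_def by blast

lemma dG_sym: "x \<in> V \<Longrightarrow> fd (\<lambda>x'. G x' a b) x = fd (\<lambda>x'. G x' b a) x"
  by (rule fd_cong[OF open_V]) (auto intro: G_sym)

text \<open>The curvature measures the failure of horizontal lifting to respect brackets.\<close>

lemma bracket_hl_hl:
  assumes x: "x \<in> V" and \<alpha>: "\<alpha> differentiable (at x)" and \<beta>: "\<beta> differentiable (at x)"
  shows "bracket (hl \<alpha>) (hl \<beta>) (x, y)
    = hl (\<lambda>_. fd \<beta> x (\<alpha> x) - fd \<alpha> x (\<beta> x)) (x, y) - vl (\<lambda>_. curv G x (\<alpha> x) (\<beta> x) y) (x, y)"
  using G_sym[OF x, of y] G_sym[OF x, of "G x y (\<alpha> x)"] G_sym[OF x, of "G x y (\<beta> x)"]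
  unfolding bracket_def fd_eqI[OF has_derivative_hl[OF x \<alpha>]] fd_eqI[OF has_derivative_hl[OF x \<beta>]]
  by (simp add: hl_def vl_def curv_def dG_sym[OF x, of y] G_minus_left G_diff_right)

lemma bracket_hl_vl:
  assumes x: "x \<in> V" and \<alpha>: "\<alpha> differentiable (at x)" and \<beta>: "\<beta> differentiable (at x)"
  shows "bracket (hl \<alpha>) (vl \<beta>) (x, y) = vl (\<lambda>_. fd \<beta> x (\<alpha> x) + G x (\<alpha> x) (\<beta> x)) (x, y)"
  using G_sym[OF x, of "\<beta> x"] linear_0[OF linear_fd[OF \<alpha>]] linear_0[OF linear_fd[OF G_differentiable[OF x]]]
  unfolding bracket_def fd_eqI[OF has_derivative_hl[OF x \<alpha>]] fd_eqI[OF has_derivative_vl[OF \<beta>]]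
  by (simp add: hl_def vl_def linear_0[OF G_linear_right])

lemma bracket_vl_hl:
  assumes "x \<in> V" "\<alpha> differentiable (at x)" "\<beta> differentiable (at x)"
  shows "bracket (vl \<beta>) (hl \<alpha>) (x, y) = - vl (\<lambda>_. fd \<beta> x (\<alpha> x) + G x (\<alpha> x) (\<beta> x)) (x, y)"
  using bracket_hl_vl[OF assms] bracket_skew by metis

lemma bracket_vl_vl:
  assumes \<alpha>: "\<alpha> differentiable (at x)" and \<beta>: "\<beta> differentiable (at x)"
  shows "bracket (vl \<alpha>) (vl \<beta>) (x, y) = 0"
  using linear_0[OF linear_fd[OF \<alpha>]] linear_0[OF linear_fd[OF \<beta>]]
  unfolding bracket_def fd_eqI[OF has_derivative_vl[OF \<alpha>]] fd_eqI[OF has_derivative_vl[OF \<beta>]]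
  by (simp add: vl_def zero_prod_def)

lemma dG_linear: "x \<in> V \<Longrightarrow> linear (\<lambda>a. fd (\<lambda>y. G y a v) x h)"
  by (rule fd_linear[where F="\<lambda>y a. G y a v", OF open_V _ G_linear_left G_differentiable])

lemma curv_minus_left:
  assumes x: "x \<in> V" shows "curv G x (- a) b v = - curv G x a b v"
  unfolding curv_def linear_neg[OF dG_linear[OF x]] linear_neg[OF linear_fd[OF G_differentiable[OF x]]]
  by (simp add: G_minus_left G_minus_right)

lemma curv_skew: "curv G x b a v = - curv G x a b v"
  by (simp add: curv_def)

lemma curv_minus_right: "x \<in> V \<Longrightarrow> curv G x a (- b) v = - curv G x a b v"
  using curv_minus_left[of x b a v] by (simp add: curv_skew[of x a])

text \<open>The splitting of the tangent space of the bundle at \<open>z\<close>: \<open>hvec z a b\<close> is the vector with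
  horizontal part \<open>a\<close> and vertical part \<open>b\<close>, that is \<open>H\<^sub>a + V\<^sub>b\<close>; conversely \<open>w\<close> has horizontal
  part \<open>fst w\<close> and vertical part \<open>vert z w\<close>.\<close>

definition vert :: "'e \<times> 'e \<Rightarrow> 'e \<times> 'e \<Rightarrow> 'e" where
  "vert z w = snd w + G (fst z) (snd z) (fst w)"

definition hvec :: "'e \<times> 'e \<Rightarrow> 'e \<Rightarrow> 'e \<Rightarrow> 'e \<times> 'e" where
  "hvec z a b = (a, b - G (fst z) (snd z) a)"

lemma hl_hvec: "hl \<alpha> z = hvec z (\<alpha> (fst z)) 0" and vl_hvec: "vl \<alpha> z = hvec z 0 (\<alpha> (fst z))"
  by (simp_all add: hl_def vl_def hvec_def linear_0[OF G_linear_right])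

lemma fst_hvec [simp]: "fst (hvec z a b) = a" and vert_hvec [simp]: "vert z (hvec z a b) = b"
  by (simp_all add: hvec_def vert_def)

lemma hvec_collapse: "hvec z (fst w) (vert z w) = w"
  by (simp add: hvec_def vert_def)

lemma hvec_add: "hvec z a b + hvec z a' b' = hvec z (a + a') (b + b')"
  by (simp add: hvec_def G_add_right)

lemma hvec_diff: "hvec z a b - hvec z a' b' = hvec z (a - a') (b - b')"
  by (simp add: hvec_def G_diff_right)

lemma hvec_minus: "- hvec z a b = hvec z (- a) (- b)"
  by (simp add: hvec_def G_minus_right)

lemma hvec_scale: "r *\<^sub>R hvec z a b = hvec z (r *\<^sub>R a) (r *\<^sub>R b)"
  by (simp add: hvec_def G_scale_right scaleR_diff_right)

lemma hvec_zero_iff: "hvec z a b = 0 \<longleftrightarrow> a = 0 \<and> b = 0"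
  by (auto simp: hvec_def zero_prod_def linear_0[OF G_linear_right])

lemma vert_linear: "linear (vert z)"
  by (rule linearI) (simp_all add: vert_def G_add_right G_scale_right algebra_simps)

lemma differentiable_vert:
  assumes "fst z \<in> V" shows "(\<lambda>z. vert z w) differentiable (at z)"
  unfolding vert_def
  using assms by (intro differentiable_add differentiable_G)
      (auto intro: differentiable_fst differentiable_snd)

lemma differentiable_hvec:
  assumes "fst z \<in> V" "a differentiable (at z)" "b differentiable (at z)"
  shows "(\<lambda>z. hvec z (a z) (b z)) differentiable (at z)"
  unfolding hvec_def
  using assms by (intro differentiable_prod differentiable_diff differentiable_G)
    (auto intro: differentiable_fst differentiable_snd)

text \<open>The structure \<open>J\<^sub>1\<close>, sending \<open>H\<^sub>a + V\<^sub>b\<close> to \<open>H\<^bsub>-b\<^esub> + V\<^sub>a\<close>.\<close>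

definition k1 :: "'e \<times> 'e \<Rightarrow> 'e \<times> 'e \<Rightarrow> 'e \<times> 'e" where
  "k1 z w = hvec z (- vert z w) (fst w)"

lemma complex_field_k1: "complex_field (V \<times> UNIV) k1"
proof (rule complex_field.intro[OF open_VT])
  fix z w :: "'e \<times> 'e" assume z: "z \<in> V \<times> UNIV"
  show "linear (k1 z)"
    by (rule linearI) (simp_all add: k1_def hvec_add hvec_scale linear_add[OF vert_linear]
        linear_scale[OF vert_linear])
  show "k1 z (k1 z w) = - w"
    by (simp add: k1_def hvec_minus[symmetric] hvec_collapse)
  show "(\<lambda>z. k1 z w) differentiable (at z)"
    unfolding k1_def using z by (intro differentiable_hvec differentiable_minus differentiable_vert) auto
qed

text \<open>\<open>J\<^sub>1\<close> maps lifts of constant fields to lifts of constant fields, so \<open>N\<^sub>1(H\<^sub>a, H\<^sub>b)\<close> follows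
  from the brackets of such lifts; the two mixed brackets cancel because the connection is torsion
  free. Every vector has the form \<open>H\<^sub>a + J\<^sub>1 H\<^sub>b\<close>.\<close>

theorem nij_k1_zero_iff:
  assumes x: "x \<in> V"
  shows "(\<forall>u v. nij k1 (x, y) u v = 0) \<longleftrightarrow> (\<forall>a b. curv G x a b y = 0)"
proof -
  interpret K: complex_field "V \<times> UNIV" k1 by (rule complex_field_k1)
  have z: "(x, y) \<in> V \<times> UNIV" using x by simp
  let ?z = "(x, y)"
  have "nij k1 ?z (hvec ?z a 0) (hvec ?z b 0) = hvec ?z 0 (- curv G x a b y)" for a b
  proof -
    have K: "(\<lambda>y. k1 y (hl (\<lambda>_. a) y)) = vl (\<lambda>_. a)" for a
      by (rule ext) (simp add: hl_hvec vl_hvec k1_def)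
    have "nij k1 ?z (hl (\<lambda>_. a) ?z) (hl (\<lambda>_. b) ?z) = hvec ?z 0 (- curv G x a b y)"
      unfolding K.nij_eq[OF z differentiable_hl[OF x differentiable_const]
          differentiable_hl[OF x differentiable_const], symmetric]
        K bracket_hl_hl[OF x differentiable_const differentiable_const]
        bracket_hl_vl[OF x differentiable_const differentiable_const]
        bracket_vl_hl[OF x differentiable_const differentiable_const]
            bracket_vl_vl[OF differentiable_const differentiable_const]
      by (simp add: hl_hvec vl_hvec k1_def hvec_minus hvec_diff hvec_add G_sym[OF x, of a b])
    then show ?thesis by (simp add: hl_hvec)
  qed
  note N = this
  show ?thesis
  proof
    assume "\<forall>u v. nij k1 ?z u v = 0"
    then have "hvec ?z 0 (- curv G x a b y) = 0" for a b
      using N by metis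
    then show "\<forall>a b. curv G x a b y = 0"
      by (simp add: hvec_zero_iff)
  next
    assume "\<forall>a b. curv G x a b y = 0"
    then have "nij k1 ?z (hvec ?z a 0) (hvec ?z b 0) = 0" for a b
      using N by (simp add: hvec_zero_iff)
    moreover have "\<exists>a b. w = hvec ?z a 0 + k1 ?z (hvec ?z b 0)" for w
      by (metis (no_types, lifting) add.left_neutral add.right_neutral fst_hvec hvec_add
          hvec_collapse k1_def neg_0_equal_iff_equal vert_hvec)
    ultimately show "\<forall>u v. nij k1 ?z u v = 0"
      using K.nij_zero_if_generated[OF z, of "\<lambda>a. hvec ?z a 0"] by metis
  qed
qed

end

locale chart_complex = chart_connection V G
  for V :: "'e::euclidean_space set" and G +
  fixes J :: "'e \<Rightarrow> 'e \<Rightarrow> 'e"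
  assumes J_linear: "linear (J x)"
    and J_smooth: "smooth_on V (\<lambda>x. J x a)"
    and J_square: "x \<in> V \<Longrightarrow> J x (J x a) = - a"
begin

lemma J_differentiable: "x \<in> V \<Longrightarrow> (\<lambda>y. J y a) differentiable (at x)"
  by (rule smooth_on_differentiable[OF J_smooth])

sublocale J: complex_field V J
  by (rule complex_field.intro[OF open_V J_linear J_square J_differentiable])

abbreviation S :: "'e \<Rightarrow> 'e \<Rightarrow> 'e \<Rightarrow> 'e" where "S \<equiv> cov_endo G J"

text \<open>Differentiate \<open>J\<^sup>2 = - 1\<close> covariantly.\<close>

lemma S_J: "x \<in> V \<Longrightarrow> S x a (J x b) = - J x (S x a b)"
  by (simp add: cov_endo_def J.K_anticommutes J_square linear_add[OF J_linear]
      linear_diff[OF J_linear] G_minus_right)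

text \<open>The structures \<open>J\<^sub>2\<close> and \<open>J\<^sub>3\<close>, sending \<open>H\<^sub>a + V\<^sub>b\<close> to \<open>H\<^bsub>Jb\<^esub> + V\<^bsub>Ja\<^esub>\<close> and to
  \<open>H\<^bsub>-Ja\<^esub> + V\<^bsub>Jb\<^esub>\<close>.\<close>

definition k2 :: "'e \<times> 'e \<Rightarrow> 'e \<times> 'e \<Rightarrow> 'e \<times> 'e" where
  "k2 z w = hvec z (J (fst z) (vert z w)) (J (fst z) (fst w))"

definition k3 :: "'e \<times> 'e \<Rightarrow> 'e \<times> 'e \<Rightarrow> 'e \<times> 'e" where
  "k3 z w = hvec z (- J (fst z) (fst w)) (J (fst z) (vert z w))"

lemma k3_eq: "k3 z w = k1 z (k2 z w)"
  by (simp add: k1_def k2_def k3_def)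

lemma differentiable_J:
  fixes z :: "'e \<times> 'e"
  assumes "fst z \<in> V" "a differentiable (at z)"
  shows "(\<lambda>y. J (fst y) (a y)) differentiable (at z)"
  using has_derivative_linear_family_compose[where F=J
      and \<phi>=fst, OF open_V assms(1) J_linear J_differentiable[OF assms(1)]
      has_derivative_fst[OF has_derivative_ident] has_derivative_fd[OF assms(2)]]
  unfolding differentiable_def by blast

lemma complex_field_k2: "complex_field (V \<times> UNIV) k2"
proof (rule complex_field.intro[OF open_VT])
  fix z w :: "'e \<times> 'e" assume z: "z \<in> V \<times> UNIV"
  then have x: "fst z \<in> V" by auto
  show "linear (k2 z)"
    by (rule linearI) (simp_all add: k2_def hvec_add hvec_scale linear_add[OF vert_linear]
        linear_scale[OF vert_linear]
        linear_add[OF J_linear] linear_scale[OF J_linear])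
  show "k2 z (k2 z w) = - w"
    by (simp add: k2_def J_square[OF x] hvec_minus[symmetric] hvec_collapse)
  show "(\<lambda>z. k2 z w) differentiable (at z)"
    unfolding k2_def using x by (intro differentiable_hvec differentiable_J differentiable_vert) auto
qed

lemma complex_field_k3: "complex_field (V \<times> UNIV) k3"
proof (rule complex_field.intro[OF open_VT])
  fix z w :: "'e \<times> 'e" assume z: "z \<in> V \<times> UNIV"
  then have x: "fst z \<in> V" by auto
  show "linear (k3 z)"
    by (rule linearI) (simp_all add: k3_def hvec_add hvec_scale linear_add[OF vert_linear]
        linear_scale[OF vert_linear]
        linear_add[OF J_linear] linear_scale[OF J_linear])
  show "k3 z (k3 z w) = - w"
    by (simp add: k3_def J_square[OF x] linear_neg[OF J_linear] hvec_minus[symmetric] hvec_collapse)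
  show "(\<lambda>z. k3 z w) differentiable (at z)"
    unfolding k3_def using x by (intro differentiable_hvec differentiable_minus differentiable_J
        differentiable_vert) auto
qed

text \<open>As for \<open>J\<^sub>1\<close>, every vector has the form \<open>H\<^sub>a + J\<^sub>2 H\<^sub>b\<close>. The derivative of \<open>J\<close> in the mixed
  brackets combines with the Christoffel terms to the covariant derivative \<open>S\<close>.\<close>

theorem nij_k2_zero_iff:
  assumes x: "x \<in> V"
  shows "(\<forall>u v. nij k2 (x, y) u v = 0) \<longleftrightarrow> (\<forall>a b. curv G x a b y = 0 \<and> S x a b = S x b a)"
proof -
  interpret K: complex_field "V \<times> UNIV" k2 by (rule complex_field_k2)
  have z: "(x, y) \<in> V \<times> UNIV" using x by simp
  let ?z = "(x, y)"
  have "nij k2 ?z (hvec ?z a 0) (hvec ?z b 0)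
      = hvec ?z (J x (S x a b - S x b a)) (- curv G x a b y)" for a b
  proof -
    have K: "(\<lambda>y. k2 y (hl (\<lambda>_. a) y)) = vl (\<lambda>x. J x a)" for a
    proof
      fix z
      show "k2 z (hl (\<lambda>_. a) z) = vl (\<lambda>x. J x a) z"
        by (simp add: hl_hvec vl_hvec k2_def linear_0[OF J_linear])
    qed
    have "nij k2 ?z (hl (\<lambda>_. a) ?z) (hl (\<lambda>_. b) ?z) = hvec ?z (J x (S x a b - S x b a)) (- curv G x a b y)"
      unfolding K.nij_eq[OF z differentiable_hl[OF x differentiable_const]
          differentiable_hl[OF x differentiable_const], symmetric]
        K bracket_hl_hl[OF x differentiable_const differentiable_const]
        bracket_hl_vl[OF x differentiable_const J_differentiable[OF x]]
        bracket_vl_hl[OF x differentiable_const J_differentiable[OF x]]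
            bracket_vl_vl[OF J_differentiable[OF x] J_differentiable[OF x]]
      using G_sym[OF x, of a b]
      by (simp add: hl_hvec vl_hvec k2_def hvec_minus hvec_diff hvec_add cov_endo_def
         linear_diff[OF J_linear] linear_add[OF J_linear] linear_neg[OF J_linear] linear_0[OF J_linear];
        simp add: algebra_simps)
    then show ?thesis by (simp add: hl_hvec)
  qed
  note N = this
  have J0: "J x v = 0 \<longleftrightarrow> v = 0" for v
    using J_square[OF x] linear_0[OF J_linear] by (metis neg_equal_0_iff_equal)
  show ?thesis
  proof
    assume "\<forall>u v. nij k2 ?z u v = 0"
    then have "hvec ?z (J x (S x a b - S x b a)) (- curv G x a b y) = 0" for a b
      using N by metis
    then show "\<forall>a b. curv G x a b y = 0 \<and> S x a b = S x b a"
      by (simp add: hvec_zero_iff J0)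
  next
    assume "\<forall>a b. curv G x a b y = 0 \<and> S x a b = S x b a"
    then have "nij k2 ?z (hvec ?z a 0) (hvec ?z b 0) = 0" for a b
      using N[of a b] by (simp add: hvec_zero_iff J0)
    moreover have "\<exists>a b. w = hvec ?z a 0 + k2 ?z (hvec ?z b 0)" for w
    proof (intro exI)
      show "w = hvec ?z (fst w) 0 + k2 ?z (hvec ?z (- J x (vert ?z w)) 0)"
        by (simp add: k2_def hvec_add hvec_collapse linear_neg[OF J_linear] linear_0[OF J_linear]
            J_square[OF x])
    qed
    ultimately show "\<forall>u v. nij k2 ?z u v = 0"
      using K.nij_zero_if_generated[OF z, of "\<lambda>a. hvec ?z a 0"] by metis
  qed
qed

lemma fd_minus_J: "x \<in> V \<Longrightarrow> fd (\<lambda>x. - J x a) x v = - fd (\<lambda>x. J x a) x v"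
  by (subst fd_eqI[OF has_derivative_minus[OF has_derivative_fd[OF J_differentiable]]]) auto

text \<open>\<open>J\<^sub>3\<close> preserves the horizontal and the vertical subspace, so here the mixed and the vertical
  values have to be computed separately.\<close>

lemma nij_k3:
  assumes x: "x \<in> V" and z_def: "z = (x, y)"
  shows "nij k3 z (hvec z a 0) (hvec z 0 b) = hvec z 0 (J x (S x a b) + S x (J x a) b)"
    and "nij k3 z (hvec z a 0) (hvec z b 0) = hvec z
      (J x (S x a b - S x b a) - S x (J x a) b + S x (J x b) a)
      (curv G x (J x a) (J x b) y - curv G x a b y + J x (curv G x (J x a) b y)
          + J x (curv G x a (J x b) y))"
    and "nij k3 z (hvec z 0 a) (hvec z 0 b) = 0"
proof -
  interpret K: complex_field "V \<times> UNIV" k3 by (rule complex_field_k3)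
  have z: "z \<in> V \<times> UNIV" "fst z = x" "snd z = y" using x by (simp_all add: z_def)
  have KH: "(\<lambda>y. k3 y (hl (\<lambda>_. a) y)) = hl (\<lambda>x. - J x a)" for a
  proof
    fix z show "k3 z (hl (\<lambda>_. a) z) = hl (\<lambda>x. - J x a) z"
      by (simp add: hl_hvec k3_def linear_0[OF J_linear])
  qed
  have KV: "(\<lambda>y. k3 y (vl (\<lambda>_. a) y)) = vl (\<lambda>x. J x a)" for a
  proof
    fix z show "k3 z (vl (\<lambda>_. a) z) = vl (\<lambda>x. J x a) z"
      by (simp add: vl_hvec k3_def linear_0[OF J_linear])
  qed
  note lin = linear_diff[OF J_linear] linear_add[OF J_linear] linear_neg[OF J_linear]
    linear_0[OF J_linear] linear_neg[OF linear_fd[OF J_differentiable[OF x]]]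
  have Jd: "(\<lambda>x. J x a) differentiable (at x)" "(\<lambda>x. - J x a) differentiable (at x)" for a
    using J_differentiable[OF x] by (auto intro: differentiable_minus)
  note c = differentiable_const
  have H: "hl (\<lambda>_. a) differentiable at z" and V: "vl (\<lambda>_. a) differentiable at z" for a
    unfolding z_def using differentiable_hl[OF x c] has_derivative_vl[OF c, THEN differentiableI] by blast+
  note simps = hl_hvec vl_hvec k3_def hvec_minus hvec_diff hvec_add cov_endo_def lin fd_minus_J[OF x]
    G_minus_left G_minus_right curv_minus_left[OF x] curv_minus_right[OF x] J_square[OF x] z(2,3)
  have "nij k3 z (hl (\<lambda>_. a) z) (vl (\<lambda>_. b) z) = hvec z 0 (J x (S x a b) + S x (J x a) b)"
    unfolding K.nij_eq[OF z(1) H V, symmetric]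
    unfolding KH KV z_def bracket_hl_vl[OF x c c] bracket_hl_vl[OF x c Jd(1)]
      bracket_hl_vl[OF x Jd(2) c] bracket_hl_vl[OF x Jd(2) Jd(1)]
    unfolding z_def[symmetric] by (simp add: simps; simp add: algebra_simps)
  then show "nij k3 z (hvec z a 0) (hvec z 0 b) = hvec z 0 (J x (S x a b) + S x (J x a) b)"
    by (simp add: hl_hvec vl_hvec)
  have "nij k3 z (hl (\<lambda>_. a) z) (hl (\<lambda>_. b) z) = hvec z
      (J x (S x a b - S x b a) - S x (J x a) b + S x (J x b) a)
      (curv G x (J x a) (J x b) y - curv G x a b y + J x (curv G x (J x a) b y)
          + J x (curv G x a (J x b) y))"
    unfolding K.nij_eq[OF z(1) H H, symmetric]
    unfolding KH KV z_def bracket_hl_hl[OF x c c] bracket_hl_hl[OF x c Jd(2)]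
      bracket_hl_hl[OF x Jd(2) c] bracket_hl_hl[OF x Jd(2) Jd(2)]
    unfolding z_def[symmetric]
    using G_sym[OF x, of a b] G_sym[OF x, of "J x a" b] G_sym[OF x, of "J x b" a]
        G_sym[OF x, of "J x a" "J x b"]
    by (simp add: simps; simp add: algebra_simps)
  then show "nij k3 z (hvec z a 0) (hvec z b 0) = hvec z
      (J x (S x a b - S x b a) - S x (J x a) b + S x (J x b) a)
      (curv G x (J x a) (J x b) y - curv G x a b y + J x (curv G x (J x a) b y)
          + J x (curv G x a (J x b) y))"
    by (simp add: hl_hvec)
  have "nij k3 z (vl (\<lambda>_. a) z) (vl (\<lambda>_. b) z) = 0"
    unfolding K.nij_eq[OF z(1) V V, symmetric]
    unfolding KH KV z_def bracket_vl_vl[OF c c] bracket_vl_vl[OF c Jd(1)]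
      bracket_vl_vl[OF Jd(1) c] bracket_vl_vl[OF Jd(1) Jd(1)]
    unfolding z_def[symmetric] by (simp add: linear_0[OF K.K_linear[OF z(1)]])
  then show "nij k3 z (hvec z 0 a) (hvec z 0 b) = 0"
    by (simp add: vl_hvec)
qed

theorem nij_k3_zero_iff:
  assumes x: "x \<in> V"
  shows "(\<forall>u v. nij k3 (x, y) u v = 0) \<longleftrightarrow> (\<forall>a b. J x (S x a b) + S x (J x a) b = 0 \<and>
    J x (S x a b - S x b a) - S x (J x a) b + S x (J x b) a = 0 \<and>
    curv G x (J x a) (J x b) y - curv G x a b y + J x (curv G x (J x a) b y)
        + J x (curv G x a (J x b) y) = 0)"
    (is "?L \<longleftrightarrow> ?R")
proof -
  interpret K: complex_field "V \<times> UNIV" k3 by (rule complex_field_k3)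
  let ?z = "(x, y)"
  have z: "?z \<in> V \<times> UNIV" using x by simp
  note N = nij_k3[OF x refl, of y]
  show ?thesis
  proof
    assume ?L
    then have "hvec ?z 0 (J x (S x a b) + S x (J x a) b) = 0"
      "hvec ?z (J x (S x a b - S x b a) - S x (J x a) b + S x (J x b) a)
        (curv G x (J x a) (J x b) y - curv G x a b y + J x (curv G x (J x a) b y)
            + J x (curv G x a (J x b) y)) = 0"
      for a b
      using N(1,2)[of a b] by metis+
    then show ?R
      by (simp add: hvec_zero_iff)
  next
    assume ?R
    then have hv: "nij k3 ?z (hvec ?z a 0) (hvec ?z 0 b) = 0"
        and hh: "nij k3 ?z (hvec ?z a 0) (hvec ?z b 0) = 0" for a b
      using N(1,2) by (auto simp: hvec_zero_iff)
    have vh: "nij k3 ?z (hvec ?z 0 a) (hvec ?z b 0) = 0" for a b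
      using K.nij_skew[OF z, of "hvec ?z 0 a"] hv by simp
    show ?L
    proof (intro allI)
      fix u v
      have "nij k3 ?z (hvec ?z a 0 + hvec ?z 0 b) (hvec ?z c 0 + hvec ?z 0 d) = 0" for a b c d
        by (simp add: K.nij_add_left[OF z] K.nij_add_right[OF z] hv hh vh N(3))
      from this[of "fst u" "vert ?z u" "fst v" "vert ?z v"] show "nij k3 ?z u v = 0"
        by (simp only: hvec_add add_0 add_0_right hvec_collapse)
    qed
  qed
qed

end

section \<open>Parallel self-adjoint complex structures and their curvature\<close>

text \<open>The classical combination of the four Bianchi identities, each of which permutes three of
  the arguments cyclically and keeps the fourth one last.\<close>

lemma pair_symmetry:
  fixes T :: "'v \<Rightarrow> 'v \<Rightarrow> 'v \<Rightarrow> 'v \<Rightarrow> real"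
  assumes "\<And>a b c d. T b a c d = - T a b c d" "\<And>a b c d. T a b d c = - T a b c d"
    and "\<And>a b c d. T a b c d + T b c a d + T c a b d = 0"
  shows "T a b c d = T c d a b"
proof -
  note skew_left = assms(1) and skew_right = assms(2) and bianchi = assms(3)
  have "T b c d a = - T b c a d" "T c d b a = - T c d a b" "T d b c a = - T b d c a"
    "T d a c b = - T a d c b" "T a d c b = - T a d b c" "T a c d b = - T c a d b" "T c a d b = - T c a b d"
    "T d a b c = - T a d b c" "T a b d c = - T a b c d" "T b d a c = - T b d c a"
    by (rule skew_left skew_right)+
  then show ?thesis
    using bianchi[of a b c d] bianchi[of b c d a] bianchi[of c d a b] bianchi[of d a b c] by linarith
qed

text \<open>By pair symmetry \<open>J\<close> can also be moved between \<open>a\<close> and \<open>b\<close>. Let \<open>P(a, b, c)\<close> and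
  \<open>Q(a, b, c)\<close> be \<open>T\<close> with \<open>J\<close> inserted into the first and into the second pair, respectively. The
  Bianchi identity for \<open>J a\<close>, \<open>b\<close>, \<open>c\<close> reads \<open>P(a, b, c) + Q(b, c, a) + P(c, a, b) = 0\<close>. The
  cyclic sum of \<open>Q\<close> vanishes, hence so does that of \<open>P\<close>, and comparison gives \<open>P = Q\<close>.\<close>

lemma curvature_pure:
  fixes T :: "'v \<Rightarrow> 'v \<Rightarrow> 'v \<Rightarrow> 'v \<Rightarrow> real"
  assumes skew: "\<And>a b c d. T b a c d = - T a b c d" "\<And>a b c d. T a b d c = - T a b c d"
    and bianchi: "\<And>a b c d. T a b c d + T b c a d + T c a b d = 0"
    and J: "\<And>a b c d. T a b (J c) d = T a b c (J d)"
  shows "T (J a) b c d = T a b (J c) d"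
proof -
  have J': "T (J a) b c d = T a (J b) c d" for a b c d
    using pair_symmetry[of T, OF skew bianchi] J by metis
  have 1: "T (J a) b c d + T b c a (J d) + T (J c) a b d = 0" for a b c
    using bianchi[of "J a" b c d] by (simp add: J J')
  show ?thesis
    using 1[of a b c] 1[of b c a] 1[of c a b] bianchi[of a b c "J d"] by (simp add: J)
qed

locale chart_skew_hermitian = chart_complex V G J
  for V :: "'e::euclidean_space set" and G J +
  fixes M :: "'e \<Rightarrow> 'e \<Rightarrow> 'e \<Rightarrow> real"
  assumes M_linear_left: "x \<in> V \<Longrightarrow> linear (\<lambda>a. M x a b)"
    and M_sym: "x \<in> V \<Longrightarrow> M x a b = M x b a"
    and M_smooth: "smooth_on V (\<lambda>x. M x a b)"
    and M_nondegenerate: "x \<in> V \<Longrightarrow> (\<And>b. M x a b = 0) \<Longrightarrow> a = 0"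
    and M_skew_hermitian: "x \<in> V \<Longrightarrow> M x (J x a) (J x b) = - M x a b"
    and M_compatible: "x \<in> V \<Longrightarrow> fd (\<lambda>y. M y b c) x a = M x (G x a b) c + M x b (G x a c)"
begin

lemma M_linear_right: "x \<in> V \<Longrightarrow> linear (M x a)"
proof -
  assume x: "x \<in> V"
  have "M x a = (\<lambda>b. M x b a)"
    by (rule ext) (rule M_sym[OF x])
  then show ?thesis
    using M_linear_left[OF x, of a] by simp
qed

lemma M_differentiable: "x \<in> V \<Longrightarrow> (\<lambda>y. M y a b) differentiable (at x)"
  by (rule smooth_on_differentiable[OF M_smooth])

lemmas M_simps = linear_add[OF M_linear_left] linear_diff[OF M_linear_left] linear_neg[OF M_linear_left]
  linear_add[OF M_linear_right] linear_diff[OF M_linear_right] linear_neg[OF M_linear_right]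

lemma M_eqI: "x \<in> V \<Longrightarrow> (\<And>c. M x a c = M x b c) \<Longrightarrow> a = b"
  using M_nondegenerate[of x "a - b"] by (simp add: M_simps)

lemma J_self_adjoint: "x \<in> V \<Longrightarrow> M x (J x a) b = M x a (J x b)"
  using M_skew_hermitian[of x a "J x b"] by (simp add: J_square M_simps)

lemma differentiable_M:
  assumes x: "x \<in> V" and a: "a differentiable (at x)" and b: "b differentiable (at x)"
  shows "(\<lambda>y. M y (a y) (b y)) differentiable (at x)"
  using has_derivative_bilinear_family[where G=M and \<phi>="\<lambda>y. y", OF open_V x M_linear_left M_linear_right
      M_differentiable[OF x] has_derivative_ident has_derivative_fd[OF a] has_derivative_fd[OF b]]
  by (auto simp: differentiable_def)

text \<open>The product rule in which compatibility has replaced derivatives of the metric by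
  Christoffel terms.\<close>

lemma fd_M:
  assumes x: "x \<in> V" and a: "a differentiable (at x)" and b: "b differentiable (at x)"
  shows "fd (\<lambda>y. M y (a y) (b y)) x h = M x (G x h (a x) + fd a x h) (b x)
      + M x (a x) (G x h (b x) + fd b x h)"
  using has_derivative_bilinear_family[where G=M and \<phi>="\<lambda>y. y", OF open_V x M_linear_left M_linear_right
      M_differentiable[OF x] has_derivative_ident has_derivative_fd[OF a] has_derivative_fd[OF b]]
  by (simp add: fd_eqI M_compatible[OF x] M_simps[OF x])

text \<open>Differentiate the self-adjointness of \<open>J\<close>, using that the metric is parallel.\<close>

lemma S_self_adjoint:
  assumes x: "x \<in> V"
  shows "M x (S x a b) c = M x b (S x a c)"
proof -
  have "fd (\<lambda>y. M y (J y b) c) x a = fd (\<lambda>y. M y b (J y c)) x a"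
    by (rule fun_cong[OF fd_cong[OF open_V x]]) (rule J_self_adjoint)
  then show ?thesis
    by (simp add: fd_M[OF x J_differentiable[OF x] differentiable_const]
        fd_M[OF x differentiable_const J_differentiable[OF x]]
       cov_endo_def M_simps[OF x] J_self_adjoint[OF x] algebra_simps)
qed

text \<open>The form \<open>F(a, b, c) = g(S(a, b), c)\<close> is totally symmetric, whereas moving \<open>J\<close> from one
  argument to another changes its sign. Three such moves bring \<open>J\<close> back to the argument where it
  started.\<close>

lemma S_zero_if_symmetric:
  assumes x: "x \<in> V" and sym: "\<And>a b. S x a b = S x b a"
  shows "S x a b = 0"
proof -
  define F where "F a b c = M x (S x a b) c" for a b c
  have sym1: "F a b c = F b a c" and sym2: "F a b c = F a c b" for a b c
    unfolding F_def using sym[of a b] S_self_adjoint[OF x, of a b c] M_sym[OF x, of b] by simp_all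
  have J: "F a (J x b) c = - F a b (J x c)" for a b c
    by (simp add: F_def S_J[OF x] M_simps[OF x] J_self_adjoint[OF x])
  have J1: "F (J x a) b c = - F a b (J x c)" for a b c
    using sym1[of "J x a" b c] J[of b a c] sym1[of b a "J x c"] by simp
  have "F (J x a) b c = 0" for a b c
    using J1[of a b c] sym2[of "J x a" b c] J1[of a c b] sym2[of a c "J x b"] J[of a b c] by simp
  then have "F a b c = 0" for a b c
    using J_square[OF x, of "- a"] by (metis minus_minus)
  then show ?thesis
    using M_nondegenerate[OF x] by (simp add: F_def)
qed

lemma first_bianchi:
  assumes x: "x \<in> V"
  shows "curv G x a b c + curv G x b c a + curv G x c a b = 0"
  by (simp add: curv_def dG_sym[OF x, of c] dG_sym[OF x, of b a] G_sym[OF x, of c] G_sym[OF x, of b a])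

text \<open>Second derivatives of the metric coefficients commute.\<close>

lemma curv_skew_adjoint:
  assumes x: "x \<in> V"
  shows "M x (curv G x a b c) d = - M x c (curv G x a b d)"
proof -
  have *: "fd (\<lambda>y. fd (\<lambda>y. M y c d) y b) x a =
     M x (G x a (G x b c) + fd (\<lambda>y. G y b c) x a) d + M x (G x b c) (G x a d)
     + (M x (G x a c) (G x b d) + M x c (G x a (G x b d) + fd (\<lambda>y. G y b d) x a))" for a b
  proof -
    have "fd (\<lambda>y. fd (\<lambda>y. M y c d) y b) x = fd (\<lambda>y. M y (G y b c) d + M y c (G y b d)) x"
      by (rule fd_cong[OF open_V x]) (rule M_compatible)
    also have "\<dots> = (\<lambda>h. fd (\<lambda>y. M y (G y b c) d) x h + fd (\<lambda>y. M y c (G y b d)) x h)"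
      using x by (intro fd_eqI has_derivative_add has_derivative_fd
         differentiable_M G_differentiable differentiable_const)
    finally show ?thesis
      by (simp add: fd_M[OF x G_differentiable[OF x] differentiable_const]
          fd_M[OF x differentiable_const G_differentiable[OF x]])
  qed
  have "fd (\<lambda>y. fd (\<lambda>y. M y c d) y b) x a = fd (\<lambda>y. fd (\<lambda>y. M y c d) y a) x b"
    by (rule second_derivative_symmetric[OF open_V x M_smooth])
  then show ?thesis
    unfolding * by (simp add: curv_def M_simps[OF x])
qed

text \<open>Where \<open>J\<close> is parallel, its derivatives are expressed by \<open>J\<close> and the Christoffel symbols; the
  symmetry of its second derivatives is then the assertion.\<close>

lemma curv_commutes:
  assumes x: "x \<in> V" and par: "\<And>x a b. x \<in> V \<Longrightarrow> S x a b = 0"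
  shows "curv G x a b (J x c) = J x (curv G x a b c)"
proof -
  have dJ: "fd (\<lambda>y. J y v) y h = J y (G y h v) - G y h (J y v)" if "y \<in> V" for y v h
    using par[OF that, of h v] by (simp add: cov_endo_def algebra_simps)
  have *: "fd (\<lambda>y. fd (\<lambda>y. J y c) y b) x a
     = J x (G x a (G x b c)) - G x a (J x (G x b c)) + J x (fd (\<lambda>y. G y b c) x a)
       - (fd (\<lambda>y. G y b (J x c)) x a + G x b (J x (G x a c) - G x a (J x c)))" for a b
  proof -
    note GJ = has_derivative_linear_family[where F="\<lambda>y. G y b" and a="\<lambda>y. J y c", OF open_V x G_linear_right
        G_differentiable[OF x] has_derivative_fd[OF J_differentiable[OF x]]]
    have "fd (\<lambda>y. fd (\<lambda>y. J y c) y b) x = fd (\<lambda>y. J y (G y b c) - G y b (J y c)) x"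
      by (rule fd_cong[OF open_V x]) (rule dJ)
    then show ?thesis
      using fd_eqI[OF has_derivative_diff[OF J.has_derivative_K[OF x G_differentiable[OF x]] GJ]]
      by (simp add: dJ[OF x])
  qed
  have "fd (\<lambda>y. fd (\<lambda>y. J y c) y b) x a = fd (\<lambda>y. fd (\<lambda>y. J y c) y a) x b"
    by (rule second_derivative_symmetric[OF open_V x J_smooth])
  then show ?thesis
    unfolding * by (simp add: curv_def linear_add[OF J_linear] linear_diff[OF J_linear] G_diff_right
        algebra_simps)
qed

text \<open>The metric turns \<open>curvature_pure\<close> into a statement on \<open>R\<close> itself, by nondegeneracy.\<close>

lemma curv_J_left:
  assumes x: "x \<in> V" and par: "\<And>x a b. x \<in> V \<Longrightarrow> S x a b = 0"
  shows "curv G x (J x a) b c = J x (curv G x a b c)"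
proof (rule M_eqI[OF x])
  fix d
  let ?T = "\<lambda>a b c d. M x (curv G x a b c) d"
  have "?T (J x a) b c d = ?T a b (J x c) d"
  proof (rule curvature_pure[of ?T "J x"])
    show "?T b a c d = - ?T a b c d" for a b c d
      using curv_skew[of x b a c] by (simp add: M_simps[OF x])
    show "?T a b d c = - ?T a b c d" for a b c d
      using curv_skew_adjoint[OF x, of a b c d] M_sym[OF x, of c] by simp
    show "?T a b c d + ?T b c a d + ?T c a b d = 0" for a b c d
      using first_bianchi[OF x, of a b c] linear_0[OF M_linear_left[OF x]]
          by (simp add: M_simps[OF x, symmetric])
    show "?T a b (J x c) d = ?T a b c (J x d)" for a b c d
      using curv_commutes[OF x par] J_self_adjoint[OF x] by simp
  qed
  then show "?T (J x a) b c d = M x (J x (curv G x a b c)) d"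
    using curv_commutes[OF x par] by simp
qed

theorem nij_k2_zero_all_iff:
  "(\<forall>x\<in>V. \<forall>y u v. nij k2 (x, y) u v = 0) \<longleftrightarrow>
    (\<forall>x\<in>V. \<forall>a b v. curv G x a b v = 0) \<and> (\<forall>x\<in>V. \<forall>a b. S x a b = 0)"
  using nij_k2_zero_iff S_zero_if_symmetric by metis

text \<open>The mixed condition is \<open>S(J a, b) = - J S(a, b)\<close>; it turns the horizontal one into
  \<open>2 J (S(a, b) - S(b, a)) = 0\<close>, whence \<open>S = 0\<close>. The vertical condition is then
  \<open>- 4 R(a, b) y = 0\<close>, because \<open>R\<close> is complex linear in its first two arguments.\<close>

theorem nij_k3_zero_all_iff:
  "(\<forall>x\<in>V. \<forall>y u v. nij k3 (x, y) u v = 0) \<longleftrightarrow>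
    (\<forall>x\<in>V. \<forall>a b v. curv G x a b v = 0) \<and> (\<forall>x\<in>V. \<forall>a b. S x a b = 0)"
    (is "?L \<longleftrightarrow> ?R")
proof
  assume R: ?R
  have "\<forall>u v. nij k3 (x, y) u v = 0" if "x \<in> V" for x y
    unfolding nij_k3_zero_iff[OF that] using R that by (simp add: linear_0[OF J_linear])
  then show ?L by blast
next
  assume ?L
  then have 1: "J x (S x a b) + S x (J x a) b = 0"
    and 2: "J x (S x a b - S x b a) - S x (J x a) b + S x (J x b) a = 0"
    and 3: "curv G x (J x a) (J x b) y - curv G x a b y + J x (curv G x (J x a) b y)
        + J x (curv G x a (J x b) y) = 0"
    if "x \<in> V" for x a b y
    using nij_k3_zero_iff[OF that] that by blast+
  have S: "S x a b = 0" if x: "x \<in> V" for x a b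
  proof (rule S_zero_if_symmetric[OF x])
    fix a b
    have "S x (J x a) b = - J x (S x a b)" for a b
      using 1[OF x, of a b] by (simp add: eq_neg_iff_add_eq_0 add.commute)
    then have "J x (S x a b - S x b a) + J x (S x a b - S x b a) = 0"
      using 2[OF x, of a b] by (simp add: linear_diff[OF J_linear] algebra_simps)
    then have "J x (S x a b - S x b a) = 0"
      using scaleR_2 by (metis scaleR_eq_0_iff zero_neq_numeral)
    then have "J x (J x (S x a b - S x b a)) = 0"
      by (simp add: linear_0[OF J_linear])
    then show "S x a b = S x b a"
      using J_square[OF x] by simp
  qed
  have "curv G x a b v = 0" if x: "x \<in> V" for x a b v
  proof -
    have JL: "curv G x (J x a) b v = J x (curv G x a b v)" for a b
      by (rule curv_J_left[OF x S])
    have JR: "curv G x a (J x b) v = J x (curv G x a b v)" for a b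
      using JL[of b a] curv_skew[of x a] by (simp add: linear_neg[OF J_linear])
    have "- curv G x a b v - curv G x a b v + - curv G x a b v + - curv G x a b v = 0"
      using 3[OF x, of a b v] unfolding JL JR J_square[OF x] .
    moreover have "(2::real) *\<^sub>R (2::real) *\<^sub>R curv G x a b v
        = - (- curv G x a b v - curv G x a b v + - curv G x a b v + - curv G x a b v)"
      unfolding scaleR_2 by simp
    ultimately have "(2::real) *\<^sub>R (2::real) *\<^sub>R curv G x a b v = 0"
      by (simp only: minus_zero)
    then show ?thesis by simp
  qed
  with S show ?R by blast
qed

end

section \<open>Integrability in charts\<close>

context atlas
begin

lemma lie_bracket_in_chart:
  "c \<in> charts_at A p \<Longrightarrow> lie_bracket A X Y p c = bracket (in_chart c X) (in_chart c Y) (snd c p)"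
  by (simp add: lie_bracket_component bracket_def charts_atD)

text \<open>The derivatives of the fields cancel by \<open>nij_eq\<close>, and constant coordinate fields realise all
  pairs of tangent vectors, so the condition on vector fields is a pointwise one in each chart.\<close>

theorem complex_structure_iff:
  assumes K_tangent: "\<And>p v. p \<in> points A \<Longrightarrow> v \<in> tangent_space A p \<Longrightarrow> K p v \<in> tangent_space A p"
    and K_chart: "\<And>c p v. c \<in> charts_at A p \<Longrightarrow> v \<in> tangent_space A p \<Longrightarrow> K p v c = k c (snd c p) (v c)"
    and k: "\<And>c. c \<in> A \<Longrightarrow> complex_field (snd c ` fst c) (k c)"
  shows "complex_structure A K \<longleftrightarrow> (\<forall>c\<in>A. \<forall>x\<in>snd c ` fst c. \<forall>u v. nij (k c) x u v = 0)"
proof -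
  have points: "p \<in> points A" if "c \<in> charts_at A p" for c p
    using that by (auto simp: points_def charts_at_def)
  have main: "nijenhuis A K X Y p \<in> tangent_space A p"
      "nijenhuis A K X Y p c = nij (k c) (snd c p) (X p c) (Y p c)"
    if U: "openin (manifold_topology A) U" "p \<in> U" and X: "vector_field A U X" and Y: "vector_field A U Y"
      and c: "c \<in> charts_at A p" for U X Y p c
  proof -
    have W: "open (snd c ` (U \<inter> fst c))" "snd c p \<in> snd c ` (U \<inter> fst c)" if "c \<in> charts_at A p" for c
      using that U by (auto intro: open_in_chart dest: charts_atD)
    have KX_tangent: "K q (X q) \<in> tangent_space A q" if "vector_field A U X" "q \<in> U" for X q
      using that ex_chart[OF U(1)] points by (meson K_tangent vector_field_tangent)
    have KX: "in_chart c (\<lambda>q. K q (X q)) x = k c x (in_chart c X x)"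
      if X: "vector_field A U X" and c: "c \<in> A" and "x \<in> snd c ` (U \<inter> fst c)" for X c x
    proof -
      obtain q where "q \<in> U" "q \<in> fst c" "x = snd c q" using \<open>x \<in> _\<close> by auto
      then show ?thesis
        using K_chart[OF charts_atI[OF c] vector_field_tangent[OF X]] c by simp
    qed
    have fdKX: "fd (in_chart c (\<lambda>q. K q (X q))) (snd c p) = fd (\<lambda>x. k c x (in_chart c X x)) (snd c p)"
      if X: "vector_field A U X" and c: "c \<in> charts_at A p" for X c
      by (rule fd_cong[OF W[OF c]]) (rule KX[OF X charts_atD(1)[OF c]])
    have KX_diff: "in_chart c (\<lambda>q. K q (X q)) differentiable (at (snd c p))"
      if X: "vector_field A U X" and c: "c \<in> charts_at A p" for X c
    proof (rule differentiable_cong[OF _ W[OF c]])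
      interpret k: complex_field "snd c ` fst c" "k c" by (rule k[OF charts_atD(1)[OF c]])
      show "(\<lambda>x. k c x (in_chart c X x)) differentiable at (snd c p)"
        using k.has_derivative_K[OF _ vector_field_differentiable[OF X U(2) c]] charts_atD(2)[OF c]
        by (auto simp: differentiable_def)
    qed (rule KX[OF X charts_atD(1)[OF c], symmetric])
    note t = vector_field_tangent and d = vector_field_differentiable[OF _ U(2)]
    have b: "lie_bracket A X Y p \<in> tangent_space A p"
      "lie_bracket A (\<lambda>q. K q (X q)) Y p \<in> tangent_space A p"
      "lie_bracket A X (\<lambda>q. K q (Y q)) p \<in> tangent_space A p"
      "lie_bracket A (\<lambda>q. K q (X q)) (\<lambda>q. K q (Y q)) p \<in> tangent_space A p"
      by (rule lie_bracket_tangent[OF U];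
          (rule t[OF X] t[OF Y] d[OF X] d[OF Y] KX_tangent[OF X] KX_tangent[OF Y] KX_diff[OF X]
          KX_diff[OF Y]; assumption))+
    show "nijenhuis A K X Y p \<in> tangent_space A p"
      unfolding nijenhuis_def
      by (intro tangent_space_add tangent_space_diff K_tangent b points[OF c])
    interpret k: complex_field "snd c ` fst c" "k c" by (rule k[OF charts_atD(1)[OF c]])
    have x: "snd c p \<in> snd c ` fst c" using charts_atD(2)[OF c] by blast
    note cA = charts_atD(1)[OF c] and cp = charts_atD(2)[OF c]
    have "nijenhuis A K X Y p c = nij (k c) (snd c p) (in_chart c X (snd c p)) (in_chart c Y (snd c p))"
      unfolding k.nij_eq[OF x d[OF X c] d[OF Y c], symmetric] nijenhuis_def
      using KX[OF X cA W(2)[OF c]] KX[OF Y cA W(2)[OF c]]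
      by (simp add: K_chart[OF c] b lie_bracket_in_chart[OF c])
          (simp add: bracket_def fdKX[OF X c] fdKX[OF Y c])
    then show "nijenhuis A K X Y p c = nij (k c) (snd c p) (X p c) (Y p c)"
      using cA cp by simp
  qed
  show ?thesis
  proof
    assume cs: "complex_structure A K"
    show "\<forall>c\<in>A. \<forall>x\<in>snd c ` fst c. \<forall>u v. nij (k c) x u v = 0"
    proof (intro ballI allI)
      fix c x u v assume c: "c \<in> A" and "x \<in> snd c ` fst c"
      then obtain p where p: "p \<in> fst c" "x = snd c p" by auto
      note at = charts_atI[OF c p(1)] and vf = vector_field_coord[OF c] and U = openin_chart[OF c]
      have "nijenhuis A K (coord_field A c u) (coord_field A c v) p c = 0"
        using cs U vf p(1) unfolding complex_structure_def by (metis zero_fun_apply)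
      then show "nij (k c) x u v = 0"
        using main(2)[OF U p(1) vf vf at] at p(2) by simp
    qed
  next
    assume *: "\<forall>c\<in>A. \<forall>x\<in>snd c ` fst c. \<forall>u v. nij (k c) x u v = 0"
    show "complex_structure A K"
      unfolding complex_structure_def
    proof (intro allI impI ballI)
      fix U X Y p
      assume "openin (manifold_topology A) U \<and> vector_field A U X \<and> vector_field A U Y" and p: "p \<in> U"
      then have U: "openin (manifold_topology A) U" and vf: "vector_field A U X" "vector_field A U Y"
        by auto
      obtain c where c: "c \<in> charts_at A p" using ex_chart[OF U p] by blast
      show "nijenhuis A K X Y p = 0"
        using main[OF U p vf c] * charts_atD[OF c]
        by (intro tangent_space_eqI[OF _ tangent_space_zero c]) simp_all
    qed
  qed
qed

end

section \<open>The tangent bundle\<close>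

context atlas
begin

abbreviation "TA \<equiv> tangent_bundle A"
abbreviation "B \<equiv> bundle_chart A"

lemma fst_B: "fst (B c) = (SIGMA p:fst c. tangent_space A p)" and snd_B: "snd (B c) (p, u) = (snd c p, u c)"
  by (simp_all add: bundle_chart_def)

lemma B_inject: "B c = B c' \<longleftrightarrow> c = c'"
proof
  assume "B c = B c'"
  then have *: "snd (B c) (p, u) = snd (B c') (p, u)" for p u by simp
  \<comment> \<open>the coordinate map of \<open>B c\<close> reads off the \<open>c\<close>-component of arbitrary families, so it determines \<open>c\<close>\<close>
  obtain b :: 'e where b: "b \<noteq> 0"
    using nonzero_Basis SOME_Basis by blast
  show "c = c'"
    using *[of undefined "\<lambda>d. if d = c then b else 0"] b by (auto simp: snd_B split: if_splits)
qed simp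

lemma charts_at_TA: "u \<in> tangent_space A p \<Longrightarrow> charts_at TA (p, u) = B ` charts_at A p"
  by (auto simp: charts_at_def tangent_bundle_def fst_B)

lemma points_TA: "(p, u) \<in> points TA \<longleftrightarrow> p \<in> points A \<and> u \<in> tangent_space A p"
  by (auto simp: points_def tangent_bundle_def fst_B)

lemma B_image:
  assumes c: "c \<in> A" and S: "S \<subseteq> fst c"
  shows "snd (B c) ` (SIGMA p:S. tangent_space A p) = (snd c ` S) \<times> UNIV"
proof
  show "snd (B c) ` (SIGMA p:S. tangent_space A p) \<subseteq> (snd c ` S) \<times> UNIV"
    by (auto simp: snd_B)
  show "(snd c ` S) \<times> UNIV \<subseteq> snd (B c) ` (SIGMA p:S. tangent_space A p)"
  proof
    fix z assume "z \<in> (snd c ` S) \<times> (UNIV :: 'e set)"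
    then obtain p y where p: "p \<in> S" "z = (snd c p, y)" by auto
    then have at: "c \<in> charts_at A p" using c S by (auto intro: charts_atI)
    have "z = snd (B c) (p, coord_field A c y p)"
      using at p by (simp add: snd_B)
    then show "z \<in> snd (B c) ` (SIGMA p:S. tangent_space A p)"
      using p(1) coord_field_tangent[OF at] by blast
  qed
qed

lemma B_overlap:
  "c \<in> A \<Longrightarrow> snd (B c) ` (fst (B c) \<inter> fst (B c')) = snd c ` (fst c \<inter> fst c') \<times> UNIV"
  using B_image[of c "fst c \<inter> fst c'"] by (simp add: fst_B Sigma_Int_distrib1[symmetric])

lemma B_range: "c \<in> A \<Longrightarrow> snd (B c) ` fst (B c) = snd c ` fst c \<times> UNIV"
  using B_overlap[of c c] by simp

lemma B_inj: "c \<in> A \<Longrightarrow> inj_on (snd (B c)) (fst (B c))"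
proof (rule inj_onI)
  fix z z' assume c: "c \<in> A" and z: "z \<in> fst (B c)" "z' \<in> fst (B c)" and eq: "snd (B c) z = snd (B c) z'"
  obtain p u p' u' where zz: "z = (p, u)" "z' = (p', u')" by (cases z, cases z')
  have p: "p \<in> fst c" "p' \<in> fst c" "u \<in> tangent_space A p" "u' \<in> tangent_space A p'"
    using z by (auto simp: zz fst_B)
  have "p = p'"
    using eq p smooth_atlas c by (auto simp: zz snd_B smooth_atlas_def dest: inj_onD)
  moreover have "u c = u' c" using eq by (simp add: zz snd_B)
  ultimately show "z = z'"
    using tangent_space_eqI[of u p u' c] p c by (simp add: zz charts_atI)
qed

lemma B_transition:
  assumes c: "c \<in> A" and c': "c' \<in> A" and z: "z \<in> snd c ` (fst c \<inter> fst c') \<times> UNIV"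
  shows "transition (B c) (B c') z = (transition c c' (fst z), fd (transition c c') (fst z) (snd z))"
proof -
  have "z \<in> snd (B c) ` (fst (B c) \<inter> fst (B c'))"
    using z B_overlap[OF c] by simp
  then obtain w where w: "w \<in> fst (B c)" "w \<in> fst (B c')" "z = snd (B c) w" by auto
  obtain p u where pu: "w = (p, u)" by (cases w)
  have at: "c \<in> charts_at A p" "c' \<in> charts_at A p" and u: "u \<in> tangent_space A p"
    using w c c' by (auto simp: pu fst_B intro: charts_atI)
  have "chart_inv (B c) z = w"
    using w B_inj[OF c] by (simp add: chart_inv_def)
  then have "transition (B c) (B c') z = snd (B c') w"
    by (simp add: transition_def)
  then show ?thesis
    using tangent_space_component[OF u at] w(3) c c' at charts_atD by (simp add: pu snd_B)
qed

text \<open>The transition maps are \<open>(x, y) \<mapsto> (\<tau> x, D\<tau>(x) y)\<close> with \<open>\<tau>\<close> a transition map of the base, and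
  tangent vectors take arbitrary component values in a chart, so the coordinate image of an
  overlap is a full cylinder.\<close>

lemma smooth_atlas_TA: "smooth_atlas TA"
  unfolding smooth_atlas_def
proof (intro conjI ballI)
  fix C assume "C \<in> TA" then show "inj_on (snd C) (fst C)"
    using B_inj by (auto simp: tangent_bundle_def)
next
  fix C C' assume "C \<in> TA" "C' \<in> TA"
  then obtain c c' where c: "c \<in> A" "C = B c" and c': "c' \<in> A" "C' = B c'"
    by (auto simp: tangent_bundle_def)
  let ?O = "snd c ` (fst c \<inter> fst c')" and ?\<tau> = "transition c c'"
  have O: "open (?O \<times> (UNIV :: 'e set))"
    by (simp add: open_Times open_overlap c c')
  then show "open (snd C ` (fst C \<inter> fst C'))"
    by (simp add: c(2) c'(2) B_overlap[OF c(1)])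
  have fst: "smooth_on (?O \<times> UNIV) (fst :: 'e \<times> 'e \<Rightarrow> 'e)"
      and snd: "smooth_on (?O \<times> UNIV) (snd :: 'e \<times> 'e \<Rightarrow> 'e)"
    by (auto intro: smooth_on_bounded_linear bounded_linear_fst bounded_linear_snd)
  have \<tau>: "smooth_on ?O ?\<tau>" by (rule smooth_transition[OF c(1) c'(1)])
  have "smooth_on (?O \<times> UNIV) (\<lambda>z::'e \<times> 'e. (?\<tau> (fst z), fd ?\<tau> (fst z) (snd z)))"
  proof (rule smooth_on_Pair[OF O])
    show "smooth_on (?O \<times> UNIV) (\<lambda>z::'e \<times> 'e. ?\<tau> (fst z))"
      by (rule smooth_on_compose[OF O _ \<tau> fst]) auto
    show "smooth_on (?O \<times> UNIV) (\<lambda>z::'e \<times> 'e. fd ?\<tau> (fst z) (snd z))"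
    proof (rule smooth_on_linear_family[where F="\<lambda>z. fd ?\<tau> (fst z)", OF O _ _ snd])
      show "linear (fd ?\<tau> (fst z))" if "z \<in> ?O \<times> UNIV" for z :: "'e \<times> 'e"
        by (rule linear_fd[OF smooth_on_differentiable[OF \<tau>]]) (use that in auto)
      show "smooth_on (?O \<times> UNIV) (\<lambda>z::'e \<times> 'e. fd ?\<tau> (fst z) i)" for i
        by (rule smooth_on_compose[OF O _ smooth_on_fd[OF \<tau>] fst]) auto
    qed
  qed
  then show "smooth_on (snd C ` (fst C \<inter> fst C')) (transition C C')"
    unfolding c(2) c'(2) B_overlap[OF c(1)]
    by (rule smooth_on_cong[OF O]) (rule B_transition[OF c(1) c'(1), symmetric])
qed

lemma atlas_TA: "atlas TA"
  by (rule atlas.intro[OF smooth_atlas_TA])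

end

section \<open>Lifts\<close>

lemma ball_image_eq: "(\<forall>y\<in>f ` S. P y) \<longleftrightarrow> (\<forall>x\<in>S. P (f x))"
  by simp

lemma ball_Times_UNIV: "(\<forall>z\<in>S \<times> UNIV. P z) \<longleftrightarrow> (\<forall>x\<in>S. \<forall>y. P (x, y))"
  by auto

context torsion_free_connection
begin

sublocale T: atlas "tangent_bundle A"
  by (rule atlas_TA)

lemma B_charts_at: "c \<in> charts_at A p \<Longrightarrow> u \<in> tangent_space A p \<Longrightarrow> B c \<in> charts_at TA (p, u)"
  by (simp add: charts_at_TA)

text \<open>The Jacobian of the bundle transition \<open>(x, y) \<mapsto> (\<tau> x, D\<tau>(x) y)\<close>. The second derivative of
  \<open>\<tau>\<close> in its lower left block is the inhomogeneous term in the transformation of the Christoffel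
  symbols.\<close>

lemma B_jac:
  assumes u: "u \<in> tangent_space A p" and c: "c \<in> charts_at A p" and c': "c' \<in> charts_at A p"
  shows "T.jac (B c) (B c') (p, u) (a, b)
    = (jac c c' p a, fd (\<lambda>x. fd (transition c c') x (u c)) (snd c p) a + jac c c' p b)"
proof -
  note cA = c[THEN charts_atD(1)] c'[THEN charts_atD(1)]
      and P = c[THEN charts_atD(2)] c'[THEN charts_atD(2)]
  let ?O = "snd c ` (fst c \<inter> fst c')" and ?\<tau> = "transition c c'" and ?z = "(snd c p, u c)"
  have O: "open (?O \<times> (UNIV :: 'e set))" "?z \<in> ?O \<times> UNIV"
    using P by (simp_all add: open_Times open_overlap cA)
  have \<tau>: "?\<tau> differentiable (at (fst ?z))" "(\<lambda>x. fd ?\<tau> x v) differentiable (at (fst ?z))" for v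
    using transition_differentiable[OF c c'] O(2)
        smooth_on_differentiable[OF smooth_on_fd[OF smooth_transition[OF cA]]] by auto
  have 1: "((\<lambda>z. ?\<tau> (fst z)) has_derivative (\<lambda>h. fd ?\<tau> (fst ?z) (fst h))) (at ?z)"
    by (rule has_derivative_compose[OF has_derivative_fst[OF has_derivative_ident]
        has_derivative_fd[OF \<tau>(1)]])
  have 2: "((\<lambda>z. fd ?\<tau> (fst z) (snd z)) has_derivative
      (\<lambda>h. fd (\<lambda>x. fd ?\<tau> x (snd ?z)) (fst ?z) (fst h) + fd ?\<tau> (fst ?z) (snd h))) (at ?z)"
  proof (rule has_derivative_linear_family_compose[where F="fd ?\<tau>" and \<phi>=fst, OF open_overlap[OF cA]])
    show "linear (fd ?\<tau> y)" if "y \<in> ?O" for y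
      by (rule linear_fd[OF smooth_on_differentiable[OF smooth_transition[OF cA] that]])
  qed (use O(2) \<tau> in \<open>auto intro: has_derivative_fst has_derivative_snd has_derivative_ident\<close>)
  have "fd (transition (B c) (B c')) ?z = fd (\<lambda>z. (?\<tau> (fst z), fd ?\<tau> (fst z) (snd z))) ?z"
    by (rule fd_cong[OF O]) (rule B_transition[OF cA])
  also have "\<dots> = (\<lambda>h. (fd ?\<tau> (fst ?z) (fst h),
      fd (\<lambda>x. fd ?\<tau> x (snd ?z)) (fst ?z) (fst h) + fd ?\<tau> (fst ?z) (snd h)))"
    by (rule fd_eqI[OF has_derivative_Pair[OF 1 2]])
  finally show ?thesis
    by (simp add: snd_B)
qed

text \<open>Both lifts are defined by prescribing their components in all induced charts. This is
  consistent as soon as the prescribed components in one chart transform into those in every other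
  one.\<close>

lemma lift_unique:
  assumes u: "u \<in> tangent_space A p" and c: "c \<in> charts_at A p"
    and compat: "\<And>c'. c' \<in> charts_at A p \<Longrightarrow> T.jac (B c) (B c') (p, u) (L c) = L c'"
  defines "w \<equiv> THE w. w \<in> tangent_space TA (p, u) \<and> (\<forall>c\<in>charts_at A (fst (p, u)). w (B c) = L c)"
  shows "w \<in> tangent_space TA (p, u)" and "w (B c) = L c"
proof -
  let ?w = "coord_field TA (B c) (L c) (p, u)"
  note Bc = B_charts_at[OF c u]
  have ex: "?w \<in> tangent_space TA (p, u)" by (rule T.coord_field_tangent[OF Bc])
  have "?w (B c') = L c'" if "c' \<in> charts_at A p" for c'
    using T.coord_field_component[OF Bc B_charts_at[OF that u]] compat[OF that] by simp
  then have sat: "?w \<in> tangent_space TA (p, u) \<and> (\<forall>c\<in>charts_at A (fst (p, u)). ?w (B c) = L c)"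
    using ex by simp
  have "w = ?w"
    unfolding w_def
  proof (rule the_equality)
    show "?w \<in> tangent_space TA (p, u) \<and> (\<forall>c\<in>charts_at A (fst (p, u)). ?w (B c) = L c)"
      by (rule sat)
  next
    fix w' assume "w' \<in> tangent_space TA (p, u) \<and> (\<forall>c\<in>charts_at A (fst (p, u)). w' (B c) = L c)"
    then show "w' = ?w"
      using Bc c by (intro T.tangent_space_eqI[OF _ ex Bc]) simp_all
  qed
  then show "w \<in> tangent_space TA (p, u)" "w (B c) = L c"
    using ex Bc by simp_all
qed

lemma vlift_in_chart:
  assumes u: "u \<in> tangent_space A p" and v: "v \<in> tangent_space A p" and c: "c \<in> charts_at A p"
  shows vlift_tangent: "vlift A (p, u) v \<in> tangent_space TA (p, u)"
    and vlift_component: "vlift A (p, u) v (B c) = (0, v c)"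
proof -
  have "T.jac (B c) (B c') (p, u) (0, v c) = (0, v c')" if c': "c' \<in> charts_at A p" for c'
  proof -
    have "(\<lambda>x. fd (transition c c') x (u c)) differentiable (at (snd c p))"
      using c c' by (intro smooth_on_differentiable[OF smooth_on_fd[OF smooth_transition]])
          (auto dest: charts_atD)
    then have "fd (\<lambda>x. fd (transition c c') x (u c)) (snd c p) 0 = 0"
      by (rule linear_0[OF linear_fd])
    then show ?thesis
      using B_jac[OF u c c'] tangent_space_component[OF v c c'] linear_0[OF linear_jac[OF c c']] by simp
  qed
  from lift_unique[OF u c, of "\<lambda>c. (0, v c)", OF this]
  show "vlift A (p, u) v \<in> tangent_space TA (p, u)" "vlift A (p, u) v (B c) = (0, v c)"
    unfolding vlift_def by blast+
qed

lemma hlift_in_chart: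
  assumes u: "u \<in> tangent_space A p" and v: "v \<in> tangent_space A p" and c: "c \<in> charts_at A p"
  shows hlift_tangent: "hlift A D (p, u) v \<in> tangent_space TA (p, u)"
    and hlift_component: "hlift A D (p, u) v (B c) = (v c, - christoffel A D c p (u c) (v c))"
proof -
  have "T.jac (B c) (B c') (p, u) (v c, - christoffel A D c p (u c) (v c))
      = (v c', - christoffel A D c' p (u c') (v c'))"
    if c': "c' \<in> charts_at A p" for c'
    using B_jac[OF u c c'] tangent_space_component[OF v c c'] christoffel_transition[OF c c' v u]
      christoffel_sym[OF c, of "u c"] christoffel_sym[OF c', of "u c'"]
          linear_neg[OF linear_jac[OF c c']] by simp
  from lift_unique[OF u c, of "\<lambda>c. (v c, - christoffel A D c p (u c) (v c))", OF this]
  show "hlift A D (p, u) v \<in> tangent_space TA (p, u)"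
    "hlift A D (p, u) v (B c) = (v c, - christoffel A D c p (u c) (v c))"
    unfolding hlift_def by simp_all
qed

lemma lifts_component:
  assumes u: "u \<in> tangent_space A p" and a: "a \<in> tangent_space A p" and b: "b \<in> tangent_space A p"
    and c: "c \<in> charts_at A p"
  shows "(hlift A D (p, u) a + vlift A (p, u) b) (B c)
      = chart_connection.hvec (gam c) (snd c p, u c) (a c) (b c)"
proof -
  interpret C: chart_connection "snd c ` fst c" "gam c" by (rule chart_connection[OF charts_atD(1)[OF c]])
  show ?thesis
    using hlift_component[OF u a c] vlift_component[OF u b c] charts_atD[OF c]
    by (simp add: C.hvec_def)
qed

text \<open>Every vector tangent to the bundle splits uniquely into lifts, so prescribing the images of
  lifts defines an endomorphism.\<close>

lemma endo_by_lifts: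
  assumes u: "u \<in> tangent_space A p" and w: "w \<in> tangent_space TA (p, u)" and c: "c \<in> charts_at A p"
    and F: "\<And>a b. a \<in> tangent_space A p \<Longrightarrow> b \<in> tangent_space A p \<Longrightarrow> F a b \<in> tangent_space TA (p, u)"
    and Fc: "\<And>a b. a \<in> tangent_space A p \<Longrightarrow> b \<in> tangent_space A p \<Longrightarrow> F a b (B c) = f (a c) (b c)"
  defines "w' \<equiv> THE w'. \<exists>a\<in>tangent_space A (fst (p, u)). \<exists>b\<in>tangent_space A (fst (p, u)).
     w = hlift A D (p, u) a + vlift A (p, u) b \<and> w' = F a b"
  shows "w' \<in> tangent_space TA (p, u)"
    and "w' (B c) = f (fst (w (B c))) (chart_connection.vert (gam c) (snd c p, u c) (w (B c)))"
proof -
  interpret C: chart_connection "snd c ` fst c" "gam c" by (rule chart_connection[OF charts_atD(1)[OF c]])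
  let ?z = "(snd c p, u c)"
  define a where "a = coord_field A c (fst (w (B c))) p"
  define b where "b = coord_field A c (C.vert ?z (w (B c))) p"
  have ab: "a \<in> tangent_space A p" "b \<in> tangent_space A p"
    unfolding a_def b_def by (rule coord_field_tangent[OF c])+
  have abc: "a c = fst (w (B c))" "b c = C.vert ?z (w (B c))"
    using c by (simp_all add: a_def b_def)
  have split: "w = hlift A D (p, u) a + vlift A (p, u) b"
    using lifts_component[OF u ab c] c
    by (intro T.tangent_space_eqI[OF w T.tangent_space_add B_charts_at[OF c u]]
        hlift_tangent[OF u _ c] vlift_tangent[OF u _ c] ab)
      (simp add: abc C.hvec_collapse)
  have "w' = F a b"
    unfolding w'_def
  proof (rule the_equality)
    show "\<exists>a'\<in>tangent_space A (fst (p, u)). \<exists>b'\<in>tangent_space A (fst (p, u)).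
       w = hlift A D (p, u) a' + vlift A (p, u) b' \<and> F a b = F a' b'"
      using ab split by auto
  next
    fix v assume "\<exists>a'\<in>tangent_space A (fst (p, u)). \<exists>b'\<in>tangent_space A (fst (p, u)).
       w = hlift A D (p, u) a' + vlift A (p, u) b' \<and> v = F a' b'"
    then obtain a' b' where ab': "a' \<in> tangent_space A p" "b' \<in> tangent_space A p"
      "w = hlift A D (p, u) a' + vlift A (p, u) b'" "v = F a' b'" by auto
    have "C.hvec ?z (a' c) (b' c) = C.hvec ?z (a c) (b c)"
      using lifts_component[OF u ab'(1,2) c] lifts_component[OF u ab c] ab'(3) split by metis
    then have "a' c = a c" "b' c = b c"
      using C.fst_hvec C.vert_hvec by metis+
    then show "v = F a b"
      using tangent_space_eqI[OF ab'(1) ab(1) c] tangent_space_eqI[OF ab'(2) ab(2) c] ab'(4) by simp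
  qed
  then show "w' \<in> tangent_space TA (p, u)" "w' (B c) = f (fst (w (B c))) (C.vert ?z (w (B c)))"
    using F[OF ab] Fc[OF ab] abc by simp_all
qed

lemma J1_in_chart:
  assumes u: "u \<in> tangent_space A p" and w: "w \<in> tangent_space TA (p, u)" and c: "c \<in> charts_at A p"
  shows J1_tangent: "J1 A D (p, u) w \<in> tangent_space TA (p, u)"
    and J1_component: "J1 A D (p, u) w (B c) = chart_connection.k1 (gam c) (snd c p, u c) (w (B c))"
proof -
  interpret C: chart_connection "snd c ` fst c" "gam c" by (rule chart_connection[OF charts_atD(1)[OF c]])
  let ?z = "(snd c p, u c)"
  have F: "vlift A (p, u) a - hlift A D (p, u) b \<in> tangent_space TA (p, u)"
    "(vlift A (p, u) a - hlift A D (p, u) b) (B c) = C.hvec ?z (- b c) (a c)"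
    if "a \<in> tangent_space A p" "b \<in> tangent_space A p" for a b
    using hlift_in_chart[OF u that(2) c] vlift_in_chart[OF u that(1) c] charts_atD[OF c]
        C.G_minus_right[of "snd c p"]
    by (simp_all add: T.tangent_space_diff C.hvec_def)
  show "J1 A D (p, u) w \<in> tangent_space TA (p, u)" "J1 A D (p, u) w (B c) = C.k1 ?z (w (B c))"
    using endo_by_lifts[where F="\<lambda>a b. vlift A (p, u) a - hlift A D (p, u) b"
        and f="\<lambda>a b. C.hvec ?z (- b) a", OF u w c F]
    unfolding J1_def C.k1_def by simp_all
qed

text \<open>The induced charts are indexed by the charts of the base, so the criterion for the bundle is
  stated with coordinate expressions indexed by the latter.\<close>

lemma bundle_complex_structure_iff:
  assumes K_tangent: "\<And>p u c w. u \<in> tangent_space A p \<Longrightarrow> w \<in> tangent_space TA (p, u) \<Longrightarrow> c \<in> charts_at A p \<Longrightarrow>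
      K (p, u) w \<in> tangent_space TA (p, u)"
    and K_component: "\<And>p u c w. u \<in> tangent_space A p \<Longrightarrow> w \<in> tangent_space TA (p, u) \<Longrightarrow> c \<in> charts_at A p \<Longrightarrow>
      K (p, u) w (B c) = k c (snd c p, u c) (w (B c))"
    and k: "\<And>c. c \<in> A \<Longrightarrow> complex_field (snd c ` fst c \<times> UNIV) (k c)"
  shows "complex_structure TA K \<longleftrightarrow> (\<forall>c\<in>A. \<forall>x\<in>snd c ` fst c. \<forall>y u v. nij (k c) (x, y) u v = 0)"
proof -
  define ch where "ch = inv_into A B"
  have ch: "ch (B c) = c" if "c \<in> A" for c
    unfolding ch_def using that by (intro inv_into_f_f inj_onI) (simp_all add: B_inject)
  have "complex_structure TA K \<longleftrightarrow> (\<forall>C\<in>TA. \<forall>z\<in>snd C ` fst C. \<forall>u v. nij (k (ch C)) z u v = 0)"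
  proof (rule T.complex_structure_iff)
    fix z w assume z: "z \<in> points TA" and w: "w \<in> tangent_space TA z"
    obtain p u where pu: "z = (p, u)" by (cases z)
    then have "p \<in> points A" "u \<in> tangent_space A p"
      using z by (simp_all add: points_TA)
    moreover from this(1) obtain c where "c \<in> charts_at A p"
      by (force simp: points_def charts_at_def)
    ultimately show "K z w \<in> tangent_space TA z"
      using K_tangent w pu by simp
  next
    fix C z w assume C: "C \<in> charts_at TA z" and w: "w \<in> tangent_space TA z"
    obtain p u where pu: "z = (p, u)" by (cases z)
    have "z \<in> points TA"
      using C by (auto simp: points_def charts_at_def)
    then have u: "u \<in> tangent_space A p"
      by (simp add: pu points_TA)
    then obtain c where c: "C = B c" "c \<in> charts_at A p"
      using C by (auto simp: pu charts_at_TA)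
    show "K z w C = k (ch C) (snd C z) (w C)"
      using K_component[OF u _ c(2)] w ch[OF charts_atD(1)[OF c(2)]] by (simp add: pu c(1) snd_B)
  next
    fix C assume "C \<in> TA"
    then obtain c where "C = B c" "c \<in> A" by (auto simp: tangent_bundle_def)
    then show "complex_field (snd C ` fst C) (k (ch C))"
      using k ch B_range by simp
  qed
  also have "\<dots> \<longleftrightarrow> (\<forall>c\<in>A. \<forall>z\<in>snd (B c) ` fst (B c). \<forall>u v. nij (k (ch (B c))) z u v = 0)"
    unfolding tangent_bundle_def by (rule ball_image_eq)
  also have "\<dots> \<longleftrightarrow> (\<forall>c\<in>A. \<forall>z\<in>snd c ` fst c \<times> UNIV. \<forall>u v. nij (k c) z u v = 0)"
    by (intro ball_cong) (simp_all only: ch B_range)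
  also have "\<dots> \<longleftrightarrow> (\<forall>c\<in>A. \<forall>x\<in>snd c ` fst c. \<forall>y u v. nij (k c) (x, y) u v = 0)"
    unfolding ball_Times_UNIV ..
  finally show ?thesis .
qed

theorem complex_structure_J1_iff: "complex_structure TA (J1 A D) \<longleftrightarrow> flat A D"
proof -
  have "complex_structure TA (J1 A D) \<longleftrightarrow>
      (\<forall>c\<in>A. \<forall>x\<in>snd c ` fst c. \<forall>y u v. nij (chart_connection.k1 (gam c)) (x, y) u v = 0)"
    by (rule bundle_complex_structure_iff[OF J1_tangent J1_component])
      (assumption | rule chart_connection.complex_field_k1 chart_connection)+
  also have "\<dots> \<longleftrightarrow> (\<forall>c\<in>A. \<forall>x\<in>snd c ` fst c. \<forall>y a b. curv (gam c) x a b y = 0)"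
    using chart_connection.nij_k1_zero_iff[OF chart_connection] by simp
  also have "\<dots> \<longleftrightarrow> flat A D"
    unfolding flat_iff by blast
  finally show ?thesis .
qed

end

locale manifold_almost_complex = manifold_endo A D J
  for A :: "('p, 'e::euclidean_space) chart set" and D J +
  assumes square: "\<And>p v. p \<in> points A \<Longrightarrow> v \<in> tangent_space A p \<Longrightarrow> J p (J p v) = - v"
begin

lemma jmat_J:
  assumes c: "c \<in> charts_at A p" and v: "v \<in> tangent_space A p"
  shows "J p v \<in> tangent_space A p" and "J p v c = jmat c (snd c p) (v c)"
  using J_tangent[OF points_chart[OF c] v] jmat_at[OF c v] by simp_all

lemma chart_complex: "c \<in> A \<Longrightarrow> chart_complex (snd c ` fst c) (gam c) (jmat c)"
proof (rule chart_complex.intro[OF chart_connection chart_complex_axioms.intro])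
  fix x a assume c: "c \<in> A" and "x \<in> snd c ` fst c"
  then obtain p where p: "p \<in> fst c" "x = snd c p" by auto
  note at = charts_atI[OF c p(1)]
  note t = coord_field_tangent[OF at, of a]
  have "jmat c x (jmat c x a) = J p (J p (coord_field A c a p)) c"
    using jmat_J(2)[OF at t] jmat_J(2)[OF at jmat_J(1)[OF at t]] at p(2) by simp
  then show "jmat c x (jmat c x a) = - a"
    using square[OF points_chart[OF at] t] at by simp
qed (auto intro: jmat_linear jmat_smooth)

lemma J2_in_chart:
  assumes u: "u \<in> tangent_space A p" and w: "w \<in> tangent_space TA (p, u)" and c: "c \<in> charts_at A p"
  shows J2_tangent: "J2 A D J (p, u) w \<in> tangent_space TA (p, u)"
    and J2_component: "J2 A D J (p, u) w (B c) = chart_complex.k2 (gam c) (jmat c) (snd c p, u c) (w (B c))"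
proof -
  interpret C: chart_complex "snd c ` fst c" "gam c" "jmat c"
      by (rule chart_complex[OF charts_atD(1)[OF c]])
  let ?z = "(snd c p, u c)"
  have F: "vlift A (p, u) (J p a) + hlift A D (p, u) (J p b) \<in> tangent_space TA (p, u)"
    "(vlift A (p, u) (J p a) + hlift A D (p, u) (J p b)) (B c)
      = C.hvec ?z (jmat c (snd c p) (b c)) (jmat c (snd c p) (a c))"
    if a: "a \<in> tangent_space A p" and b: "b \<in> tangent_space A p" for a b
    using hlift_in_chart[OF u jmat_J(1)[OF c b] c] vlift_in_chart[OF u jmat_J(1)[OF c a] c]
        jmat_J(2)[OF c a] jmat_J(2)[OF c b] charts_atD[OF c]
    by (simp_all add: T.tangent_space_add C.hvec_def)
  show "J2 A D J (p, u) w \<in> tangent_space TA (p, u)" "J2 A D J (p, u) w (B c) = C.k2 ?z (w (B c))"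
    using endo_by_lifts[where F="\<lambda>a b. vlift A (p, u) (J p a) + hlift A D (p, u) (J p b)"
        and f="\<lambda>a b. C.hvec ?z (jmat c (snd c p) b) (jmat c (snd c p) a)", OF u w c F]
    unfolding J2_def C.k2_def by simp_all
qed

lemma J3_in_chart:
  assumes u: "u \<in> tangent_space A p" and w: "w \<in> tangent_space TA (p, u)" and c: "c \<in> charts_at A p"
  shows J3_tangent: "J3 A D J (p, u) w \<in> tangent_space TA (p, u)"
    and J3_component: "J3 A D J (p, u) w (B c) = chart_complex.k3 (gam c) (jmat c) (snd c p, u c) (w (B c))"
proof -
  interpret C: chart_complex "snd c ` fst c" "gam c" "jmat c"
      by (rule chart_complex[OF charts_atD(1)[OF c]])
  show "J3 A D J (p, u) w \<in> tangent_space TA (p, u)"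
      "J3 A D J (p, u) w (B c) = C.k3 (snd c p, u c) (w (B c))"
    using J1_in_chart[OF u J2_tangent[OF assms] c] J2_component[OF assms] by (simp_all add: J3_def C.k3_eq)
qed

end

section \<open>The metric\<close>

text \<open>The values of \<open>h v\<close> on the basis are nonzero multiples of the coefficients of \<open>v\<close>.\<close>

lemma nondegenerate_of_orthogonal_basis:
  fixes e :: "nat \<Rightarrow> 'v::real_vector" and h :: "'v \<Rightarrow> 'v \<Rightarrow> real"
  assumes span: "span (e ` {..<N}) = T"
    and lin: "\<And>w. w \<in> T \<Longrightarrow> linear_on T (\<lambda>v. h v w)"
    and orth: "\<And>i j. i < N \<Longrightarrow> j < N \<Longrightarrow> i \<noteq> j \<Longrightarrow> h (e i) (e j) = 0"
    and norm: "\<And>i. i < N \<Longrightarrow> h (e i) (e i) \<noteq> 0"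
    and v: "v \<in> T" and zero: "\<And>w. w \<in> T \<Longrightarrow> h v w = 0"
  shows "v = 0"
proof -
  have e: "e i \<in> T" if "i < N" for i
    using that span_base[of "e i" "e ` {..<N}"] span by auto
  have inj: "inj_on e {..<N}"
    using orth norm by (metis inj_onI lessThan_iff)
  have sub: "subspace T"
    using span subspace_span by metis
  have L: "h (a *\<^sub>R x + b *\<^sub>R y) w = a * h x w + b * h y w" if "x \<in> T" "y \<in> T" "w \<in> T" for a b x y w
    using lin[OF that(3)] that(1,2) by (simp add: linear_on_def)
  have h0: "h 0 w = 0" if "w \<in> T" for w
    using L[OF that that that, of 0 0] by simp
  have h_add: "h (x + y) w = h x w + h y w" and h_scale: "h (r *\<^sub>R x) w = r * h x w"
    if "x \<in> T" "y \<in> T" "w \<in> T" for x y r w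
    using L[OF that, of 1 1] L[OF that, of r 0] by simp_all
  have h_sum: "h (\<Sum>i\<in>I. r i *\<^sub>R e i) w = (\<Sum>i\<in>I. r i * h (e i) w)"
    if "I \<subseteq> {..<N}" "w \<in> T" for I r w
    using that
  proof (induction I rule: infinite_finite_induct)
    case (insert i I)
    then have "(\<Sum>i\<in>I. r i *\<^sub>R e i) \<in> T" "r i *\<^sub>R e i \<in> T" "e i \<in> T"
      using sub e by (auto intro!: subspace_sum subspace_scale)
    then show ?case
      using insert h_add h_scale by simp
  qed (use h0 subspace_0[OF sub] in auto)
  obtain s where s: "v = (\<Sum>x\<in>e ` {..<N}. s x *\<^sub>R x)"
    using v span span_finite[of "e ` {..<N}"] by auto
  then have v_eq: "v = (\<Sum>i<N. s (e i) *\<^sub>R e i)"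
    by (simp add: sum.reindex[OF inj])
  have "s (e j) = 0" if j: "j < N" for j
  proof -
    have "0 = (\<Sum>i<N. s (e i) * h (e i) (e j))"
      using zero[OF e[OF j]] h_sum[OF order_refl e[OF j], of "\<lambda>i. s (e i)"] v_eq by simp
    also have "\<dots> = (\<Sum>i<N. if i = j then s (e j) * h (e j) (e j) else 0)"
      using orth j by (intro sum.cong) auto
    also have "\<dots> = s (e j) * h (e j) (e j)"
      using j by simp
    finally show ?thesis using norm[OF j] by simp
  qed
  then show ?thesis using v_eq by simp
qed

locale skew_hermitian_manifold = manifold_almost_complex A D J
  for A :: "('p, 'e::euclidean_space) chart set" and D J +
  fixes g :: "'p \<Rightarrow> ('p, 'e) tvec \<Rightarrow> ('p, 'e) tvec \<Rightarrow> real" and m n :: nat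
  assumes metric: "pseudo_riemannian_metric m n A g"
    and skew: "\<And>p v w. p \<in> points A \<Longrightarrow> v \<in> tangent_space A p \<Longrightarrow> w \<in> tangent_space A p
        \<Longrightarrow> g p (J p v) (J p w) = - g p v w"
    and compatible: "\<And>U X Y Z p. \<lbrakk>openin (manifold_topology A) U; vector_field A U X; vector_field A U Y;
       vector_field A U Z; p \<in> U\<rbrakk> \<Longrightarrow>
       dir_deriv A p (X p) (\<lambda>q. g q (Y q) (Z q)) = g p (D X Y p) (Z p) + g p (Y p) (D X Z p)"
begin

definition gmat :: "('p, 'e) chart \<Rightarrow> 'e \<Rightarrow> 'e \<Rightarrow> 'e \<Rightarrow> real" where
  "gmat c x a b = g (chart_inv c x) (coord_field A c a (chart_inv c x)) (coord_field A c b (chart_inv c x))"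

lemma g_sym: "p \<in> points A \<Longrightarrow> v \<in> tangent_space A p \<Longrightarrow> w \<in> tangent_space A p \<Longrightarrow> g p v w = g p w v"
  and g_linear: "p \<in> points A \<Longrightarrow> w \<in> tangent_space A p \<Longrightarrow> linear_on (tangent_space A p) (\<lambda>v. g p v w)"
  using conjunct1[OF metric[unfolded pseudo_riemannian_metric_def]] by simp_all

lemma g_nondegenerate:
  assumes p: "p \<in> points A" and v: "v \<in> tangent_space A p"
      and zero: "\<And>w. w \<in> tangent_space A p \<Longrightarrow> g p v w = 0"
  shows "v = 0"
proof -
  obtain e :: "nat \<Rightarrow> ('p, 'e) tvec" where e: "span (e ` {..<m + n}) = tangent_space A p"
    "\<And>i j. i < m + n \<Longrightarrow> j < m + n \<Longrightarrow> g p (e i) (e j) = (if i \<noteq> j then 0 else if i < m then 1 else - 1)"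
    using bspec[OF conjunct1[OF metric[unfolded pseudo_riemannian_metric_def]] p] by blast
  show ?thesis
    by (rule nondegenerate_of_orthogonal_basis[OF e(1), of "g p"]) (use e(2) g_linear[OF p] v zero in auto)
qed

lemma gmat_at:
  "c \<in> charts_at A p \<Longrightarrow> v \<in> tangent_space A p \<Longrightarrow> w \<in> tangent_space A p
    \<Longrightarrow> gmat c (snd c p) (v c) (w c) = g p v w"
  by (simp add: gmat_def coord_field_eq charts_atD)

lemma gmat_sym: "c \<in> A \<Longrightarrow> x \<in> snd c ` fst c \<Longrightarrow> gmat c x a b = gmat c x b a"
  by (auto simp: gmat_def intro!: g_sym coord_field_tangent charts_atI points_chart)

lemma gmat_linear: "c \<in> A \<Longrightarrow> x \<in> snd c ` fst c \<Longrightarrow> linear (\<lambda>a. gmat c x a b)"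
proof -
  assume c: "c \<in> A" and "x \<in> snd c ` fst c"
  then obtain p where p: "p \<in> fst c" "x = snd c p" by auto
  note at = charts_atI[OF c p(1)]
  have lin: "g p (r *\<^sub>R v + s *\<^sub>R w) (coord_field A c b p) = r * g p v (coord_field A c b p)
      + s * g p w (coord_field A c b p)"
    if "v \<in> tangent_space A p" "w \<in> tangent_space A p" for r s v w
    using g_linear[OF points_chart[OF at] coord_field_tangent[OF at]] that unfolding linear_on_def by simp
  show ?thesis
  proof (rule linearI)
    fix a a' and r :: real
    show "gmat c x (a + a') b = gmat c x a b + gmat c x a' b"
      using lin[OF coord_field_tangent[OF at, of a] coord_field_tangent[OF at, of a'], of 1 1] c p at
      by (simp add: gmat_def coord_field_add)
    show "gmat c x (r *\<^sub>R a) b = r *\<^sub>R gmat c x a b"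
      using lin[OF coord_field_tangent[OF at, of a] coord_field_tangent[OF at, of a], of r 0] c p at
      by (simp add: gmat_def coord_field_scale)
  qed
qed

lemma gmat_smooth:
  assumes c: "c \<in> A" shows "smooth_on (snd c ` fst c) (\<lambda>x. gmat c x a b)"
proof -
  note V = open_chart_range[OF c]
  have basis: "smooth_on (snd c ` fst c) (\<lambda>x. gmat c x i j)" if "i \<in> Basis" "j \<in> Basis" for i j
    using conjunct2[OF metric[unfolded pseudo_riemannian_metric_def]] c that unfolding gmat_def by blast
  have right: "smooth_on (snd c ` fst c) (\<lambda>x. gmat c x a j)" if "j \<in> Basis" for j
    by (rule smooth_on_linear_family[where F="\<lambda>x a. gmat c x a j"
        and a="\<lambda>_. a", OF V gmat_linear[OF c] basis[OF _ that] smooth_on_const])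
  have "linear (gmat c x a)" if "x \<in> snd c ` fst c" for x
  proof -
    have "gmat c x a = (\<lambda>b. gmat c x b a)"
      using gmat_sym[OF c that] by auto
    then show ?thesis using gmat_linear[OF c that, of a] by simp
  qed
  then show ?thesis
    by (rule smooth_on_linear_family[where F="\<lambda>x. gmat c x a" and a="\<lambda>_. b", OF V _ right smooth_on_const])
qed

lemma chart_skew_hermitian:
  assumes c: "c \<in> A" shows "chart_skew_hermitian (snd c ` fst c) (gam c) (jmat c) (gmat c)"
proof (rule chart_skew_hermitian.intro[OF chart_complex[OF c] chart_skew_hermitian_axioms.intro])
  fix x a b d assume "x \<in> snd c ` fst c"
  then obtain p where p: "p \<in> fst c" "x = snd c p" by auto
  note at = charts_atI[OF c p(1)]
  note t = coord_field_tangent[OF at] and P = points_chart[OF at]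
  show "a = 0" if *: "\<And>b. gmat c x a b = 0"
  proof -
    have "g p (coord_field A c a p) w = 0" if "w \<in> tangent_space A p" for w
      using *[of "w c"] gmat_at[OF at t that, of a] at p(2) by simp
    then have "coord_field A c a p = 0"
      by (rule g_nondegenerate[OF P t])
    then show "a = 0"
      using coord_field_self[OF at, of a] by simp
  qed
  show "gmat c x (jmat c x a) (jmat c x b) = - gmat c x a b"
    using skew[OF P t t, of a b] gmat_at[OF at t t, of a b]
        gmat_at[OF at jmat_J(1)[OF at t] jmat_J(1)[OF at t], of a b]
      jmat_J(2)[OF at t] at p(2) by simp
  show "fd (\<lambda>y. gmat c y b d) x a = gmat c x (gam c x a b) d + gmat c x b (gam c x a d)"
  proof -
    let ?E = "coord_field A c"
    note vf = vector_field_coord[OF c] and U = openin_chart[OF c]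
    have "(\<lambda>q. g q (?E b q) (?E d q)) \<circ> chart_inv c = (\<lambda>y. gmat c y b d)"
      by (simp add: gmat_def comp_def)
    then have "dir_deriv A p (?E a p) (\<lambda>q. g q (?E b q) (?E d q)) = fd (\<lambda>y. gmat c y b d) x a"
      using dir_deriv_in_chart[OF at t, of "\<lambda>q. g q (?E b q) (?E d q)" a]
        smooth_on_differentiable[OF gmat_smooth[OF c]] at p by simp
    moreover have "D (?E a) (?E b) p \<in> tangent_space A p" "D (?E a) (?E d) p \<in> tangent_space A p"
      by (rule D_tangent[OF U vf vf p(1)])+
    ultimately show ?thesis
      using compatible[OF U vf vf vf p(1), of a b d] gmat_at[OF at _ t, of "D (?E a) (?E b) p" d]
        gmat_at[OF at t, of "D (?E a) (?E d) p" b] D_coord_field[OF at] at p c by simp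
  qed
qed (use c in \<open>auto intro: gmat_linear gmat_sym gmat_smooth\<close>)

theorem complex_structure_J2_iff: "complex_structure TA (J2 A D J) \<longleftrightarrow> flat A D \<and> parallel A D J"
proof -
  have "complex_structure TA (J2 A D J) \<longleftrightarrow>
      (\<forall>c\<in>A. \<forall>x\<in>snd c ` fst c. \<forall>y u v. nij (chart_complex.k2 (gam c) (jmat c)) (x, y) u v = 0)"
    by (rule bundle_complex_structure_iff[OF J2_tangent J2_component])
      (assumption | rule chart_complex.complex_field_k2 chart_complex)+
  also have "\<dots> \<longleftrightarrow> (\<forall>c\<in>A. (\<forall>x\<in>snd c ` fst c. \<forall>a b v. curv (gam c) x a b v = 0) \<and>
      (\<forall>x\<in>snd c ` fst c. \<forall>a b. cov_endo (gam c) (jmat c) x a b = 0))"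
    by (intro ball_cong refl chart_skew_hermitian.nij_k2_zero_all_iff[OF chart_skew_hermitian])
  also have "\<dots> \<longleftrightarrow> flat A D \<and> parallel A D J"
    unfolding flat_iff parallel_iff by (rule ball_conj_distrib)
  finally show ?thesis .
qed

theorem complex_structure_J3_iff: "complex_structure TA (J3 A D J) \<longleftrightarrow> flat A D \<and> parallel A D J"
proof -
  have "complex_structure TA (J3 A D J) \<longleftrightarrow>
      (\<forall>c\<in>A. \<forall>x\<in>snd c ` fst c. \<forall>y u v. nij (chart_complex.k3 (gam c) (jmat c)) (x, y) u v = 0)"
    by (rule bundle_complex_structure_iff[OF J3_tangent J3_component])
      (assumption | rule chart_complex.complex_field_k3 chart_complex)+
  also have "\<dots> \<longleftrightarrow> (\<forall>c\<in>A. (\<forall>x\<in>snd c ` fst c. \<forall>a b v. curv (gam c) x a b v = 0) \<and>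
      (\<forall>x\<in>snd c ` fst c. \<forall>a b. cov_endo (gam c) (jmat c) x a b = 0))"
    by (intro ball_cong refl chart_skew_hermitian.nij_k3_zero_all_iff[OF chart_skew_hermitian])
  also have "\<dots> \<longleftrightarrow> flat A D \<and> parallel A D J"
    unfolding flat_iff parallel_iff by (rule ball_conj_distrib)
  finally show ?thesis .
qed

end

lemma skew_hermitian_manifold:
  assumes "almost_skew_hermitian n A J g gt" and "levi_civita A g D"
  shows "skew_hermitian_manifold A D J g n n"
proof unfold_locales
  show "smooth_atlas A"
    using assms(1) by (simp add: almost_skew_hermitian_def smooth_manifold_def)
  show "connection A D"
    using assms(2) by (simp add: levi_civita_def)
  show "endo_field A J"
    using assms(1) by (simp add: almost_skew_hermitian_def almost_complex_def)
  show "pseudo_riemannian_metric n n A g"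
    using assms(1) by (simp add: almost_skew_hermitian_def)
  show "J p (J p v) = - v" if "p \<in> points A" "v \<in> tangent_space A p" for p v
    using assms(1) that by (simp add: almost_skew_hermitian_def almost_complex_def)
  show "g p (J p v) (J p w) = - g p v w"
    if "p \<in> points A" "v \<in> tangent_space A p" "w \<in> tangent_space A p" for p v w
    using assms(1) that by (simp add: almost_skew_hermitian_def)
  fix U X Y Z p
  assume "openin (manifold_topology A) U" "vector_field A U X" "vector_field A U Y" "p \<in> U"
  then show "D X Y p - D Y X p = lie_bracket A X Y p"
    using assms(2) unfolding levi_civita_def by blast
  assume "vector_field A U Z"
  with \<open>openin _ _\<close> \<open>vector_field A U X\<close> \<open>vector_field A U Y\<close> \<open>p \<in> U\<close>
  show "dir_deriv A p (X p) (\<lambda>q. g q (Y q) (Z q)) = g p (D X Y p) (Z p) + g p (Y p) (D X Z p)"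
    using assms(2) unfolding levi_civita_def by blast
qed

text \<open>The hypercomplex case is the conjunction of the three others, in which the condition for
  \<open>J\<^sub>1\<close> is implied by that for \<open>J\<^sub>2\<close>.\<close>

theorem theorem3p4:
  fixes A :: "('p, 'e::euclidean_space) chart set"
    and J :: "'p \<Rightarrow> ('p, 'e) tvec \<Rightarrow> ('p, 'e) tvec"
    and g gt :: "'p \<Rightarrow> ('p, 'e) tvec \<Rightarrow> ('p, 'e) tvec \<Rightarrow> real"
    and D :: "('p, 'e) vfield \<Rightarrow> ('p, 'e) vfield \<Rightarrow> ('p, 'e) vfield"
    and n :: nat
  assumes "almost_skew_hermitian n A J g gt"
    and "levi_civita A g D"
  shows "(complex_structure (tangent_bundle A) (J1 A D) \<longleftrightarrow> flat A D) \<and>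
    (\<forall>K\<in>{J2 A D J, J3 A D J}.
       complex_structure (tangent_bundle A) K \<longleftrightarrow> flat A D \<and> parallel A D J) \<and>
    (hypercomplex_structure (tangent_bundle A) (J1 A D) (J2 A D J) (J3 A D J) \<longleftrightarrow>
       flat A D \<and> parallel A D J)"
proof -
  interpret skew_hermitian_manifold A D J g n n
    by (rule skew_hermitian_manifold[OF assms])
  show ?thesis
    using complex_structure_J1_iff complex_structure_J2_iff complex_structure_J3_iff
    by (auto simp: hypercomplex_structure_def)
qed

end
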